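(* Let $C$ be a proper polyhedral cone of arbitrary finite dimension. If $C$ has a three-dimensional face with at least five extreme rays, or a three-dimensional face quotient $C/F$ (for some face $F$ of $C$) with at least five extreme rays, then $C^{\min}$ is not subhomogeneous.
   Context: A proper polyhedral cone $C\subseteq V$ in a finite-dimensional real vector space is a finitely generated convex cone that is pointed ($C\cap(-C)=\{0\}$) and has nonempty interior. A face of $C$ is a convex subcone $F\subseteq C$ such that $c_1,c_2\in C$ and $c_1+c_2\in F$ imply $c_1,c_2\in F$; its dimension is $\dim\operatorname{span}F$. For a face $F$ of $C$, the face quotient is $C/F=q(C)\subseteq V/\operatorname{span}F$, where $q:V\to V/\operatorname{span}F$ is the quotient map; it is a proper polyhedral cone in $V/\operatorname{span}F$. Minimal operator system: an interior point $u$ of $C$ is (arbitrarily) fixed. With $\operatorname{Her}_s$ the complex Hermitian $s\times s$ matrices and $\operatorname{Her}_s(V)=\operatorname{Her}_s\otimes_{\mathbb R}V$, set $C_s^{\min}=\operatorname{cone}\{A\otimes c\mid A\in\operatorname{Her}_s,\ A\geqslant0,\ c\in C\}\subseteq\operatorname{Her}_s(V)$ and $C^{\min}=(V,(C_s^{\min})_{s\geqslant1},u)$, with matrix order unit $I_s\otimes u$ at level $s$. It is called $d$-subhomogeneous if it admits a unital complete order embedding into $\operatorname{Mat}_d(\mathcal A)$ for some commutative $C^*$-algebra $\mathcal A$, i.e. a real-linear map $\Phi$ from $V$ to the Hermitian elements of $\operatorname{Mat}_d(\mathcal A)$ with $\Phi(u)=1$ such that for all $s\geqslant1$ and $X\in\operatorname{Her}_s(V)$: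 $X\in C_s^{\min}$ if and only if $(\mathrm{id}\otimes\Phi)(X)\geqslant0$ in $\operatorname{Mat}_s(\operatorname{Mat}_d(\mathcal A))$. It is subhomogeneous if it is $d$-subhomogeneous for some $d\geqslant1$. *)

theory Defs
  imports "HOL-Analysis.Analysis" "Jordan_Normal_Form.Matrix"
begin

section \<open>Polyhedral cones, faces and face quotients\<close>

definition proper_polyhedral_cone :: "'a::euclidean_space set \<Rightarrow> bool" where
  "proper_polyhedral_cone C \<longleftrightarrow>
     (\<exists>S. finite S \<and> C = convex_cone hull S) \<and> C \<inter> uminus ` C = {0} \<and> interior C \<noteq> {}"

text \<open>The library's \<^const>\<open>face_of\<close> is the notion for convex sets; it also admits the empty set.\<close>

definition cone_face :: "'a::real_vector set \<Rightarrow> 'a set \<Rightarrow> bool" where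
  "cone_face F C \<longleftrightarrow> F \<subseteq> C \<and> convex_cone F \<and>
     (\<forall>x\<in>C. \<forall>y\<in>C. x + y \<in> F \<longrightarrow> x \<in> F \<and> y \<in> F)"

definition extreme_rays :: "'a::real_vector set \<Rightarrow> 'a set set" where
  "extreme_rays C = {R. cone_face R C \<and> dim (span R) = 1}"

text \<open>
  The quotient of a vector space by a subspace \<open>W\<close> is realised as the image of any linear map
  with kernel \<open>W\<close>. The two lemmas below say that such a map always exists, and that any two of
  them differ by a linear isomorphism of their images. The face quotient \<open>C/F\<close> is \<open>q ` C\<close> for
  a map \<open>q\<close> with kernel \<open>span F\<close>.
\<close>

definition linear_quotient :: "'a::real_vector set \<Rightarrow> ('a \<Rightarrow> 'b::real_vector) \<Rightarrow> bool" where
  "linear_quotient W q \<longleftrightarrow> linear q \<and> {x. q x = 0} = W"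

lemma linear_quotient_exists:
  fixes W :: "'a::real_vector set"
  assumes "subspace W"
  shows "\<exists>q :: 'a \<Rightarrow> 'a. linear_quotient W q"
proof -
  obtain g :: "'a \<Rightarrow> 'a" where g: "range g \<subseteq> W" "linear g" "\<forall>v\<in>W. g v = v"
    using linear_exists_left_inverse_on[OF linear_id assms] by auto
  have "linear (\<lambda>x. x - g x)"
    using linear_compose_sub[OF linear_id g(2)] by simp
  moreover have "{x. x - g x = 0} = W"
    using g by (auto simp: image_subset_iff) metis
  ultimately show ?thesis
    unfolding linear_quotient_def by blast
qed

lemma linear_quotient_unique:
  assumes q: "linear_quotient W q" and q': "linear_quotient W q'"
  shows "\<exists>h. linear h \<and> inj_on h (range q) \<and> (\<forall>x. h (q x) = q' x)"
proof -
  have lin: "linear q" "linear q'" and ker: "\<And>x. q x = 0 \<longleftrightarrow> q' x = 0"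
    using q q' by (auto simp: linear_quotient_def)
  have eq: "q x = q y \<longleftrightarrow> q' x = q' y" for x y
    using ker[of "x - y"] lin by (simp add: linear_diff)
  obtain g where g: "linear g" "\<forall>v\<in>range q. q (g v) = v"
    using linear_exists_right_inverse_on[OF lin(1) subspace_UNIV] by auto
  have "q' (g (q x)) = q' x" for x
    using g(2) eq by (metis rangeI)
  moreover have "linear (q' \<circ> g)"
    using g(1) lin(2) by (rule linear_compose)
  ultimately show ?thesis
    using eq by (intro exI[of _ "q' \<circ> g"]) (auto simp: inj_on_def)
qed

section \<open>Commutative unital C*-algebras\<close>

text \<open>
  Completeness and the Banach algebra norm come from the library's real classes. The class
  contains all commutative unital C*-algebras except the zero algebra. Over the zero algebra
  every matrix is positive, so a proper cone in a nonzero space has no order embedding there.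
\<close>

class comm_cstar_algebra = real_normed_algebra_1 + comm_ring_1 + banach +
  fixes cscale :: "complex \<Rightarrow> 'a \<Rightarrow> 'a"
    and star :: "'a \<Rightarrow> 'a"
  assumes cscale_add_right: "cscale z (a + b) = cscale z a + cscale z b"
    and cscale_add_left: "cscale (z + w) a = cscale z a + cscale w a"
    and cscale_cscale: "cscale z (cscale w a) = cscale (z * w) a"
    and cscale_of_real: "cscale (complex_of_real r) a = r *\<^sub>R a"
    and cscale_mult_left: "cscale z a * b = cscale z (a * b)"
    and norm_cscale: "norm (cscale z a) = cmod z * norm a"
    and star_star: "star (star a) = a"
    and star_add: "star (a + b) = star a + star b"
    and star_cscale: "star (cscale z a) = cscale (cnj z) (star a)"
    and star_mult: "star (a * b) = star b * star a"
    and norm_star_mult: "norm (star a * a) = (norm a)\<^sup>2"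

instantiation complex :: comm_cstar_algebra
begin

definition cscale_complex :: "complex \<Rightarrow> complex \<Rightarrow> complex" where
  "cscale_complex z w = z * w"

definition star_complex :: "complex \<Rightarrow> complex" where
  "star_complex z = cnj z"

instance
  by standard
    (simp_all add: cscale_complex_def star_complex_def algebra_simps norm_mult
      scaleR_conv_of_real power2_eq_square)

end

definition mat_star :: "'b::comm_cstar_algebra mat \<Rightarrow> 'b mat" where
  "mat_star X = map_mat star (transpose_mat X)"

text \<open>Positivity in the C*-algebra of \<open>n \<times> n\<close> matrices over a commutative C*-algebra.\<close>

definition mat_pos :: "nat \<Rightarrow> 'b::comm_cstar_algebra mat \<Rightarrow> bool" where
  "mat_pos n X \<longleftrightarrow> (\<exists>Y \<in> carrier_mat n n. X = mat_star Y * Y)"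

section \<open>Hermitian matrices over a real vector space and the minimal operator system\<close>

definition psd_mat :: "nat \<Rightarrow> complex mat \<Rightarrow> bool" where
  "psd_mat s A \<longleftrightarrow> A \<in> carrier_mat s s \<and> mat_star A = A \<and>
     (\<forall>v \<in> carrier_vec s. 0 \<le> (A *\<^sub>v v) \<bullet>c v)"

text \<open>
  The real tensor product of the Hermitian \<open>s \<times> s\<close> matrices with a real vector space \<open>V\<close> is
  identified with the Hermitian \<open>s \<times> s\<close> matrices over the complexification of \<open>V\<close>. An element
  \<open>x + \<i> y\<close> of the complexification is the pair \<open>(x, y)\<close>, with conjugate \<open>(x, - y)\<close>. The
  elementary tensor of \<open>A\<close> and \<open>c\<close> has the entries \<open>A\<^sub>i\<^sub>j c\<close>.
\<close>

definition her_mat :: "nat \<Rightarrow> ('a::real_vector \<times> 'a) mat set" where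
  "her_mat s = {X \<in> carrier_mat s s. \<forall>i<s. \<forall>j<s.
     X $$ (j, i) = (fst (X $$ (i, j)), - snd (X $$ (i, j)))}"

definition elem_tensor :: "complex mat \<Rightarrow> 'a::real_vector \<Rightarrow> ('a \<times> 'a) mat" where
  "elem_tensor A c = map_mat (\<lambda>z. (Re z *\<^sub>R c, Im z *\<^sub>R c)) A"

definition min_cone :: "'a::real_vector set \<Rightarrow> nat \<Rightarrow> ('a \<times> 'a) mat set" where
  "min_cone C s = {X. \<exists>(n::nat) (t :: nat \<Rightarrow> real) A c.
     (\<forall>k<n. 0 \<le> t k \<and> psd_mat s (A k) \<and> c k \<in> C) \<and>
     X = Matrix.mat s s (\<lambda>ij. \<Sum>k<n. t k *\<^sub>R (elem_tensor (A k) (c k) $$ ij))}"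

section \<open>Subhomogeneity\<close>

text \<open>
  \<open>amplify d \<Phi> X\<close> is \<open>(id \<otimes> \<Phi>)(X)\<close>, where an \<open>s \<times> s\<close> matrix of \<open>d \<times> d\<close> blocks is flattened
  to an \<open>(s * d) \<times> (s * d)\<close> matrix: the entry at \<open>(i * d + a, j * d + b)\<close> is the entry at
  \<open>(a, b)\<close> of the block at \<open>(i, j)\<close>, and the block is \<open>\<Phi> x + \<i> \<Phi> y\<close> for \<open>X\<^sub>i\<^sub>j = (x, y)\<close>.
\<close>

definition amplify ::
  "nat \<Rightarrow> ('a::real_vector \<Rightarrow> 'b::comm_cstar_algebra mat) \<Rightarrow> ('a \<times> 'a) mat \<Rightarrow> 'b mat" where
  "amplify d \<Phi> X = Matrix.mat (dim_row X * d) (dim_col X * d) (\<lambda>(p, r).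
     let (x, y) = X $$ (p div d, r div d)
     in \<Phi> x $$ (p mod d, r mod d) + cscale \<i> (\<Phi> y $$ (p mod d, r mod d)))"

text \<open>
  An operator system on \<open>V\<close> is given by its matrix cones \<open>K s\<close>, \<open>s \<ge> 1\<close>, and its order unit \<open>u\<close>.
  The C*-algebra is the type argument \<open>'b\<close>. HOL has no quantification over types inside a formula,
  so ``subhomogeneous'' means that the predicate holds for some type \<open>'b\<close>, and ``not subhomogeneous''
  is the negated predicate with \<open>'b\<close> left arbitrary.
\<close>

definition subhomogeneous_of_degree ::
  "'b::comm_cstar_algebra itself \<Rightarrow> nat \<Rightarrow> (nat \<Rightarrow> ('a::real_vector \<times> 'a) mat set) \<Rightarrow> 'a \<Rightarrow> bool"
where
  "subhomogeneous_of_degree _ d K u \<longleftrightarrow> (\<exists>\<Phi> :: 'a \<Rightarrow> 'b mat.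
     (\<forall>v. \<Phi> v \<in> carrier_mat d d \<and> mat_star (\<Phi> v) = \<Phi> v) \<and>
     (\<forall>a<d. \<forall>b<d. linear (\<lambda>v. \<Phi> v $$ (a, b))) \<and>
     \<Phi> u = 1\<^sub>m d \<and>
     (\<forall>s\<ge>1. \<forall>X \<in> her_mat s. X \<in> K s \<longleftrightarrow> mat_pos (s * d) (amplify d \<Phi> X)))"

definition subhomogeneous ::
  "'b::comm_cstar_algebra itself \<Rightarrow> (nat \<Rightarrow> ('a::real_vector \<times> 'a) mat set) \<Rightarrow> 'a \<Rightarrow> bool"
where
  "subhomogeneous A K u \<longleftrightarrow> (\<exists>d\<ge>1. subhomogeneous_of_degree A d K u)"

end

(*
  Restricting and quotienting reduces the question to five consecutive rays c_0, ..., c_4 of a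
  three-dimensional cone, scaled such that c_0 = c_1 - c_2 + c_3 and c_4 = a c_1 - c_2 + b c_3 with
  0 < a < 1 < b.

  For every n there is a positive map phi from the cone into the real symmetric 2n x 2n matrices
  which is so degenerate on the five rays that a tuple of positive semidefinite matrices with the
  same two relations and vanishing on the five kernels is a multiple of (phi(c_i)). Since the sum
  of the phi(c_i) is invertible, such a tuple with a common null vector is zero, and by compactness
  this persists with a gap delta > 0. Let X be the sum of the tensors p p^T (x) c_i over the chosen
  null vectors p of phi(c_i), minus delta I (x) (c_0 + ... + c_4), plus a small multiple of I (x) u.
  Pairing with phi shows that X is not in the minimal cone. A positive map into d x d matrices with
  d < 2n produces only tuples with a common null vector, so its amplification is positive definite
  at X. By Gelfand theory for the commutative algebra, positive definiteness at all characters
  makes the image of X in the matrices over the algebra positive.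
*)
theory Submission
  imports Defs "HOL-Computational_Algebra.Formal_Power_Series" "Jordan_Normal_Form.Determinant"
begin

subsection \<open>Self-adjoint elements and square roots\<close>

text \<open>phi sends \<open>c 1\<close>, \<open>c 2\<close>, \<open>c 3\<close> to diag(M^-1, 0),
  the matrix with four identity blocks, and diag(0, N^-1). By Schur complements, positivity at
  \<open>c 0\<close> and \<open>c 4\<close> amounts to M + N <= 1 and M/a + N/b <= 1. The gaps are
  chosen in general position: 1 - M - N = v v^T with v nowhere zero, and 1 - M/a - N/b is diagonal
  with distinct entries, one of them 0. A competing tuple is governed by one Hermitian matrix
  commuting with M and N, hence with both gaps, hence scalar.

  The obstacle is that phi must be positive on all other rays too. In coordinates (x, y, w) along
  \<open>c 1\<close>, \<open>c 2\<close>, \<open>c 3\<close>, scaled to y = -1 where y < 0, such a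
  ray has x > a and w > 1: the planes through \<open>c 0\<close>, \<open>c 1\<close> and through
  \<open>c 3\<close>, \<open>c 4\<close> meet in (a, -1, 1). At this corner M = a E, N = 1 - E with
  a projection E give M/a + N = 1, so beyond it there is room to perturb this pair into general
  position. Finitely many rays leave a uniform margin. Off a three-dimensional face, a large
  multiple of an exposing functional times the identity restores positivity.\<close>

lemma star_zero [simp]: "star (0::'b::comm_cstar_algebra) = 0"
  using star_add[of "0::'b" 0] by simp

lemma star_minus: "star (- a) = - star (a::'b::comm_cstar_algebra)"
  using star_add[of a "- a"] by (simp add: add_eq_0_iff)

lemma star_diff: "star (a - b) = star a - star (b::'b::comm_cstar_algebra)"
  using star_add[of a "- b"] by (simp add: star_minus)

lemma star_one [simp]: "star (1::'b::comm_cstar_algebra) = 1"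
  by (metis mult.right_neutral star_mult star_star)

lemma star_scaleR: "star (r *\<^sub>R a) = r *\<^sub>R star (a::'b::comm_cstar_algebra)"
  using star_cscale[of "complex_of_real r" a] by (simp add: cscale_of_real)

lemma star_of_real [simp]: "star (of_real r) = (of_real r :: 'b::comm_cstar_algebra)"
  by (simp add: of_real_def star_scaleR)

lemma star_of_real_mult: "star (of_real r * a) = of_real r * star (a::'b::comm_cstar_algebra)"
  by (simp add: star_mult mult.commute)

lemma star_power: "star (a ^ k) = star a ^ k" for a :: "'b::comm_cstar_algebra"
  by (induction k) (auto simp: star_mult mult.commute)

lemma norm_star: "norm (star a) = norm (a::'b::comm_cstar_algebra)"
proof -
  have le: "norm b \<le> norm (star b)" for b :: 'b
  proof (cases "norm b = 0")
    case False
    have "norm b * norm b \<le> norm (star b) * norm b"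
      using norm_mult_ineq[of "star b" b] by (simp add: norm_star_mult power2_eq_square)
    with False show ?thesis by simp
  qed simp
  from le[of a] le[of "star a"] show ?thesis by (simp add: star_star)
qed

lemma bounded_linear_star: "bounded_linear (star :: 'b \<Rightarrow> 'b::comm_cstar_algebra)"
  by (intro bounded_linear_intro[where K = 1])
     (simp_all add: star_add star_scaleR norm_star)

lemma cscale_zero_right [simp]: "cscale z (0::'b::comm_cstar_algebra) = 0"
  using cscale_add_right[of z "0::'b" 0] by simp

lemma cscale_minus_right: "cscale z (- a) = - cscale z (a::'b::comm_cstar_algebra)"
  using cscale_add_right[of z a "- a"] by (simp add: add_eq_0_iff)

lemma cscale_diff_right: "cscale z (a - b) = cscale z a - cscale z (b::'b::comm_cstar_algebra)"
  using cscale_add_right[of z a "- b"] by (simp add: cscale_minus_right)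

lemma cscale_one [simp]: "cscale 1 a = (a::'b::comm_cstar_algebra)"
  using cscale_of_real[of 1 a] by simp

lemma cscale_zero_left [simp]: "cscale 0 a = (0::'b::comm_cstar_algebra)"
  using cscale_of_real[of 0 a] by simp

lemma cscale_minus_left: "cscale (- z) a = - cscale z (a::'b::comm_cstar_algebra)"
  using cscale_add_left[of z "- z" a] by (simp add: add_eq_0_iff)

lemma cscale_mult_right: "a * cscale z b = cscale z (a * b)" for a :: "'b::comm_cstar_algebra"
  using cscale_mult_left[of z b a] by (simp add: mult.commute)

text \<open>The ratio of consecutive coefficients, (1/2 - k)/(k + 1), has modulus at most 1.
  Comparison with the geometric series then makes the binomial series for the square root absolutely
  convergent inside the unit ball.\<close>

lemma abs_half_gchoose_le: "\<bar>(1/2::real) gchoose k\<bar> \<le> 1"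
proof (induction k)
  case (Suc k)
  have "\<bar>(1/2 - real k) / real (Suc k)\<bar> \<le> 1"
    by (simp add: abs_le_iff field_simps)
  moreover have "(1/2::real) gchoose Suc k = ((1/2) gchoose k) * ((1/2 - real k) / real (Suc k))"
    by (simp add: gbinomial_prod_rev prod.atLeast0_lessThan_Suc field_simps del: of_nat_Suc)
  ultimately show ?case
    using Suc by (simp only: abs_mult) (metis abs_ge_zero mult_le_one)
qed simp

text \<open>Binomial series for (1 - x)^(1/2). Its sum is self-adjoint because the coefficients are
  real and \<open>star\<close> is continuous.\<close>

lemma selfadjoint_sqrt_one_minus:
  fixes x :: "'b::comm_cstar_algebra"
  assumes "star x = x" "norm x < 1"
  obtains y where "star y = y" "y * y = 1 - x"
proof -
  define c where "c k = ((1/2::real) gchoose k) * (-1) ^ k" for k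
  have c1: "\<bar>c k\<bar> \<le> 1" for k
    using abs_half_gchoose_le[of k] by (simp add: c_def abs_mult power_abs)
  have bound: "norm (c k *\<^sub>R x ^ k) \<le> norm x ^ k" for k
    using mult_mono[OF c1[of k] norm_power_ineq[of x k]] by simp
  have geo: "summable (\<lambda>k. norm x ^ k)"
    using assms by (simp add: summable_geometric)
  have summ: "summable (\<lambda>k. norm (c k *\<^sub>R x ^ k))"
    by (rule summable_comparison_test'[OF geo, of 0]) (use bound in simp)
  define y where "y = (\<Sum>k. c k *\<^sub>R x ^ k)"
  have "star y = (\<Sum>k. star (c k *\<^sub>R x ^ k))"
    unfolding y_def
    by (rule bounded_linear.suminf[OF bounded_linear_star])
       (rule summable_norm_cancel[OF summ])
  then have "star y = y"
    by (simp add: y_def star_scaleR star_power assms)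
  \<comment> \<open>Vandermonde for 1/2 + 1/2 = 1: the square of the series has the coefficients of
    (1 - x)^1, which vanish from degree 2 on.\<close>
  have conv: "(\<Sum>i\<le>k. c i * c (k - i)) = (1 gchoose k) * (-1) ^ k" for k
  proof -
    have "(\<Sum>i\<le>k. c i * c (k - i))
        = (\<Sum>i\<le>k. ((1/2::real) gchoose i) * ((1/2) gchoose (k - i)) * (-1) ^ k)"
    proof (rule sum.cong)
      fix i assume "i \<in> {..k}"
      then have "(-1::real) ^ k = (-1) ^ i * (-1) ^ (k - i)"
        by (simp flip: power_add)
      then show "c i * c (k - i) = ((1/2::real) gchoose i) * ((1/2) gchoose (k - i)) * (-1) ^ k"
        by (simp add: c_def mult_ac)
    qed simp
    then show ?thesis
      using gbinomial_Vandermonde[of "1/2::real" "1/2" k]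
      by (simp add: sum_distrib_right[symmetric] atMost_atLeast0)
  qed
  have "(\<lambda>k. \<Sum>i\<le>k. (c i *\<^sub>R x ^ i) * (c (k - i) *\<^sub>R x ^ (k - i))) sums (y * y)"
    unfolding y_def by (rule Cauchy_product_sums[OF summ summ])
  moreover have "(\<Sum>i\<le>k. (c i *\<^sub>R x ^ i) * (c (k - i) *\<^sub>R x ^ (k - i)))
      = ((1 gchoose k) * (-1) ^ k) *\<^sub>R x ^ k" for k
  proof -
    have "(\<Sum>i\<le>k. (c i *\<^sub>R x ^ i) * (c (k - i) *\<^sub>R x ^ (k - i)))
        = (\<Sum>i\<le>k. (c i * c (k - i)) *\<^sub>R x ^ k)"
      by (rule sum.cong) (simp_all flip: power_add)
    then show ?thesis by (simp add: scaleR_sum_left[symmetric] conv)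
  qed
  ultimately have "(\<lambda>k. ((1 gchoose k) * (-1) ^ k) *\<^sub>R x ^ k) sums (y * y)"
    by simp
  moreover have "(\<lambda>k. ((1 gchoose k) * (-1) ^ k) *\<^sub>R x ^ k) sums
      (\<Sum>k<2. ((1 gchoose k) * (-1) ^ k) *\<^sub>R x ^ k)"
  proof (rule sums_finite)
    fix k :: nat assume "k \<notin> {..<2}"
    then have "1 < k" by simp
    then have "(1::real) gchoose k = 0"
      by (metis binomial_eq_0 binomial_gbinomial of_nat_0 of_nat_1)
    then show "((1 gchoose k) * (-1) ^ k) *\<^sub>R x ^ k = 0" by simp
  qed simp
  ultimately have "y * y = (\<Sum>k<2. ((1 gchoose k) * (-1) ^ k) *\<^sub>R x ^ k)"
    using sums_unique2 by blast
  then have "y * y = 1 - x" by (simp add: numeral_2_eq_2)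
  with \<open>star y = y\<close> show ?thesis by (rule that)
qed

lemma one_minus_invertible:
  fixes x :: "'b::comm_cstar_algebra"
  assumes "norm x < 1"
  obtains z where "(1 - x) * z = 1"
proof -
  have geo: "summable (\<lambda>k. norm x ^ k)"
    using assms by (simp add: summable_geometric)
  have summ: "summable (\<lambda>k. x ^ k)"
    by (rule summable_norm_cancel, rule summable_comparison_test'[OF geo, of 0])
       (simp add: norm_power_ineq)
  define z where "z = (\<Sum>k. x ^ k)"
  have "x * z = (\<Sum>k. x ^ Suc k)"
    using suminf_mult[OF summ, of x] by (simp add: z_def)
  also have "\<dots> = z - 1"
    using suminf_split_head[OF summ] by (simp add: z_def)
  finally have "(1 - x) * z = 1" by (simp add: algebra_simps)
  then show ?thesis by (rule that)
qed

subsection \<open>The positive cone\<close>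

text \<open>
  Norm description of positivity: it makes closure under sums trivial, and it needs no spectrum.
\<close>

definition norm_pos :: "'b::comm_cstar_algebra \<Rightarrow> bool" where
  "norm_pos h \<longleftrightarrow> star h = h \<and> (\<exists>t\<ge>0. norm (of_real t - h) \<le> t)"

lemma norm_pos_add:
  assumes "norm_pos a" "norm_pos b"
  shows "norm_pos (a + b)"
proof -
  obtain s t where "0 \<le> s" "norm (of_real s - a) \<le> s" "0 \<le> t" "norm (of_real t - b) \<le> t"
    using assms by (auto simp: norm_pos_def)
  then have "norm (of_real (s + t) - (a + b)) \<le> s + t"
    using norm_triangle_ineq[of "of_real s - a" "of_real t - b"] by (simp add: algebra_simps)
  then show ?thesis
    using assms \<open>0 \<le> s\<close> \<open>0 \<le> t\<close> by (auto simp: norm_pos_def star_add intro!: exI[of _ "s + t"])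
qed

text \<open>
  If \<open>\<parallel>e\<parallel> < 1\<close> and \<open>b\<^sup>2 = 1 - e\<^sup>2\<close>, then \<open>e + \<i> b\<close> is unitary, hence \<open>\<parallel>b\<parallel> \<le> 1\<close>.
\<close>

lemma norm_pos_square:
  fixes a :: "'b::comm_cstar_algebra"
  assumes "star a = a"
  shows "norm_pos (a * a)"
proof -
  define r where "r = norm a + 1"
  have r: "r > 0" by (simp add: r_def add_nonneg_pos)
  define e where "e = (1 / r) *\<^sub>R a"
  have e: "star e = e" "norm e < 1"
    using r assms by (simp_all add: e_def star_scaleR r_def)
  have "norm e * norm e \<le> norm e"
    using e(2) by (intro mult_left_le) auto
  then have "norm (e * e) < 1"
    using norm_mult_ineq[of e e] e(2) by linarith
  moreover have "star (e * e) = e * e" by (simp add: star_mult e)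
  ultimately obtain b where b: "star b = b" "b * b = 1 - e * e"
    using selfadjoint_sqrt_one_minus by blast
  define u where "u = e + cscale \<i> b"
  have su: "star u = e - cscale \<i> b"
    by (simp add: u_def star_add star_cscale e b cscale_minus_left)
  have "star u * u = (e - cscale \<i> b) * (e + cscale \<i> b)"
    by (simp only: su) (simp only: u_def)
  also have "\<dots> = e * e - cscale \<i> b * cscale \<i> b"
    by (simp add: algebra_simps)
  also have "cscale \<i> b * cscale \<i> b = cscale (\<i> * \<i>) (b * b)"
    by (simp only: cscale_mult_left cscale_mult_right cscale_cscale)
  also have "\<dots> = - (b * b)" by (simp add: cscale_minus_left)
  finally have "star u * u = e * e + b * b" by simp
  then have "(norm u)\<^sup>2 = 1"
    using norm_star_mult[of u] b by simp
  then have nu: "norm u = 1"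
    using power2_eq_1_iff[of "norm u"] norm_ge_zero[of u] by linarith
  have "cscale (2 * \<i>) b = u - star u"
    by (simp only: su) (simp only: u_def mult_2 cscale_add_left, simp)
  then have "norm (cscale (2 * \<i>) b) \<le> norm u + norm (star u)"
    by (simp only: norm_triangle_ineq4)
  then have nb: "norm b \<le> 1"
    by (simp add: norm_cscale norm_star nu norm_mult)
  have "norm (1 - e * e) \<le> 1"
    using norm_mult_ineq[of b b] mult_mono[OF nb nb] b by simp
  then have "r\<^sup>2 * norm (1 - e * e) \<le> r\<^sup>2"
    by (simp add: mult_left_le)
  moreover have "of_real (r\<^sup>2) - a * a = (r\<^sup>2) *\<^sub>R (1 - e * e)"
    using r by (simp add: e_def power2_eq_square scaleR_right_diff_distrib of_real_def)
  ultimately have "norm (of_real (r\<^sup>2) - a * a) \<le> r\<^sup>2"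
    by simp
  then show ?thesis
    using assms by (auto simp: norm_pos_def star_mult intro!: exI[of _ "r\<^sup>2"])
qed

text \<open>With s = t + \<epsilon> the element h/s has distance at most t/s < 1 from 1, so the
  binomial series gives a root and the Neumann series an inverse. The inverse \<open>z\<close> of
  the root is what dividing by a pivot requires.\<close>

lemma norm_pos_strict_sqrt:
  fixes h :: "'b::comm_cstar_algebra"
  assumes "norm_pos (h - of_real \<epsilon>)" "\<epsilon> > 0"
  obtains y z where "star y = y" "star z = z" "y * y = h" "y * z = 1"
proof -
  obtain t where t: "t \<ge> 0" "norm (of_real t - (h - of_real \<epsilon>)) \<le> t"
    and sh: "star h = h"
    using assms by (auto simp: norm_pos_def star_diff)
  define s where "s = t + \<epsilon>"
  have s: "s > 0" using t assms by (simp add: s_def)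
  define x where "x = 1 - (1 / s) *\<^sub>R h"
  have "x = (1 / s) *\<^sub>R (of_real s - h)"
    using s by (simp add: x_def scaleR_right_diff_distrib of_real_def)
  moreover have "of_real s - h = of_real t - (h - of_real \<epsilon>)"
    by (simp add: s_def)
  ultimately have "norm x \<le> t / s"
    using t s by (simp add: divide_right_mono)
  also have "\<dots> < 1" using s assms by (simp add: s_def)
  finally have nx: "norm x < 1" .
  have sx: "star x = x" by (simp add: x_def star_diff star_scaleR sh)
  obtain y0 where y0: "star y0 = y0" "y0 * y0 = 1 - x"
    using selfadjoint_sqrt_one_minus[OF sx nx] .
  obtain z0 where z0: "(1 - x) * z0 = 1"
    using one_minus_invertible[OF nx] .
  define y where "y = sqrt s *\<^sub>R y0"
  define z where "z = (1 / s) *\<^sub>R (y * z0)"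
  have y: "star y = y" by (simp add: y_def star_scaleR y0)
  have yy: "y * y = h"
    using s y0 by (simp add: y_def x_def)
  have yz: "y * z = 1"
  proof -
    have "y * z = (1 / s) *\<^sub>R (h * z0)"
      by (simp add: z_def mult.assoc[symmetric] yy)
    also have "\<dots> = (1 - x) * z0" by (simp add: x_def)
    finally show ?thesis using z0 by simp
  qed
  have "star z = star z * (y * z)" by (simp add: yz)
  also have "\<dots> = star (y * z) * z" by (simp add: star_mult y mult_ac)
  finally have "star z = z" by (simp add: yz)
  with y yy yz show ?thesis by (intro that)
qed

subsection \<open>Characters\<close>

text \<open>
  Characters come from maximal preorderings of the self-adjoint part, as in the Kadison--Dubois
  theorem, so that neither maximal ideals nor the Gelfand--Mazur theorem are needed.
\<close>

inductive_set sum_squares :: "'b::comm_cstar_algebra set" where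
  square: "star a = a \<Longrightarrow> a * a \<in> sum_squares"
| add: "p \<in> sum_squares \<Longrightarrow> q \<in> sum_squares \<Longrightarrow> p + q \<in> sum_squares"

lemma sum_squares_selfadjoint: "p \<in> sum_squares \<Longrightarrow> star p = p"
  by (induction rule: sum_squares.induct) (auto simp: star_mult star_add)

lemma sum_squares_norm_pos: "p \<in> sum_squares \<Longrightarrow> norm_pos p"
  by (induction rule: sum_squares.induct) (auto intro: norm_pos_square norm_pos_add)

lemma sum_squares_mult:
  assumes "p \<in> sum_squares" "q \<in> sum_squares"
  shows "p * q \<in> sum_squares"
  using assms
proof (induction rule: sum_squares.induct)
  case (square a)
  from \<open>q \<in> sum_squares\<close> show ?case
  proof (induction rule: sum_squares.induct)
    case (square b)
    have "a * a * (b * b) = (a * b) * (a * b)" by (simp add: mult_ac)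
    moreover have "star (a * b) = a * b"
      using square \<open>star a = a\<close> by (simp add: star_mult mult.commute)
    ultimately show ?case by (metis sum_squares.square)
  qed (auto simp: distrib_left intro: sum_squares.add)
qed (auto simp: distrib_right intro: sum_squares.add)

locale preordering =
  fixes Q :: "'b::comm_cstar_algebra set"
  assumes selfadjoint: "a \<in> Q \<Longrightarrow> star a = a"
    and add: "a \<in> Q \<Longrightarrow> b \<in> Q \<Longrightarrow> a + b \<in> Q"
    and mult: "a \<in> Q \<Longrightarrow> b \<in> Q \<Longrightarrow> a * b \<in> Q"
    and square: "star a = a \<Longrightarrow> a * a \<in> Q"
    and minus_one: "- 1 \<notin> Q"
begin

lemma of_real_nonneg: "r \<ge> 0 \<Longrightarrow> of_real r \<in> Q"
  using square[of "of_real (sqrt r)"] by (simp flip: of_real_mult)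

lemma of_real_iff: "of_real r \<in> Q \<longleftrightarrow> r \<ge> 0"
proof
  assume *: "of_real r \<in> Q"
  show "r \<ge> 0"
  proof (rule ccontr)
    assume "\<not> r \<ge> 0"
    then have "of_real (1 / - r) * of_real r \<in> Q"
      by (intro mult * of_real_nonneg) simp
    moreover have "(of_real (1 / - r) * of_real r :: 'b) = - 1"
      using \<open>\<not> r \<ge> 0\<close> by (simp flip: of_real_mult)
    ultimately show False using minus_one by simp
  qed
qed (rule of_real_nonneg)

text \<open>Archimedean property: s - a is s times 1 - a/s, a square by the binomial series. Hence
  every self-adjoint element has real upper and lower bounds in the order of
  \<open>Q\<close>.\<close>

lemma norm_bound:
  assumes "star a = a" "s > norm a"
  shows "of_real s - a \<in> Q"
proof -
  have s: "s > 0" using assms(2) norm_ge_zero[of a] by linarith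
  have "star ((1 / s) *\<^sub>R a) = (1 / s) *\<^sub>R a" "norm ((1 / s) *\<^sub>R a) < 1"
    using assms s by (simp_all add: star_scaleR)
  then obtain y where y: "star y = y" "y * y = 1 - (1 / s) *\<^sub>R a"
    using selfadjoint_sqrt_one_minus by blast
  have "(sqrt s *\<^sub>R y) * (sqrt s *\<^sub>R y) = of_real s - a"
    using s y by (simp add: scaleR_right_diff_distrib of_real_def)
  moreover have "star (sqrt s *\<^sub>R y) = sqrt s *\<^sub>R y" by (simp add: star_scaleR y)
  ultimately show ?thesis by (metis square)
qed

text \<open>The extension step for Zorn's lemma. Products keep the form p + a q because
  \<open>a * a\<close> is in \<open>Q\<close>; the second hypothesis is properness of the
  result.\<close>

lemma adjoin:
  assumes "star a = a" "\<And>p q. p \<in> Q \<Longrightarrow> q \<in> Q \<Longrightarrow> - 1 \<noteq> p + a * q"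
  shows "preordering {p + a * q | p q. p \<in> Q \<and> q \<in> Q}" (is "preordering ?R")
    and "Q \<subseteq> {p + a * q | p q. p \<in> Q \<and> q \<in> Q}" "a \<in> {p + a * q | p q. p \<in> Q \<and> q \<in> Q}"
proof -
  have zero: "0 \<in> Q" and one: "1 \<in> Q"
    using of_real_nonneg[of 0] of_real_nonneg[of 1] by simp_all
  show sub: "Q \<subseteq> ?R"
  proof
    fix p assume "p \<in> Q"
    moreover have "p = p + a * 0" by simp
    ultimately show "p \<in> ?R" using zero by blast
  qed
  have "a = 0 + a * 1" by simp
  then show "a \<in> ?R" using zero one by blast
  show "preordering ?R"
  proof
    fix x assume "x \<in> ?R" then show "star x = x"
      using assms(1) selfadjoint by (auto simp: star_add star_mult mult.commute)
  next
    fix x y assume "x \<in> ?R" "y \<in> ?R"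
    then obtain p q p' q' where xy: "x = p + a * q" "y = p' + a * q'"
      and Q: "p \<in> Q" "q \<in> Q" "p' \<in> Q" "q' \<in> Q" by blast
    have "x + y = (p + p') + a * (q + q')" by (simp add: xy algebra_simps)
    then show "x + y \<in> ?R" using Q add by blast
    have "x * y = (p * p' + (a * a) * (q * q')) + a * (p * q' + q * p')"
      by (simp add: xy algebra_simps)
    moreover have "p * p' + (a * a) * (q * q') \<in> Q" "p * q' + q * p' \<in> Q"
      using Q add mult square[OF assms(1)] by simp_all
    ultimately show "x * y \<in> ?R" by blast
  next
    fix x :: 'b assume "star x = x" then show "x * x \<in> ?R" using square sub by blast
  next
    show "- 1 \<notin> ?R" using assms(2) by blast
  qed
qed

end

locale total_preordering = preordering +
  assumes total: "star a = a \<Longrightarrow> a \<in> Q \<or> - a \<in> Q"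
begin

text \<open>The Dedekind cut of \<open>a\<close> in the total order; it becomes the value of a
  character at \<open>a\<close>.\<close>

definition val :: "'a \<Rightarrow> real" where "val a = Sup {r. a - of_real r \<in> Q}"

lemma below_above:
  assumes "a - of_real r \<in> Q" "of_real s - a \<in> Q"
  shows "r \<le> s"
  using add[OF assms] of_real_iff[of "s - r"] by simp

lemma val_upper:
  assumes "star a = a" "of_real s - a \<in> Q"
  shows "val a \<le> s"
  unfolding val_def
proof (rule cSup_least)
  have "of_real (norm a + 1) - - a \<in> Q"
    by (rule norm_bound) (simp_all add: star_minus assms)
  then show "{r. a - of_real r \<in> Q} \<noteq> {}"
    by (auto intro!: exI[of _ "- (norm a + 1)"] simp: algebra_simps)
qed (use assms below_above in auto)

lemma val_lower:
  assumes "star a = a" "a - of_real r \<in> Q"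
  shows "r \<le> val a"
  unfolding val_def
proof (rule cSup_upper)
  have "of_real (norm a + 1) - a \<in> Q"
    by (rule norm_bound) (simp_all add: assms)
  then show "bdd_above {r. a - of_real r \<in> Q}"
    using below_above by (auto intro!: bdd_aboveI[of _ "norm a + 1"])
qed (use assms in simp)

lemma val_gt:
  assumes "star a = a" "val a < s"
  shows "of_real s - a \<in> Q"
  using total[of "a - of_real s"] val_lower[OF assms(1), of s] assms by (auto simp: star_diff)

lemma val_lt:
  assumes "star a = a" "r < val a"
  shows "a - of_real r \<in> Q"
  using total[of "a - of_real r"] val_upper[OF assms(1), of r] assms by (auto simp: star_diff)

lemma val_eqI:
  assumes "star a = a" "\<And>e. e > 0 \<Longrightarrow> of_real (r + e) - a \<in> Q" "\<And>e. e > 0 \<Longrightarrow> a - of_real (r - e) \<in> Q"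
  shows "val a = r"
proof (rule antisym)
  show "val a \<le> r"
    using val_upper[OF assms(1) assms(2)] by (rule field_le_epsilon)
  show "r \<le> val a"
  proof (rule field_le_epsilon)
    fix e :: real assume "e > 0"
    from val_lower[OF assms(1) assms(3)[OF this]] show "r \<le> val a + e" by simp
  qed
qed

lemma val_of_real [simp]: "val (of_real r) = r"
  by (rule val_eqI) (simp_all flip: of_real_diff add: of_real_nonneg)

lemma val_add:
  assumes "star a = a" "star b = b"
  shows "val (a + b) = val a + val b"
proof (rule val_eqI)
  fix e :: real assume e: "e > 0"
  have "(of_real (val a + e / 2) - a) + (of_real (val b + e / 2) - b) \<in> Q"
    using e by (intro add val_gt assms) simp_all
  then show "of_real (val a + val b + e) - (a + b) \<in> Q"
    by (simp add: algebra_simps flip: of_real_add)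
  have "(a - of_real (val a - e / 2)) + (b - of_real (val b - e / 2)) \<in> Q"
    using e by (intro add val_lt assms) simp_all
  moreover have "(a - of_real (val a - e / 2)) + (b - of_real (val b - e / 2))
      = (a + b) - of_real ((val a - e / 2) + (val b - e / 2))"
    by (simp only: of_real_add) simp
  ultimately show "a + b - of_real (val a + val b - e) \<in> Q"
    by (simp add: algebra_simps del: of_real_add of_real_diff)
qed (simp add: star_add assms)

lemma val_minus:
  assumes "star a = a"
  shows "val (- a) = - val a"
  using val_add[of a "- a"] val_of_real[of 0] assms by (simp add: star_minus)

lemma val_diff:
  assumes "star a = a" "star b = b"
  shows "val (a - b) = val a - val b"
  using val_add[of a "- b"] val_minus[of b] assms by (simp add: star_minus)

lemma val_nonneg: "a \<in> Q \<Longrightarrow> 0 \<le> val a"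
  using val_lower[of a 0] selfadjoint by simp

text \<open>For r >= 0, scaling the lower bounds of \<open>b\<close> gives one inequality, and the
  same for - b gives the other. Negative r reduces to positive r by changing both signs.\<close>

lemma val_scale:
  assumes "star a = a"
  shows "val (of_real r * a) = r * val a"
proof -
  have pos: "val (of_real r * b) \<ge> r * val b" if "r \<ge> 0" "star b = b" for r b
  proof (cases "r = 0")
    case False
    show ?thesis
    proof (rule field_le_epsilon)
      fix e :: real assume e: "e > 0"
      have "of_real r * (b - of_real (val b - e / r)) \<in> Q"
        using e that False by (intro mult of_real_nonneg val_lt) auto
      moreover have "of_real r * (b - of_real (val b - e / r)) = of_real r * b - of_real (r * val b - e)"
      proof -
        have "r * val b - e = r * (val b - e / r)" using False by (simp add: field_simps)
        then show ?thesis by (simp only: of_real_mult right_diff_distrib[of "of_real r :: 'a"])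
      qed
      ultimately show "r * val b \<le> val (of_real r * b) + e"
        using val_lower[of "of_real r * b" "r * val b - e"] that by (simp add: star_mult mult.commute)
    qed
  qed (use val_of_real[of 0] in simp)
  have nn: "val (of_real r * b) = r * val b" if "r \<ge> 0" "star b = b" for r b
    using pos[OF that] pos[OF that(1), of "- b"] that val_minus[of "of_real r * b"] val_minus[of b]
    by (simp add: star_minus star_mult mult.commute)
  show ?thesis
  proof (cases "r \<ge> 0")
    case False
    then have "val (of_real (- r) * - a) = (- r) * val (- a)"
      using assms by (intro nn) (simp_all add: star_minus)
    then show ?thesis using assms val_minus[of a] by simp
  qed (use nn assms in blast)
qed

text \<open>Subtracting the value reduces to \<open>val b = 0\<close>. Then b lies between - sqrt e
  and sqrt e for every e > 0, so the product (sqrt e - b)(b + sqrt e) = e - b^2 is in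
  \<open>Q\<close>.\<close>

lemma val_square:
  assumes "star a = a"
  shows "val (a * a) = val a * val a"
proof -
  define b where "b = a - of_real (val a)"
  have b: "star b = b" "val b = 0" using assms by (simp_all add: b_def star_diff val_diff)
  have "val (b * b) = 0"
  proof (rule val_eqI)
    show "star (b * b) = b * b" by (simp add: star_mult b)
  next
    fix e :: real assume e: "e > 0"
    have "of_real (sqrt e) - b \<in> Q"
      using e b by (intro val_gt) simp_all
    moreover have "b - of_real (- sqrt e) \<in> Q"
      using e b by (intro val_lt) simp_all
    ultimately have "(of_real (sqrt e) - b) * (b - of_real (- sqrt e)) \<in> Q" by (rule mult)
    moreover have "(of_real (sqrt e) - b) * (b - of_real (- sqrt e)) = of_real (sqrt e * sqrt e) - b * b"
      by (simp add: algebra_simps del: real_sqrt_mult_self)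
    moreover have "sqrt e * sqrt e = 0 + e" using e by simp
    ultimately show "of_real (0 + e) - b * b \<in> Q" by (simp only:)
    have "b * b + of_real e \<in> Q"
      using e b by (intro add square of_real_nonneg) simp_all
    then show "b * b - of_real (0 - e) \<in> Q" by simp
  qed
  moreover have "a * a = b * b + (of_real (2 * val a) * b + of_real (val a * val a))"
    by (simp add: b_def algebra_simps)
  ultimately show ?thesis
    using b val_add[of "b * b" "of_real (2 * val a) * b + of_real (val a * val a)"]
      val_add[of "of_real (2 * val a) * b" "of_real (val a * val a)"] val_scale[of b "2 * val a"]
      val_of_real[of "val a * val a"]
    by (simp add: star_add star_mult mult.commute del: of_real_mult)
qed

text \<open>Polarisation of \<open>val_square\<close>.\<close>

lemma val_mult:
  assumes "star a = a" "star b = b"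
  shows "val (a * b) = val a * val b"
proof -
  have "(a + b) * (a + b) = a * a + (b * b + of_real 2 * (a * b))"
    by (simp add: algebra_simps mult_2)
  then have "val ((a + b) * (a + b)) = val a * val a + (val b * val b + 2 * val (a * b))"
    using assms val_add[of "a * a" "b * b + of_real 2 * (a * b)"] val_add[of "b * b" "of_real 2 * (a * b)"]
      val_scale[of "a * b" 2]
    by (simp add: star_add star_mult mult.commute val_square del: of_real_numeral)
  moreover have "val ((a + b) * (a + b)) = (val a + val b) * (val a + val b)"
    using assms by (simp add: val_square val_add star_add)
  ultimately show ?thesis by (simp add: algebra_simps)
qed

end

section \<open>Complex characters detect positivity\<close>

definition character :: "('b::comm_cstar_algebra \<Rightarrow> complex) \<Rightarrow> bool" where
  "character \<omega> \<longleftrightarrow> (\<forall>a b. \<omega> (a + b) = \<omega> a + \<omega> b) \<and> (\<forall>a b. \<omega> (a * b) = \<omega> a * \<omega> b) \<and> \<omega> 1 = 1 \<and>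
     (\<forall>a. \<omega> (star a) = cnj (\<omega> a)) \<and> (\<forall>z a. \<omega> (cscale z a) = z * \<omega> a)"

definition re_part :: "'b::comm_cstar_algebra \<Rightarrow> 'b" where
  "re_part a = (1/2) *\<^sub>R (a + star a)"

definition im_part :: "'b::comm_cstar_algebra \<Rightarrow> 'b" where
  "im_part a = cscale (- \<i> / 2) (a - star a)"

lemma re_im_selfadjoint: "star (re_part a) = re_part a" "star (im_part a) = im_part a"
proof -
  show "star (re_part a) = re_part a"
    by (simp add: re_part_def star_scaleR star_add star_star add.commute)
  have "star (im_part a) = cscale (cnj (- \<i> / 2)) (star a - a)"
    by (simp only: im_part_def star_cscale star_diff star_star)
  also have "cnj (- \<i> / 2) = - (- \<i> / 2)" by simp
  also have "cscale (- (- \<i> / 2)) (star a - a) = cscale (- \<i> / 2) (- (star a - a))"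
    by (simp only: cscale_minus_left cscale_minus_right)
  also have "\<dots> = im_part a" by (simp only: im_part_def minus_diff_eq)
  finally show "star (im_part a) = im_part a" .
qed

lemma cscale_half_double: "cscale (1/2) (a + a) = (a::'b::comm_cstar_algebra)"
proof -
  have "cscale (1/2) (a + a) = cscale (1/2 + 1/2) a"
    by (simp only: cscale_add_left cscale_add_right)
  then show ?thesis by simp
qed

lemma scaleR_half_cscale: "(1/2) *\<^sub>R a = cscale (1/2) (a::'b::comm_cstar_algebra)"
  by (subst cscale_of_real[symmetric]) simp

lemma re_im_decomp: "re_part a + cscale \<i> (im_part a) = a"
proof -
  have "\<i> * (- \<i> / 2) = 1/2" by simp
  then have "re_part a + cscale \<i> (im_part a) = cscale (1/2) ((a + star a) + (a - star a))"
    by (simp only: re_part_def im_part_def cscale_cscale scaleR_half_cscale cscale_add_right)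
  also have "(a + star a) + (a - star a) = a + a" by simp
  finally show ?thesis by (simp only: cscale_half_double)
qed

lemma re_im_unique:
  assumes "star x = x" "star y = y"
  shows "re_part (x + cscale \<i> y) = x" "im_part (x + cscale \<i> y) = y"
proof -
  have s: "star (x + cscale \<i> y) = x - cscale \<i> y"
    by (simp add: star_add star_cscale assms cscale_minus_left)
  have "(x + cscale \<i> y) + (x - cscale \<i> y) = x + x"
    "(x + cscale \<i> y) - (x - cscale \<i> y) = cscale \<i> y + cscale \<i> y"
    by simp_all
  then have "re_part (x + cscale \<i> y) = cscale (1/2) (x + x)"
    "im_part (x + cscale \<i> y) = cscale (- \<i> / 2) (cscale \<i> (y + y))"
    by (simp_all only: re_part_def im_part_def s scaleR_half_cscale cscale_add_right)
  moreover have "(- \<i> / 2) * \<i> = 1/2" by simp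
  ultimately show "re_part (x + cscale \<i> y) = x" "im_part (x + cscale \<i> y) = y"
    by (simp_all only: cscale_cscale cscale_half_double)
qed

lemma cscale_re_im:
  "cscale z x = of_real (Re z) * x + cscale \<i> (of_real (Im z) * x)" for x :: "'b::comm_cstar_algebra"
proof -
  have "cscale z x = cscale (complex_of_real (Re z) + \<i> * complex_of_real (Im z)) x"
    by (rule arg_cong[where f = "\<lambda>w. cscale w x", OF complex_eq])
  also have "\<dots> = cscale (complex_of_real (Re z)) x + cscale \<i> (cscale (complex_of_real (Im z)) x)"
    by (simp only: cscale_add_left cscale_cscale)
  finally show ?thesis by (simp only: cscale_of_real scaleR_conv_of_real)
qed

lemma cscale_decomp:
  "cscale z (x + cscale \<i> y) =
    (of_real (Re z) * x - of_real (Im z) * y) + cscale \<i> (of_real (Re z) * y + of_real (Im z) * x)"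
  for x y :: "'b::comm_cstar_algebra"
proof -
  have "cscale z (x + cscale \<i> y) = cscale z x + cscale \<i> (cscale z y)"
    by (simp add: cscale_add_right cscale_cscale mult.commute)
  also have "\<dots> = (of_real (Re z) * x + cscale \<i> (of_real (Im z) * x))
      + cscale \<i> (of_real (Re z) * y + cscale \<i> (of_real (Im z) * y))"
    by (simp only: cscale_re_im[of z])
  also have "\<dots> = (of_real (Re z) * x - of_real (Im z) * y) + cscale \<i> (of_real (Re z) * y + of_real (Im z) * x)"
    by (simp add: cscale_add_right cscale_cscale cscale_minus_left)
  finally show ?thesis .
qed

lemma mult_decomp:
  "(x + cscale \<i> y) * (x' + cscale \<i> y') = (x * x' - y * y') + cscale \<i> (x * y' + y * x')"
  for x y :: "'b::comm_cstar_algebra"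
  by (simp add: distrib_left distrib_right cscale_add_right cscale_mult_left cscale_mult_right
      cscale_cscale cscale_minus_left)

text \<open>\<open>val\<close> is a real ring homomorphism on the self-adjoint part, and every
  element is uniquely x + i y with x and y self-adjoint.\<close>

lemma (in total_preordering) character_val:
  "character (\<lambda>a. Complex (val (re_part a)) (val (im_part a)))" (is "character ?\<omega>")
proof -
  have chi: "?\<omega> (x + cscale \<i> y) = Complex (val x) (val y)" if "star x = x" "star y = y" for x y :: 'a
    using that by (simp add: re_im_unique)
  have "?\<omega> (a + b) = ?\<omega> a + ?\<omega> b" for a b
  proof -
    have "a + b = (re_part a + re_part b) + cscale \<i> (im_part a + im_part b)"
    proof -
      have "(re_part a + cscale \<i> (im_part a)) + (re_part b + cscale \<i> (im_part b))
          = (re_part a + re_part b) + cscale \<i> (im_part a + im_part b)"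
        by (simp add: cscale_add_right)
      then show ?thesis by (simp only: re_im_decomp)
    qed
    then show ?thesis
      using chi[of "re_part a + re_part b" "im_part a + im_part b"]
      by (simp add: re_im_selfadjoint star_add val_add complex_eq_iff)
  qed
  moreover have "?\<omega> (a * b) = ?\<omega> a * ?\<omega> b" for a b
  proof -
    have "a * b = (re_part a * re_part b - im_part a * im_part b)
        + cscale \<i> (re_part a * im_part b + im_part a * re_part b)"
      using mult_decomp[of "re_part a" "im_part a" "re_part b" "im_part b"] by (simp only: re_im_decomp)
    then show ?thesis
      using chi[of "re_part a * re_part b - im_part a * im_part b" "re_part a * im_part b + im_part a * re_part b"]
      by (simp add: re_im_selfadjoint star_add star_diff star_mult mult.commute val_add val_diff val_mult complex_eq_iff)
  qed
  moreover have "?\<omega> 1 = 1"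
    using chi[of 1 0] val_of_real[of 1] val_of_real[of 0] by (simp add: complex_eq_iff)
  moreover have "?\<omega> (star a) = cnj (?\<omega> a)" for a
  proof -
    have "star a = re_part a + cscale \<i> (- im_part a)"
      using arg_cong[OF re_im_decomp[of a], of star]
      by (simp add: star_add star_cscale re_im_selfadjoint cscale_minus_left cscale_minus_right)
    then show ?thesis
      using chi[of "re_part a" "- im_part a"]
      by (simp add: re_im_selfadjoint star_minus val_minus complex_eq_iff)
  qed
  moreover have "?\<omega> (cscale z a) = z * ?\<omega> a" for z a
  proof -
    have "cscale z a = (of_real (Re z) * re_part a - of_real (Im z) * im_part a)
        + cscale \<i> (of_real (Re z) * im_part a + of_real (Im z) * re_part a)"
      using cscale_decomp[of z "re_part a" "im_part a"] by (simp only: re_im_decomp)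
    then show ?thesis
      using chi[of "of_real (Re z) * re_part a - of_real (Im z) * im_part a"
          "of_real (Re z) * im_part a + of_real (Im z) * re_part a"]
      by (simp add: re_im_selfadjoint star_add star_diff star_of_real_mult
          val_add val_diff val_scale complex_eq_iff)
  qed
  ultimately show ?thesis by (auto simp: character_def)
qed

text \<open>A maximal preordering above \<open>Q\<close> is total, and its cut \<open>val\<close>
  gives the character.\<close>

lemma preordering_character:
  assumes "preordering Q"
  obtains \<omega> where "character \<omega>" "\<And>a. a \<in> Q \<Longrightarrow> 0 \<le> Re (\<omega> a)"
proof -
  let ?A = "{R. preordering R \<and> Q \<subseteq> R}"
  have "\<exists>M\<in>?A. \<forall>X\<in>?A. M \<subseteq> X \<longrightarrow> X = M"
  proof (rule subset_Zorn_nonempty)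
    show "?A \<noteq> {}" using assms by blast
  next
    fix \<C> assume C: "\<C> \<noteq> {}" "subset.chain ?A \<C>"
    have pre: "preordering R" "Q \<subseteq> R" if "R \<in> \<C>" for R
      using C that by (auto simp: subset.chain_def)
    have two: "\<exists>R\<in>\<C>. a \<in> R \<and> b \<in> R" if "a \<in> \<Union>\<C>" "b \<in> \<Union>\<C>" for a b
    proof -
      obtain R S where "R \<in> \<C>" "a \<in> R" "S \<in> \<C>" "b \<in> S" using \<open>a \<in> _\<close> \<open>b \<in> _\<close> by blast
      moreover have "R \<subseteq> S \<or> S \<subseteq> R"
        using calculation C(2) unfolding subset.chain_def by blast
      ultimately show ?thesis by blast
    qed
    have "preordering (\<Union>\<C>)"
    proof
      fix a assume "a \<in> \<Union>\<C>" then show "star a = a" using pre preordering.selfadjoint by blast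
    next
      fix a b assume "a \<in> \<Union>\<C>" "b \<in> \<Union>\<C>"
      from two[OF this] show "a + b \<in> \<Union>\<C>" using pre preordering.add by blast
    next
      fix a b assume "a \<in> \<Union>\<C>" "b \<in> \<Union>\<C>"
      from two[OF this] show "a * b \<in> \<Union>\<C>" using pre preordering.mult by blast
    next
      fix a :: 'a assume "star a = a"
      then show "a * a \<in> \<Union>\<C>" using C(1) pre preordering.square by blast
    next
      show "- 1 \<notin> \<Union>\<C>" using pre preordering.minus_one by blast
    qed
    then show "\<Union>\<C> \<in> ?A" using C(1) pre by blast
  qed
  then obtain M where M': "M \<in> ?A" "\<forall>X\<in>?A. M \<subseteq> X \<longrightarrow> X = M" ..
  then have M: "preordering M" "Q \<subseteq> M" by simp_all
  have max: "X = M" if "preordering X" "M \<subseteq> X" for X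
    using M'(2) that M(2) by simp
  interpret M: preordering M by (rule M)
  have "total_preordering M"
  proof
    fix a :: 'a assume a: "star a = a"
    have step: "b \<in> M \<or> (\<exists>p\<in>M. \<exists>q\<in>M. - 1 = p + b * q)" if "star b = b" for b
    proof (rule ccontr)
      assume *: "\<not> ?thesis"
      then have "\<And>p q. p \<in> M \<Longrightarrow> q \<in> M \<Longrightarrow> - 1 \<noteq> p + b * q" by blast
      note R = M.adjoin[OF that this]
      from max[OF R(1,2)] R(3) * show False by simp
    qed
    show "a \<in> M \<or> - a \<in> M"
    proof (rule ccontr)
      assume "\<not> (a \<in> M \<or> - a \<in> M)"
      then obtain p q p' q' where pq: "p \<in> M" "q \<in> M" "- 1 = p + a * q"
        "p' \<in> M" "q' \<in> M" "- 1 = p' + - a * q'"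
      proof -
        have "star (- a) = - a" by (simp add: star_minus a)
        from step[OF a] step[OF this] \<open>\<not> (a \<in> M \<or> - a \<in> M)\<close> that show ?thesis by blast
      qed
      have "a * q = (p + a * q) - p" "- a * q' = (p' + - a * q') - p'" by simp_all
      then have e: "a * q = - 1 - p" "- a * q' = - 1 - p'"
        by (simp_all only: pq(3)[symmetric] pq(6)[symmetric])
      have "a * q' = - (- a * q')" by simp
      also have "\<dots> = 1 + p'" unfolding e(2) by simp
      finally have e': "a * q' = 1 + p'" .
      \<comment> \<open>If neither sign can be adjoined, a q = - (1 + p) and a q' = 1 + p'.
        Multiplying, a^2 q q' = - (1 + p)(1 + p'), which exhibits -1 as an element of
        \<open>M\<close>.\<close>
      have "(a * a) * (q * q') = (a * q) * (a * q')" by (simp add: mult_ac)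
      also have "\<dots> = - (1 + (p + (p' + p * p')))" by (simp add: e(1) e' algebra_simps)
      finally have "- 1 = (a * a) * (q * q') + (p + (p' + p * p'))" by (simp add: algebra_simps)
      moreover have "(a * a) * (q * q') + (p + (p' + p * p')) \<in> M"
        using pq a by (intro M.add M.mult M.square) auto
      ultimately show False using M.minus_one by simp
    qed
  qed
  then interpret T: total_preordering M .
  show ?thesis
  proof (rule that[OF T.character_val])
    fix a assume "a \<in> Q"
    then have "a \<in> M" using M by blast
    then have "star a = a" "0 \<le> T.val a" by (auto dest: M.selfadjoint T.val_nonneg)
    then show "0 \<le> Re (Complex (T.val (re_part a)) (T.val (im_part a)))"
      using re_im_unique[of a 0] by simp
  qed
qed

text \<open>Dichotomy on whether - h can be adjoined to the sums of squares. If not, h q = 1 + p has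
  a root with self-adjoint inverse z, and h = h^2 q z^2 is itself a sum of squares. If it can, a
  character nonnegative on the extension has value at most 0 at h, which is excluded.\<close>

lemma norm_pos_if_characters_pos:
  fixes h :: "'b::comm_cstar_algebra"
  assumes sh: "star h = h" and pos: "\<And>\<omega>. character \<omega> \<Longrightarrow> 0 < Re (\<omega> h)"
  shows "norm_pos h"
proof (cases "\<exists>p\<in>sum_squares. \<exists>q\<in>sum_squares. - 1 = p + - h * q")
  case True
  then obtain p q where pq: "p \<in> sum_squares" "q \<in> sum_squares" "- 1 = p + - h * q"
    by blast
  have "h * q = p - (p + - h * q)" by simp
  also have "\<dots> = 1 + p" unfolding pq(3)[symmetric] by simp
  finally have hq: "h * q = 1 + p" .
  have "1 + p - of_real (1::real) = p" by simp
  then have "norm_pos (1 + p - of_real (1::real))" using sum_squares_norm_pos[OF pq(1)] by simp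
  then obtain y z where yz: "star y = y" "star z = z" "y * y = 1 + p" "y * z = 1"
    using norm_pos_strict_sqrt[of "1 + p" "1::real" thesis] by simp
  have "h * (q * (z * z)) = (h * q) * (z * z)" by (simp only: mult.assoc)
  also have "\<dots> = (y * z) * (y * z)" by (simp only: hq yz(3)[symmetric] mult_ac)
  finally have "h * (q * (z * z)) = 1" by (simp add: yz)
  then have "h = h * h * (q * (z * z))" by (simp add: mult.assoc)
  moreover have "h * h * (q * (z * z)) \<in> sum_squares"
    by (intro sum_squares_mult sum_squares.square pq yz sh)
  ultimately show ?thesis using sum_squares_norm_pos by simp
next
  case False
  have "preordering (sum_squares :: 'b set)"
  proof
    show "(- 1 :: 'b) \<notin> sum_squares"
    proof
      assume "(- 1 :: 'b) \<in> sum_squares"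
      then have "norm_pos (- 1 :: 'b)" by (rule sum_squares_norm_pos)
      then obtain t where "t \<ge> 0" "norm (of_real t + 1 :: 'b) \<le> t" by (auto simp: norm_pos_def)
      moreover have "norm (of_real t + 1 :: 'b) = \<bar>t + 1\<bar>"
        by (metis norm_of_real of_real_1 of_real_add)
      ultimately show False by simp
    qed
  qed (auto intro: sum_squares.intros sum_squares_mult dest: sum_squares_selfadjoint)
  then interpret preordering "sum_squares :: 'b set" .
  have "\<And>p q. p \<in> sum_squares \<Longrightarrow> q \<in> sum_squares \<Longrightarrow> - 1 \<noteq> p + - h * q"
    using False by blast
  moreover have "star (- h) = - h" by (simp add: star_minus sh)
  ultimately have R: "preordering {p + - h * q | p q. p \<in> sum_squares \<and> q \<in> sum_squares}"
    "- h \<in> {p + - h * q | p q. p \<in> sum_squares \<and> q \<in> sum_squares}"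
    using adjoin[of "- h"] by blast+
  show ?thesis
  proof (rule preordering_character[OF R(1)])
    fix \<omega> :: "'b \<Rightarrow> complex"
    assume c: "character \<omega>"
      and nn: "\<And>a. a \<in> {p + - h * q | p q. p \<in> sum_squares \<and> q \<in> sum_squares} \<Longrightarrow> 0 \<le> Re (\<omega> a)"
    have "\<omega> (h + - h) = \<omega> h + \<omega> (- h)" "\<omega> (0 + 0) = \<omega> 0 + \<omega> 0"
      using c unfolding character_def by blast+
    then have "Re (\<omega> (- h)) = - Re (\<omega> h)"
      by (simp add: add_eq_0_iff)
    with pos[OF c] nn[OF R(2)] show ?thesis by simp
  qed
qed

lemma character_of_real:
  fixes \<omega> :: "'b::comm_cstar_algebra \<Rightarrow> complex"
  assumes "character \<omega>"
  shows "\<omega> (of_real r) = of_real r"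
proof -
  have "(of_real r :: 'b) = cscale (complex_of_real r) 1"
    by (rule trans[OF of_real_def cscale_of_real[symmetric]])
  moreover have "\<omega> (cscale (complex_of_real r) 1) = complex_of_real r * \<omega> 1" "\<omega> 1 = 1"
    using assms unfolding character_def by blast+
  ultimately show ?thesis by simp
qed

text \<open>Half of the bound \<epsilon> is spent on strict positivity at the characters, the other
  half on invertibility of the root.\<close>

lemma character_pos_sqrt:
  fixes h :: "'b::comm_cstar_algebra"
  assumes sh: "star h = h" and e: "\<epsilon> > 0" and pos: "\<And>\<omega>. character \<omega> \<Longrightarrow> \<epsilon> \<le> Re (\<omega> h)"
  obtains y z where "star y = y" "star z = z" "y * y = h" "y * z = 1"
proof -
  have "norm_pos (h - of_real (\<epsilon> / 2))"
  proof (rule norm_pos_if_characters_pos)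
    fix \<omega> :: "'b \<Rightarrow> complex" assume c: "character \<omega>"
    have "\<omega> h = \<omega> (h - of_real (\<epsilon> / 2)) + \<omega> (of_real (\<epsilon> / 2))"
      using c unfolding character_def by (metis diff_add_cancel)
    then show "0 < Re (\<omega> (h - of_real (\<epsilon> / 2)))"
      using pos[OF c] e by (simp add: character_of_real[OF c])
  qed (simp add: star_diff sh)
  with e norm_pos_strict_sqrt[of h "\<epsilon> / 2" thesis] that show ?thesis by simp
qed

subsection \<open>Positivity of matrices over the algebra\<close>

context
  fixes \<omega> :: "'b::comm_cstar_algebra \<Rightarrow> complex"
  assumes character: "character \<omega>"
begin

lemma character_add: "\<omega> (a + b) = \<omega> a + \<omega> b"
  and character_mult: "\<omega> (a * b) = \<omega> a * \<omega> b"
  and character_one: "\<omega> 1 = 1"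
  and character_star: "\<omega> (star a) = cnj (\<omega> a)"
  and character_cscale: "\<omega> (cscale z a) = z * \<omega> a"
  using character unfolding character_def by blast+

lemma character_zero: "\<omega> 0 = 0"
  using character_add[of 0 0] by simp

lemma character_diff: "\<omega> (a - b) = \<omega> a - \<omega> b"
  using character_add[of "a - b" b] by simp

lemma character_sum: "\<omega> (sum f A) = (\<Sum>i\<in>A. \<omega> (f i))"
  by (induction A rule: infinite_finite_induct) (auto simp: character_add character_zero)

lemma character_scaleR: "\<omega> (r *\<^sub>R a) = r *\<^sub>R \<omega> a"
  using character_cscale[of "complex_of_real r" a] by (simp add: cscale_of_real scaleR_conv_of_real)

end

text \<open>
  Cholesky factorisation. Subtracting the rank-one term of the last pivot leaves a Schur complement
  whose form at \<open>x\<close> is the original form at \<open>x\<close> extended by a suitable last coordinate, so the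
  lower bound \<open>\<epsilon>\<close> is inherited.
\<close>

lemma cholesky:
  fixes H :: "nat \<Rightarrow> nat \<Rightarrow> 'b::comm_cstar_algebra"
  assumes "\<And>i j. i < n \<Longrightarrow> j < n \<Longrightarrow> star (H i j) = H j i" and e: "\<epsilon> > 0"
    and "\<And>\<omega> x. character \<omega> \<Longrightarrow>
      \<epsilon> * (\<Sum>i<n. (cmod (x i))\<^sup>2) \<le> Re (\<Sum>i<n. \<Sum>j<n. cnj (x i) * \<omega> (H i j) * x j)"
  shows "\<exists>Y. \<forall>i<n. \<forall>j<n. H i j = (\<Sum>k<n. star (Y k i) * Y k j)"
  using assms(1,3)
proof (induction n arbitrary: H)
  case (Suc n)
  note herm = Suc.prems(1) and pos = Suc.prems(2)
  have sh: "star (H n n) = H n n" by (rule herm) auto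
  \<comment> \<open>The form at the last unit vector bounds the pivot below at every
    character.\<close>
  have piv: "\<epsilon> \<le> Re (\<omega> (H n n))" if "character \<omega>" for \<omega>
    using pos[OF that, of "\<lambda>i. if i = n then 1 else 0"]
    by (simp add: if_distrib[of "\<lambda>z. z * _"] if_distrib[of "\<lambda>z. _ * z"] if_distrib[of cnj]
        if_distrib[of "\<lambda>z. (cmod z)\<^sup>2"] cong: if_cong)
  obtain y z where y: "star y = y" and z: "star z = z" and yy: "y * y = H n n" and yz: "y * z = 1"
    using character_pos_sqrt[OF sh e] piv by blast
  define K where "K i j = H i j - H i n * (z * z) * H n j" for i j
  have "\<exists>Y. \<forall>i<n. \<forall>j<n. K i j = (\<Sum>k<n. star (Y k i) * Y k j)"
  proof (rule Suc.IH)
    fix i j assume "i < n" "j < n"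
    then show "star (K i j) = K j i"
      by (simp add: K_def star_diff star_mult herm z mult_ac)
  next
    fix \<omega> :: "'b \<Rightarrow> complex" and x :: "nat \<Rightarrow> complex"
    assume c: "character \<omega>"
    define w where "w = \<omega> (z * z)"
    define g where "g = (\<Sum>j<n. \<omega> (H n j) * x j)"
    define F where "F = (\<Sum>i<n. \<Sum>j<n. cnj (x i) * \<omega> (H i j) * x j)"
    have cw: "cnj w = w"
      using character_star[OF c, of "z * z"] by (simp add: w_def star_mult z)
    have "(z * z) * (y * y) = (y * z) * (y * z)" by (simp add: mult_ac)
    then have wh: "w * \<omega> (H n n) = 1"
      using character_mult[OF c, of "z * z" "y * y"] character_one[OF c] by (simp add: w_def yz yy)
    have cg: "cnj g = (\<Sum>i<n. cnj (x i) * \<omega> (H i n))"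
      unfolding g_def cnj_sum
    proof (rule sum.cong)
      fix i assume "i \<in> {..<n}"
      then have "cnj (\<omega> (H n i)) = \<omega> (H i n)"
        using herm[of n i] character_star[OF c, of "H n i"] by simp
      then show "cnj (\<omega> (H n i) * x i) = cnj (x i) * \<omega> (H i n)" by simp
    qed simp
    \<comment> \<open>The last coordinate minimises the form for given \<open>x\<close>: it is - g
      divided by the pivot, and \<open>w\<close> is the inverse of the pivot.\<close>
    define x' where "x' i = (if i < n then x i else - w * g)" for i
    have x'1: "x' i = x i" if "i < n" for i using that by (simp add: x'_def)
    have x'2: "x' n = - w * g" by (simp add: x'_def)
    have "(\<Sum>i<Suc n. \<Sum>j<Suc n. cnj (x' i) * \<omega> (H i j) * x' j)
        = (\<Sum>i<n. (\<Sum>j<n. cnj (x i) * \<omega> (H i j) * x j) + cnj (x i) * \<omega> (H i n) * (- w * g))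
          + ((\<Sum>j<n. cnj (- w * g) * \<omega> (H n j) * x j) + cnj (- w * g) * \<omega> (H n n) * (- w * g))"
      by (simp add: x'1 x'2 cong: sum.cong_simp)
    also have "\<dots> = F + cnj g * (- w * g) + (cnj (- w * g) * g + cnj (- w * g) * \<omega> (H n n) * (- w * g))"
    proof -
      have "(\<Sum>j<n. t * \<omega> (H n j) * x j) = t * g" for t
        by (simp add: g_def sum_distrib_left mult.assoc)
      then show ?thesis by (simp only: sum.distrib F_def cg sum_distrib_right)
    qed
    also have "\<dots> = F - cnj g * w * g"
    proof -
      have "cnj (- w * g) * \<omega> (H n n) * (- w * g) = (w * \<omega> (H n n)) * (w * cnj g * g)"
        by (simp add: cw mult_ac)
      then show ?thesis by (simp add: wh cw mult_ac)
    qed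
    also have "\<dots> = (\<Sum>i<n. \<Sum>j<n. cnj (x i) * \<omega> (K i j) * x j)"
    proof -
      have "cnj g * w * g = (\<Sum>i<n. \<Sum>j<n. (cnj (x i) * \<omega> (H i n)) * w * (\<omega> (H n j) * x j))"
        by (simp only: cg) (simp add: g_def sum_distrib_left sum_distrib_right mult_ac)
      then show ?thesis
        by (simp add: F_def K_def character_diff[OF c] character_mult[OF c] w_def
            sum_subtractf[symmetric] algebra_simps)
    qed
    finally have eq: "(\<Sum>i<Suc n. \<Sum>j<Suc n. cnj (x' i) * \<omega> (H i j) * x' j)
      = (\<Sum>i<n. \<Sum>j<n. cnj (x i) * \<omega> (K i j) * x j)" .
    have "(\<Sum>i<n. (cmod (x i))\<^sup>2) \<le> (\<Sum>i<Suc n. (cmod (x' i))\<^sup>2)"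
      by (simp add: x'1 cong: sum.cong_simp)
    then have "\<epsilon> * (\<Sum>i<n. (cmod (x i))\<^sup>2) \<le> \<epsilon> * (\<Sum>i<Suc n. (cmod (x' i))\<^sup>2)"
      using e by (simp del: sum.lessThan_Suc)
    also have "\<dots> \<le> Re (\<Sum>i<Suc n. \<Sum>j<Suc n. cnj (x' i) * \<omega> (H i j) * x' j)"
      by (rule pos[OF c])
    finally show "\<epsilon> * (\<Sum>i<n. (cmod (x i))\<^sup>2) \<le> Re (\<Sum>i<n. \<Sum>j<n. cnj (x i) * \<omega> (K i j) * x j)"
      by (simp only: eq)
  qed
  then obtain Y where Y: "\<And>i j. i < n \<Longrightarrow> j < n \<Longrightarrow> K i j = (\<Sum>k<n. star (Y k i) * Y k j)"
    by blast
  \<comment> \<open>Upper triangular factor: the factor of the Schur complement, below it the last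
    row of \<open>H\<close> divided by the root y of the pivot, and y in the corner.\<close>
  define W where "W k j = (if k < n then (if j < n then Y k j else 0) else (if j < n then z * H n j else y))" for k j
  have "H i j = (\<Sum>k<Suc n. star (W k i) * W k j)" if "i < Suc n" "j < Suc n" for i j
  proof -
    have S: "(\<Sum>k<Suc n. star (W k i) * W k j)
        = (\<Sum>k<n. star (if i < n then Y k i else 0) * (if j < n then Y k j else 0)) + star (W n i) * W n j"
      by (simp add: W_def)
    have zy: "z * y = 1" using yz by (simp add: mult.commute)
    consider "i < n" "j < n" | "i < n" "j = n" | "i = n" "j < n" | "i = n" "j = n"
      using \<open>i < Suc n\<close> \<open>j < Suc n\<close> by linarith
    then show ?thesis
    proof cases
      case 1
      have "star (z * H n i) * (z * H n j) = H i n * (z * z) * H n j"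
        using 1 by (simp add: star_mult z herm mult_ac)
      moreover have "H i j = K i j + H i n * (z * z) * H n j" by (simp add: K_def)
      ultimately show ?thesis using 1 Y[of i j] unfolding S by (simp add: W_def)
    next
      case 2
      have "star (z * H n i) * y = H i n * (z * y)"
        using 2 by (simp add: star_mult z herm mult_ac)
      with 2 show ?thesis unfolding S by (simp add: W_def zy)
    next
      case 3
      have "y * (z * H n j) = H n j" by (simp add: mult.assoc[symmetric] yz)
      with 3 show ?thesis unfolding S by (simp add: W_def y)
    next
      case 4
      then show ?thesis unfolding S by (simp add: W_def y yy)
    qed
  qed
  then show ?case by blast
qed simp

lemma mat_star_mult_index:
  assumes "Y \<in> carrier_mat n n" "i < n" "j < n"
  shows "(mat_star Y * Y) $$ (i, j) = (\<Sum>k<n. star (Y $$ (k, i)) * Y $$ (k, j))"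
  using assms by (auto simp: mat_star_def scalar_prod_def atLeast0LessThan)

lemma mat_pos_if_characters_pos:
  fixes H :: "'b::comm_cstar_algebra mat"
  assumes H: "H \<in> carrier_mat n n" "\<And>i j. i < n \<Longrightarrow> j < n \<Longrightarrow> star (H $$ (i, j)) = H $$ (j, i)"
    and "\<epsilon> > 0"
    and "\<And>\<omega> x. character \<omega> \<Longrightarrow>
      \<epsilon> * (\<Sum>i<n. (cmod (x i))\<^sup>2) \<le> Re (\<Sum>i<n. \<Sum>j<n. cnj (x i) * \<omega> (H $$ (i, j)) * x j)"
  shows "mat_pos n H"
proof -
  obtain Y where Y: "\<forall>i<n. \<forall>j<n. H $$ (i, j) = (\<Sum>k<n. star (Y k i) * Y k j)"
    using cholesky[of n "\<lambda>i j. H $$ (i, j)" \<epsilon>] assms by blast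
  define M where "M = Matrix.mat n n (\<lambda>(i, j). Y i j)"
  have M: "M \<in> carrier_mat n n" by (simp add: M_def)
  have "H = mat_star M * M"
  proof (rule eq_matI)
    show "dim_row H = dim_row (mat_star M * M)" "dim_col H = dim_col (mat_star M * M)"
      using H M by (simp_all add: mat_star_def)
    fix i j assume "i < dim_row (mat_star M * M)" "j < dim_col (mat_star M * M)"
    then have "i < n" "j < n" using M by (simp_all add: mat_star_def)
    then show "H $$ (i, j) = (mat_star M * M) $$ (i, j)"
      using Y mat_star_mult_index[OF M] by (simp add: M_def)
  qed
  with M show ?thesis by (auto simp: mat_pos_def)
qed

lemma character_mat_pos:
  fixes X :: "'b::comm_cstar_algebra mat"
  assumes "mat_pos n X" "character \<omega>"
  shows "0 \<le> Re (\<Sum>i<n. \<Sum>j<n. cnj (x i) * \<omega> (X $$ (i, j)) * x j)"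
proof -
  obtain Y where Y: "Y \<in> carrier_mat n n" "X = mat_star Y * Y"
    using assms by (auto simp: mat_pos_def)
  let ?g = "\<lambda>k. \<Sum>j<n. \<omega> (Y $$ (k, j)) * x j"
  have "(\<Sum>i<n. \<Sum>j<n. cnj (x i) * \<omega> (X $$ (i, j)) * x j)
      = (\<Sum>i<n. \<Sum>j<n. \<Sum>k<n. cnj (\<omega> (Y $$ (k, i)) * x i) * (\<omega> (Y $$ (k, j)) * x j))"
    using mat_star_mult_index[OF Y(1)]
    by (simp add: Y(2) character_sum[OF assms(2)] character_mult[OF assms(2)] character_star[OF assms(2)]
        sum_distrib_left sum_distrib_right mult_ac)
  also have "\<dots> = (\<Sum>i<n. \<Sum>k<n. \<Sum>j<n. cnj (\<omega> (Y $$ (k, i)) * x i) * (\<omega> (Y $$ (k, j)) * x j))"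
    by (rule sum.cong[OF refl], rule sum.swap)
  also have "\<dots> = (\<Sum>k<n. \<Sum>i<n. \<Sum>j<n. cnj (\<omega> (Y $$ (k, i)) * x i) * (\<omega> (Y $$ (k, j)) * x j))"
    by (rule sum.swap)
  also have "\<dots> = (\<Sum>k<n. cnj (?g k) * ?g k)"
    by (simp add: sum_product)
  finally have "Re (\<Sum>i<n. \<Sum>j<n. cnj (x i) * \<omega> (X $$ (i, j)) * x j) = (\<Sum>k<n. Re (cnj (?g k) * ?g k))"
    by simp
  also have "\<dots> \<ge> 0"
  proof (rule sum_nonneg)
    have "0 \<le> Re (cnj z * z)" for z by simp
    then show "0 \<le> Re (cnj (?g k) * ?g k)" for k .
  qed
  finally show ?thesis .
qed

subsection \<open>Membership test for the minimal system\<close>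

text \<open>Positive on \<open>C\<close>, with no condition at higher matrix levels: out of a
  minimal system such maps are automatically completely positive. The maps \<omega> o \<Phi> for
  characters \<omega> are of this kind.\<close>

definition pos_map :: "nat \<Rightarrow> 'a::real_vector set \<Rightarrow> ('a \<Rightarrow> nat \<Rightarrow> nat \<Rightarrow> complex) \<Rightarrow> bool" where
  "pos_map d C \<psi> \<longleftrightarrow> (\<forall>a b. linear (\<lambda>v. \<psi> v a b)) \<and> (\<forall>v a b. cnj (\<psi> v a b) = \<psi> v b a) \<and>
     (\<forall>c\<in>C. \<forall>x. 0 \<le> Re (\<Sum>a<d. \<Sum>b<d. cnj (x a) * \<psi> c a b * x b))"

lemma psd_one_mat: "psd_mat s (1\<^sub>m s)"
proof -
  have "mat_star (1\<^sub>m s :: complex mat) = 1\<^sub>m s"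
    by (rule eq_matI) (auto simp: mat_star_def star_complex_def)
  then show ?thesis by (auto simp: psd_mat_def conjugate_square_ge_0_vec)
qed

lemma elem_in_min_cone:
  assumes "c \<in> C"
  shows "Matrix.mat 1 1 (\<lambda>_. (c, 0)) \<in> min_cone C 1"
  unfolding min_cone_def
proof (intro CollectI exI conjI)
  show "\<forall>k<Suc 0. 0 \<le> (1::real) \<and> psd_mat 1 (1\<^sub>m 1) \<and> c \<in> C" using assms psd_one_mat by simp
  show "Matrix.mat 1 1 (\<lambda>_. (c, 0)) =
    Matrix.mat 1 1 (\<lambda>ij. \<Sum>k<Suc 0. (1::real) *\<^sub>R (elem_tensor (1\<^sub>m 1) c $$ ij))"
    by (rule eq_matI) (auto simp: elem_tensor_def)
qed

lemma sum_blocks: "(\<Sum>p<s * d. f p) = (\<Sum>j<s. \<Sum>a<d. f (j * d + a))" for f :: "nat \<Rightarrow> 'c::comm_monoid_add"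
proof -
  have "(\<Sum>j<s. sum f {j * d..<j * d + d}) = (\<Sum>p<s * d. f p)" by (rule sum.nat_group)
  moreover have "sum f {j * d..<j * d + d} = (\<Sum>a<d. f (j * d + a))" for j
    using sum.shift_bounds_nat_ivl[of f 0 "j * d" d] by (simp add: atLeast0LessThan add.commute)
  ultimately show ?thesis by simp
qed

text \<open>Level one of the embedding makes \<omega> o \<Phi> a positive unital map for each
  character \<omega>. A lower bound \<epsilon> valid for all such maps therefore bounds the
  amplified matrix below at every character, so it is positive, and the embedding read backwards at
  level s yields membership.\<close>

lemma min_cone_test:
  fixes C :: "'a::real_vector set" and x :: "nat \<Rightarrow> nat \<Rightarrow> 'a"
  assumes sub: "subhomogeneous_of_degree TYPE('b::comm_cstar_algebra) d (min_cone C) u"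
    and s: "s \<ge> 1" and sym: "\<And>j k. x j k = x k j" and e: "\<epsilon> > 0"
    and test: "\<And>\<psi> \<xi>. pos_map d C \<psi> \<Longrightarrow> (\<And>a b. a < d \<Longrightarrow> b < d \<Longrightarrow> \<psi> u a b = (if a = b then 1 else 0)) \<Longrightarrow>
      \<epsilon> * (\<Sum>j<s. \<Sum>a<d. (cmod (\<xi> j a))\<^sup>2) \<le>
      Re (\<Sum>j<s. \<Sum>a<d. \<Sum>k<s. \<Sum>b<d. cnj (\<xi> j a) * \<psi> (x j k) a b * \<xi> k b)"
  shows "Matrix.mat s s (\<lambda>(j, k). (x j k, 0)) \<in> min_cone C s"
proof -
  obtain \<Phi> :: "'a \<Rightarrow> 'b mat" where
    carr': "\<forall>v. \<Phi> v \<in> carrier_mat d d \<and> mat_star (\<Phi> v) = \<Phi> v"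
    and lin': "\<forall>a<d. \<forall>b<d. linear (\<lambda>v. \<Phi> v $$ (a, b))"
    and unit: "\<Phi> u = 1\<^sub>m d"
    and emb': "\<forall>s\<ge>1. \<forall>X\<in>her_mat s. X \<in> min_cone C s \<longleftrightarrow> mat_pos (s * d) (amplify d \<Phi> X)"
    using sub unfolding subhomogeneous_of_degree_def by (elim exE conjE) (rule that)
  have carr: "\<Phi> v \<in> carrier_mat d d" and herm: "mat_star (\<Phi> v) = \<Phi> v" for v
    using carr' by simp_all
  have lin: "linear (\<lambda>v. \<Phi> v $$ (a, b))" if "a < d" "b < d" for a b
    using lin' that by simp
  have emb: "X \<in> min_cone C s \<longleftrightarrow> mat_pos (s * d) (amplify d \<Phi> X)" if "s \<ge> 1" "X \<in> her_mat s" for s X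
    using emb' that by simp
  have sPhi: "star (\<Phi> v $$ (a, b)) = \<Phi> v $$ (b, a)" if "a < d" "b < d" for v a b
  proof -
    have "mat_star (\<Phi> v) $$ (b, a) = star (\<Phi> v $$ (a, b))"
      using carr[of v] that by (simp add: mat_star_def)
    then show ?thesis by (simp add: herm)
  qed
  have zero: "\<Phi> 0 $$ (a, b) = 0" if "a < d" "b < d" for a b
    using lin[OF that] by (rule linear_0)
  let ?X = "Matrix.mat s s (\<lambda>(j, k). (x j k, 0 :: 'a))"
  have X: "?X \<in> her_mat s" by (auto simp: her_mat_def sym)
  define H where "H = amplify d \<Phi> ?X"
  have bound: "p div d < s" "p mod d < d" if "p < s * d" for p
  proof -
    have "0 < d" using that by (cases d) auto
    then show "p div d < s" "p mod d < d" using that by (auto simp: less_mult_imp_div_less)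
  qed
  have Hidx: "H $$ (p, r) = \<Phi> (x (p div d) (r div d)) $$ (p mod d, r mod d)"
    if "p < s * d" "r < s * d" for p r
    using that bound by (simp add: H_def amplify_def zero)
  have blk: "j * d + a < s * d" if "j < s" "a < d" for j a
  proof -
    have "j * d + a < Suc j * d" using that by simp
    also have "\<dots> \<le> s * d" using that by (intro mult_le_mono1) simp
    finally show ?thesis .
  qed
  have "mat_pos (s * d) H"
  proof (rule mat_pos_if_characters_pos[OF _ _ e])
    show "H \<in> carrier_mat (s * d) (s * d)" by (simp add: H_def amplify_def)
    show "star (H $$ (p, r)) = H $$ (r, p)" if "p < s * d" "r < s * d" for p r
      using that bound by (simp add: Hidx sPhi sym)
  next
    fix \<omega> :: "'b \<Rightarrow> complex" and y :: "nat \<Rightarrow> complex"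
    assume c: "character \<omega>"
    \<comment> \<open>Entries outside the d x d range are 0, so that linearity and symmetry hold for
      all indices.\<close>
    define \<psi> where "\<psi> v a b = (if a < d \<and> b < d then \<omega> (\<Phi> v $$ (a, b)) else 0)" for v a b
    have "linear (\<lambda>v. \<psi> v a b)" for a b
    proof (cases "a < d \<and> b < d")
      case True
      then show ?thesis
        using linear_add[OF lin[of a b]] linear_scale[OF lin[of a b]]
        by (intro linearI) (simp_all add: \<psi>_def character_add[OF c] character_scaleR[OF c])
    qed (auto intro!: linearI simp: \<psi>_def)
    moreover have "cnj (\<psi> v a b) = \<psi> v b a" for v a b
      by (simp add: \<psi>_def character_star[OF c, symmetric] sPhi)
    moreover have "0 \<le> Re (\<Sum>a<d. \<Sum>b<d. cnj (y a) * \<psi> v a b * y b)" if "v \<in> C" for v y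
    proof -
      let ?V = "Matrix.mat 1 1 (\<lambda>_. (v, 0 :: 'a))"
      have "?V \<in> her_mat 1" by (auto simp: her_mat_def)
      then have "mat_pos (1 * d) (amplify d \<Phi> ?V)"
        using emb[of 1 ?V] elem_in_min_cone[OF that] by blast
      moreover have "amplify d \<Phi> ?V $$ (a, b) = \<Phi> v $$ (a, b)" if "a < d" "b < d" for a b
        using that by (simp add: amplify_def zero)
      ultimately show ?thesis
        using character_mat_pos[OF _ c, of d "amplify d \<Phi> ?V" y] by (simp add: \<psi>_def)
    qed
    ultimately have "pos_map d C \<psi>" by (simp add: pos_map_def)
    moreover have "\<psi> u a b = (if a = b then 1 else 0)" if "a < d" "b < d" for a b
      using that by (simp add: \<psi>_def unit character_one[OF c] character_zero[OF c])
    ultimately have "\<epsilon> * (\<Sum>j<s. \<Sum>a<d. (cmod (y (j * d + a)))\<^sup>2) \<le>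
      Re (\<Sum>j<s. \<Sum>a<d. \<Sum>k<s. \<Sum>b<d. cnj (y (j * d + a)) * \<psi> (x j k) a b * y (k * d + b))"
      by (rule test)
    also have "(\<Sum>j<s. \<Sum>a<d. \<Sum>k<s. \<Sum>b<d. cnj (y (j * d + a)) * \<psi> (x j k) a b * y (k * d + b))
      = (\<Sum>p<s * d. \<Sum>r<s * d. cnj (y p) * \<omega> (H $$ (p, r)) * y r)"
      unfolding sum_blocks by (intro sum.cong refl) (simp add: Hidx blk \<psi>_def)
    also have "(\<Sum>j<s. \<Sum>a<d. (cmod (y (j * d + a)))\<^sup>2) = (\<Sum>p<s * d. (cmod (y p))\<^sup>2)"
      by (simp only: sum_blocks)
    finally show "\<epsilon> * (\<Sum>p<s * d. (cmod (y p))\<^sup>2) \<le>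
      Re (\<Sum>p<s * d. \<Sum>r<s * d. cnj (y p) * \<omega> (H $$ (p, r)) * y r)" .
  qed
  then show ?thesis using emb[OF s X] by (simp add: H_def)
qed

subsection \<open>Positive semidefinite forms\<close>

definition qform :: "nat \<Rightarrow> (nat \<Rightarrow> nat \<Rightarrow> complex) \<Rightarrow> (nat \<Rightarrow> complex) \<Rightarrow> (nat \<Rightarrow> complex) \<Rightarrow> complex" where
  "qform s B x y = (\<Sum>j<s. \<Sum>k<s. cnj (x j) * B j k * y k)"

definition psd_form :: "nat \<Rightarrow> (nat \<Rightarrow> nat \<Rightarrow> complex) \<Rightarrow> bool" where
  "psd_form s B \<longleftrightarrow> (\<forall>j<s. \<forall>k<s. cnj (B j k) = B k j) \<and> (\<forall>x. 0 \<le> Re (qform s B x x))"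

lemma qform_add_right: "qform s B x (\<lambda>i. y i + z i) = qform s B x y + qform s B x z"
  by (simp add: qform_def distrib_left sum.distrib)

lemma qform_add_left: "qform s B (\<lambda>i. y i + z i) x = qform s B y x + qform s B z x"
  by (simp add: qform_def distrib_right sum.distrib)

lemma qform_scale_right: "qform s B x (\<lambda>i. t * y i) = t * qform s B x y"
  by (simp add: qform_def sum_distrib_left mult_ac)

lemma qform_scale_left: "qform s B (\<lambda>i. t * y i) x = cnj t * qform s B y x"
  by (simp add: qform_def sum_distrib_left mult_ac)

lemma qform_flip:
  assumes "psd_form s B"
  shows "qform s B y x = cnj (qform s B x y)"
proof -
  have "cnj (qform s B x y) = (\<Sum>j<s. \<Sum>k<s. cnj (y k) * B k j * x j)"
    unfolding qform_def cnj_sum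
  proof (intro sum.cong refl)
    fix j k assume "j \<in> {..<s}" "k \<in> {..<s}"
    then have "cnj (B j k) = B k j" using assms by (simp add: psd_form_def)
    then show "cnj (cnj (x j) * B j k * y k) = cnj (y k) * B k j * x j" by simp
  qed
  also have "\<dots> = qform s B y x" unfolding qform_def by (rule sum.swap)
  finally show ?thesis by simp
qed

lemma qform_unit:
  assumes "j < s" "k < s"
  shows "qform s B (\<lambda>i. if i = j then 1 else 0) (\<lambda>i. if i = k then 1 else 0) = B j k"
proof -
  have "qform s B (\<lambda>i. if i = j then 1 else 0) (\<lambda>i. if i = k then 1 else 0)
      = (\<Sum>j'<s. \<Sum>k'<s. if j' = j then (if k' = k then B j' k' else 0) else 0)"
    unfolding qform_def by (intro sum.cong refl) simp
  also have "\<dots> = (\<Sum>j'<s. if j' = j then (\<Sum>k'<s. if k' = k then B j' k' else 0) else 0)"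
    by (intro sum.cong refl) simp
  finally show ?thesis using assms by simp
qed

lemma psd_form_bound:
  assumes "psd_form s B"
  shows "2 * cmod (qform s B x y) \<le> Re (qform s B x x) + Re (qform s B y y)"
proof (cases "qform s B x y = 0")
  case True
  then show ?thesis using assms by (simp add: psd_form_def)
next
  case False
  let ?q = "qform s B x y"
  \<comment> \<open>The phase with z * ?q = - |?q|, so that the cross terms of the form at x + z y
    are as negative as possible.\<close>
  define z where "z = - cnj ?q / complex_of_real (cmod ?q)"
  have zq: "z * ?q = - complex_of_real (cmod ?q)"
    using False complex_norm_square[of ?q]
    by (simp add: z_def field_simps power2_eq_square)
  have "cmod z = 1" using False by (simp add: z_def norm_divide)
  then have zz: "z * cnj z = 1" using complex_norm_square[of z] by simp
  have "qform s B (\<lambda>i. x i + z * y i) (\<lambda>i. x i + z * y i)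
      = qform s B x x + z * ?q + (cnj (z * ?q) + (z * cnj z) * qform s B y y)"
    by (simp only: qform_add_left qform_add_right qform_scale_left qform_scale_right
        qform_flip[OF assms, of y x] distrib_left complex_cnj_mult) (simp add: algebra_simps)
  also have "\<dots> = qform s B x x - 2 * complex_of_real (cmod ?q) + qform s B y y"
    by (simp only: zq zz) simp
  finally have "Re (qform s B (\<lambda>i. x i + z * y i) (\<lambda>i. x i + z * y i))
      = Re (qform s B x x) - 2 * cmod ?q + Re (qform s B y y)" by simp
  moreover have "0 \<le> Re (qform s B (\<lambda>i. x i + z * y i) (\<lambda>i. x i + z * y i))"
    using assms unfolding psd_form_def by blast
  ultimately show ?thesis by linarith
qed

text \<open>Let m be the modulus of the form at x, p and Q its value at x, x. Replacing x by t x in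
  \<open>psd_form_bound\<close> gives 2 t m <= t^2 Q for every t > 0, and a small t forces m =
  0.\<close>

lemma psd_form_null:
  assumes "psd_form s B" "Re (qform s B p p) = 0"
  shows "qform s B x p = 0"
proof (rule ccontr)
  assume *: "qform s B x p \<noteq> 0"
  define m where "m = cmod (qform s B x p)"
  define Q where "Q = Re (qform s B x x)"
  have m: "m > 0" using * by (simp add: m_def)
  have Q: "Q \<ge> 0" using assms by (simp add: Q_def psd_form_def)
  define t where "t = m / (Q + 1)"
  have t: "t > 0" using m Q by (simp add: t_def)
  have "2 * cmod (qform s B (\<lambda>i. complex_of_real t * x i) p)
      \<le> Re (qform s B (\<lambda>i. complex_of_real t * x i) (\<lambda>i. complex_of_real t * x i)) + Re (qform s B p p)"
    by (rule psd_form_bound[OF assms(1)])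
  then have "2 * (t * m) \<le> t * (t * Q)"
    using t by (simp add: qform_scale_left qform_scale_right norm_mult m_def Q_def assms(2))
  then have "2 * m \<le> t * Q" using t by simp
  also have "\<dots> \<le> m" using m Q by (simp add: t_def field_simps)
  finally show False using m by simp
qed

text \<open>A homogeneous system of d equations in s > d unknowns, padded with zero rows to a
  singular square matrix.\<close>

lemma common_null_vector:
  fixes \<xi> :: "nat \<Rightarrow> nat \<Rightarrow> complex"
  assumes "d < s"
  obtains w where "\<exists>k<s. w k \<noteq> 0" "\<And>a. a < d \<Longrightarrow> (\<Sum>k<s. \<xi> k a * w k) = 0"
proof -
  define A where "A = Matrix.mat s s (\<lambda>(a, k). if a < d then \<xi> k a else 0)"
  have A: "A \<in> carrier_mat s s" by (simp add: A_def)
  have eq: "A = mat\<^sub>r s s (\<lambda>i. if i = s - 1 then 0\<^sub>v s else Matrix.row A i)"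
    by (rule eq_matI) (use assms in \<open>auto simp: A_def\<close>)
  have "det (mat\<^sub>r s s (\<lambda>i. if i = s - 1 then 0\<^sub>v s else Matrix.row A i)) = 0"
    by (rule det_row_0) (use assms in \<open>auto simp: A_def\<close>)
  then have "det A = 0" using eq by simp
  then obtain v where v: "v \<in> carrier_vec s" "v \<noteq> 0\<^sub>v s" "A *\<^sub>v v = 0\<^sub>v s"
    using det_0_iff_vec_prod_zero[OF A] by blast
  show ?thesis
  proof (rule that)
    show "\<exists>k<s. v $ k \<noteq> 0"
    proof (rule ccontr)
      assume "\<not> (\<exists>k<s. v $ k \<noteq> 0)"
      then have "v = 0\<^sub>v s" using v(1) by (intro eq_vecI) auto
      then show False using v by simp
    qed
    fix a assume "a < d"
    then have "(A *\<^sub>v v) $ a = (\<Sum>k<s. \<xi> k a * v $ k)"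
      using assms v(1) by (simp add: A_def scalar_prod_def atLeast0LessThan)
    then show "(\<Sum>k<s. \<xi> k a * v $ k) = 0" using v(3) assms \<open>a < d\<close> by simp
  qed
qed

subsection \<open>The spectral gap\<close>

text \<open>\<open>B i\<close> stands for the image of the i-th ray under a positive map, and
  \<open>w\<close> for a common null vector; \<alpha> and \<gamma> are the constants of the second
  linear relation.\<close>

definition admissible ::
  "nat \<Rightarrow> real \<Rightarrow> real \<Rightarrow> (nat \<Rightarrow> nat \<Rightarrow> nat \<Rightarrow> complex) \<Rightarrow> (nat \<Rightarrow> complex) \<Rightarrow> bool" where
  "admissible s \<alpha> \<gamma> B w \<longleftrightarrow> (\<forall>i<5. psd_form s (B i)) \<and>
     (\<forall>j<s. \<forall>k<s. B 0 j k = B 1 j k - B 2 j k + B 3 j k) \<and>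
     (\<forall>j<s. \<forall>k<s. B 4 j k = of_real \<alpha> * B 1 j k - B 2 j k + of_real \<gamma> * B 3 j k) \<and>
     (\<forall>i<5. \<forall>j<s. (\<Sum>k<s. B i j k * w k) = 0)"

definition ctrace :: "nat \<Rightarrow> (nat \<Rightarrow> nat \<Rightarrow> nat \<Rightarrow> complex) \<Rightarrow> real" where
  "ctrace s B = (\<Sum>i<5. \<Sum>j<s. Re (B i j j))"

text \<open>For positive semidefinite \<open>B i\<close> and finite \<open>N i\<close> this vanishes
  exactly when each vector in \<open>N i\<close> is a null vector of \<open>B i\<close>.\<close>

definition defect :: "nat \<Rightarrow> (nat \<Rightarrow> (nat \<Rightarrow> real) set) \<Rightarrow> (nat \<Rightarrow> nat \<Rightarrow> nat \<Rightarrow> complex) \<Rightarrow> real" where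
  "defect s N B = (\<Sum>i<5. \<Sum>p\<in>N i. Re (qform s (B i) (\<lambda>j. of_real (p j)) (\<lambda>j. of_real (p j))))"

lemma compact_PiE_fun:
  fixes S :: "'i \<Rightarrow> 'c::topological_space set"
  assumes "\<And>i. compact (S i)"
  shows "compact (PiE UNIV S)"
proof -
  have "compactin (product_topology (\<lambda>_. euclidean) UNIV) (PiE UNIV S)"
    using assms by (auto simp: compactin_PiE)
  then show ?thesis by (simp add: euclidean_product_topology)
qed

lemma psd_form_entry_bound:
  assumes "psd_form s B" "j < s" "k < s"
  shows "2 * cmod (B j k) \<le> Re (B j j) + Re (B k k)" "0 \<le> Re (B j j)"
proof -
  show "2 * cmod (B j k) \<le> Re (B j j) + Re (B k k)"
    using psd_form_bound[OF assms(1), of "\<lambda>i. if i = j then 1 else 0" "\<lambda>i. if i = k then 1 else 0"] assms(2,3)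
    by (simp add: qform_unit)
  have "0 \<le> Re (qform s B (\<lambda>i. if i = j then 1 else 0) (\<lambda>i. if i = j then 1 else 0))"
    using assms(1) unfolding psd_form_def by blast
  then show "0 \<le> Re (B j j)" by (simp add: qform_unit assms)
qed

text \<open>Makes the tuples of trace 1 a bounded set.\<close>

lemma admissible_entry_bound:
  assumes "admissible s \<alpha> \<gamma> B w" "i < 5" "j < s" "k < s"
  shows "cmod (B i j k) \<le> ctrace s B"
proof -
  have psd: "psd_form s (B i)" if "i < 5" for i using assms that by (simp add: admissible_def)
  have le: "Re (B i l l) \<le> ctrace s B" if "l < s" for l
  proof -
    have "Re (B i l l) \<le> (\<Sum>j<s. Re (B i j j))"
      using that psd_form_entry_bound(2)[OF psd[OF assms(2)]] by (intro member_le_sum) auto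
    also have "\<dots> \<le> ctrace s B"
      unfolding ctrace_def using assms(2) psd_form_entry_bound(2)[OF psd]
      by (intro member_le_sum[of i "{..<5}" "\<lambda>i. \<Sum>j<s. Re (B i j j)"] sum_nonneg) auto
    finally show ?thesis .
  qed
  show ?thesis
    using psd_form_entry_bound(1)[OF psd[OF assms(2)] assms(3,4)] le[OF assms(3)] le[OF assms(4)] by linarith
qed

lemma closed_Collect_all_less: "(\<And>i. i < n \<Longrightarrow> closed {x. P i x}) \<Longrightarrow> closed {x. \<forall>i<(n::nat). P i x}"
  by (intro closed_Collect_all) (metis (mono_tags, lifting) Collect_cong closed_Collect_const closed_Collect_imp not_less open_Collect_const)

text \<open>Both sides are homogeneous in \<open>B\<close>, and \<open>w\<close> matters only up to
  scale. So it suffices to minimise \<open>defect\<close> over tuples of trace 1 with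
  \<open>w\<close> of norm 1, a compact set on which rigidity makes it positive.\<close>

lemma spectral_gap:
  assumes fin: "\<And>i. finite (N i)"
    and rigid: "\<And>B w. admissible s \<alpha> \<gamma> B w \<Longrightarrow> \<exists>k<s. w k \<noteq> 0 \<Longrightarrow> defect s N B = 0 \<Longrightarrow> ctrace s B = 0"
  shows "\<exists>\<delta>>0. \<forall>B w. admissible s \<alpha> \<gamma> B w \<longrightarrow> (\<exists>k<s. w k \<noteq> 0) \<longrightarrow> \<delta> * ctrace s B \<le> defect s N B"
proof -
  \<comment> \<open>Tuples and vectors are functions on infinite index types; indices out of range
    get the factor {0}, so that the product is compact by Tychonoff.\<close>
  define box where "box = PiE UNIV (\<lambda>(i::nat, j::nat, k::nat). if i < 5 \<and> j < s \<and> k < s then cball (0::complex) 1 else {0}) \<times>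
    PiE UNIV (\<lambda>k::nat. if k < s then cball (0::complex) 1 else {0})"
  define K where "K = box \<inter> {z. (\<forall>i<5. (\<forall>j<s. \<forall>k<s. cnj (fst z (i, j, k)) = fst z (i, k, j)) \<and>
        (\<forall>x. 0 \<le> Re (\<Sum>j<s. \<Sum>k<s. cnj (x j) * fst z (i, j, k) * x k))) \<and>
      (\<forall>j<s. \<forall>k<s. fst z (0, j, k) = fst z (1, j, k) - fst z (2, j, k) + fst z (3, j, k)) \<and>
      (\<forall>j<s. \<forall>k<s. fst z (4, j, k) = of_real \<alpha> * fst z (1, j, k) - fst z (2, j, k) + of_real \<gamma> * fst z (3, j, k)) \<and>
      (\<forall>i<5. \<forall>j<s. (\<Sum>k<s. fst z (i, j, k) * snd z k) = 0) \<and>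
      (\<Sum>i<5. \<Sum>j<s. Re (fst z (i, j, j))) = 1 \<and> (\<Sum>k<s. (cmod (snd z k))\<^sup>2) = 1}"
  have cf: "continuous_on UNIV (\<lambda>z :: (nat \<times> nat \<times> nat \<Rightarrow> complex) \<times> (nat \<Rightarrow> complex). fst z m)" for m
    by (rule continuous_on_product_then_coordinatewise) (intro continuous_intros)
  have cs: "continuous_on UNIV (\<lambda>z :: (nat \<times> nat \<times> nat \<Rightarrow> complex) \<times> (nat \<Rightarrow> complex). snd z m)" for m
    by (rule continuous_on_product_then_coordinatewise) (intro continuous_intros)
  have "compact box"
    unfolding box_def by (intro compact_Times compact_PiE_fun) (auto split: prod.splits)
  moreover have "closed {z :: (nat \<times> nat \<times> nat \<Rightarrow> complex) \<times> (nat \<Rightarrow> complex).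
      (\<forall>i<5. (\<forall>j<s. \<forall>k<s. cnj (fst z (i, j, k)) = fst z (i, k, j)) \<and>
        (\<forall>x. 0 \<le> Re (\<Sum>j<s. \<Sum>k<s. cnj (x j) * fst z (i, j, k) * x k))) \<and>
      (\<forall>j<s. \<forall>k<s. fst z (0, j, k) = fst z (1, j, k) - fst z (2, j, k) + fst z (3, j, k)) \<and>
      (\<forall>j<s. \<forall>k<s. fst z (4, j, k) = of_real \<alpha> * fst z (1, j, k) - fst z (2, j, k) + of_real \<gamma> * fst z (3, j, k)) \<and>
      (\<forall>i<5. \<forall>j<s. (\<Sum>k<s. fst z (i, j, k) * snd z k) = 0) \<and>
      (\<Sum>i<5. \<Sum>j<s. Re (fst z (i, j, j))) = 1 \<and> (\<Sum>k<s. (cmod (snd z k))\<^sup>2) = 1}"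
  proof -
    let ?fst = "fst :: (nat \<times> nat \<times> nat \<Rightarrow> complex) \<times> (nat \<Rightarrow> complex) \<Rightarrow> _"
    have "closed {z. cnj (?fst z (i, j, k)) = fst z (i, k, j)}" for i j k
      by (intro closed_Collect_eq continuous_on_cnj cf)
    moreover have "closed {z. 0 \<le> Re (\<Sum>j<s. \<Sum>k<s. cnj (x j) * ?fst z (i, j, k) * x k)}" for i x
      by (intro closed_Collect_le continuous_on_const continuous_on_Re continuous_on_sum continuous_on_mult cf)
    moreover have "closed {z. ?fst z (0, j, k) = fst z (1, j, k) - fst z (2, j, k) + fst z (3, j, k)}" for j k
      by (intro closed_Collect_eq continuous_on_add continuous_on_diff cf)
    moreover have "closed {z. ?fst z (4, j, k) = of_real \<alpha> * fst z (1, j, k) - fst z (2, j, k) + of_real \<gamma> * fst z (3, j, k)}" for j k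
      by (intro closed_Collect_eq continuous_on_add continuous_on_diff continuous_on_mult continuous_on_const cf)
    moreover have "closed {z. (\<Sum>k<s. ?fst z (i, j, k) * snd z k) = 0}" for i j
      by (intro closed_Collect_eq continuous_on_const continuous_on_sum continuous_on_mult cf cs)
    moreover have "closed {z. (\<Sum>i<5. \<Sum>j<s. Re (?fst z (i, j, j))) = 1}"
      by (intro closed_Collect_eq continuous_on_const continuous_on_sum continuous_on_Re cf)
    moreover have "closed {z :: (nat \<times> nat \<times> nat \<Rightarrow> complex) \<times> (nat \<Rightarrow> complex). (\<Sum>k<s. (cmod (snd z k))\<^sup>2) = 1}"
      by (intro closed_Collect_eq continuous_on_const continuous_on_sum continuous_on_power continuous_on_norm cs)
    ultimately show ?thesis
      by (intro closed_Collect_conj closed_Collect_all_less closed_Collect_all)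
  qed
  ultimately have K: "compact K" unfolding K_def by (rule compact_Int_closed)
  have K_adm: "admissible s \<alpha> \<gamma> (\<lambda>i j k. fst z (i, j, k)) (snd z)"
    "ctrace s (\<lambda>i j k. fst z (i, j, k)) = 1" "\<exists>k<s. snd z k \<noteq> 0" if "z \<in> K" for z
  proof -
    show "admissible s \<alpha> \<gamma> (\<lambda>i j k. fst z (i, j, k)) (snd z)" "ctrace s (\<lambda>i j k. fst z (i, j, k)) = 1"
      using that by (simp_all add: K_def admissible_def psd_form_def qform_def ctrace_def)
    show "\<exists>k<s. snd z k \<noteq> 0"
    proof (rule ccontr)
      assume "\<not> ?thesis"
      then have "(\<Sum>k<s. (cmod (snd z k))\<^sup>2) = 0" by simp
      then show False using that by (simp add: K_def)
    qed
  qed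
  define h where "h z = defect s N (\<lambda>i j k. fst z (i, j, k))" for z :: "(nat \<times> nat \<times> nat \<Rightarrow> complex) \<times> (nat \<Rightarrow> complex)"
  have "continuous_on UNIV h"
    unfolding h_def defect_def qform_def
    by (intro continuous_on_sum continuous_on_Re continuous_on_mult continuous_on_const cf)
  then have hc: "continuous_on K h" by (rule continuous_on_subset) simp
  have defect_nonneg: "0 \<le> defect s N B" if "admissible s \<alpha> \<gamma> B w" for B w
    using that unfolding defect_def by (intro sum_nonneg) (simp add: admissible_def psd_form_def)
  have hpos: "h z > 0" if "z \<in> K" for z
    using rigid[OF K_adm(1,3)[OF that]] K_adm(2)[OF that] defect_nonneg[OF K_adm(1)[OF that]]
    by (fastforce simp: h_def)
  obtain \<delta> where \<delta>: "\<delta> > 0" "\<And>z. z \<in> K \<Longrightarrow> \<delta> \<le> h z"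
  proof (cases "K = {}")
    \<comment> \<open>Without any normalised tuple every positive constant serves.\<close>
    case True
    then show ?thesis using that[of 1] by simp
  next
    case False
    obtain z0 where "z0 \<in> K" "\<forall>z\<in>K. h z0 \<le> h z"
      using continuous_attains_inf[OF K False hc] by blast
    then show ?thesis using that[of "h z0"] hpos by blast
  qed
  show ?thesis
  proof (intro exI[of _ \<delta>] conjI allI impI \<delta>(1))
    fix B w assume adm: "admissible s \<alpha> \<gamma> B w" and w: "\<exists>k<s. w k \<noteq> 0"
    define \<tau> where "\<tau> = ctrace s B"
    define r where "r = sqrt (\<Sum>k<s. (cmod (w k))\<^sup>2)"
    have psd: "psd_form s (B i)" if "i < 5" for i using adm that by (simp add: admissible_def)
    have "0 \<le> \<tau>"
      unfolding \<tau>_def ctrace_def using psd_form_entry_bound(2)[OF psd] by (intro sum_nonneg) auto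
    show "\<delta> * ctrace s B \<le> defect s N B"
    proof (cases "\<tau> = 0")
      case True
      then show ?thesis using defect_nonneg[OF adm] by (simp add: \<tau>_def)
    next
      case False
      with \<open>0 \<le> \<tau>\<close> have \<tau>: "\<tau> > 0" by simp
      obtain k0 where k0: "k0 < s" "w k0 \<noteq> 0" using w by blast
      have "(cmod (w k0))\<^sup>2 \<le> (\<Sum>k<s. (cmod (w k))\<^sup>2)"
        using k0 by (intro member_le_sum) auto
      moreover have "(cmod (w k0))\<^sup>2 > 0" using k0 by simp
      ultimately have r2: "(\<Sum>k<s. (cmod (w k))\<^sup>2) > 0" by linarith
      then have r: "r > 0" by (simp add: r_def)
      have rr: "r\<^sup>2 = (\<Sum>k<s. (cmod (w k))\<^sup>2)" using r2 by (simp add: r_def)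
      define f where "f = (\<lambda>(i, j, k). if i < 5 \<and> j < s \<and> k < s then B i j k / of_real \<tau> else 0)"
      define v where "v k = (if k < s then w k / of_real r else 0)" for k
      have f: "f (i, j, k) = B i j k / of_real \<tau>" if "i < 5" "j < s" "k < s" for i j k
        using that by (simp add: f_def)
      have v: "v k = w k / of_real r" if "k < s" for k using that by (simp add: v_def)
      have b1: "(f, v) \<in> box"
      proof -
        have nf: "cmod (f (i, j, k)) \<le> 1" if "i < 5" "j < s" "k < s" for i j k
          using admissible_entry_bound[OF adm that] \<tau> by (simp add: f that norm_divide \<tau>_def)
        have nv: "cmod (v k) \<le> 1" if "k < s" for k
        proof -
          have "(cmod (w k))\<^sup>2 \<le> r\<^sup>2" unfolding rr using that by (intro member_le_sum) auto
          then have "cmod (w k) \<le> r" by (rule power2_le_imp_le) (use r in simp)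
          then show ?thesis using r that by (simp add: v norm_divide)
        qed
        have fm: "f (i, j, k) \<in> (if i < 5 \<and> j < s \<and> k < s then cball 0 1 else {0})" for i j k
        proof (cases "i < 5 \<and> j < s \<and> k < s")
          case True
          then show ?thesis using nf by simp
        next
          case False
          then show ?thesis by (simp only: f_def prod.case if_False singletonI)
        qed
        have vm: "v k \<in> (if k < s then cball 0 1 else {0})" for k
        proof (cases "k < s")
          case True
          then show ?thesis using nv by simp
        next
          case False
          then show ?thesis by (simp only: v_def if_False singletonI)
        qed
        show ?thesis
          unfolding box_def
        proof (intro SigmaI PiE_I)
          fix m :: "nat \<times> nat \<times> nat"
          show "f m \<in> (case m of (i, j, k) \<Rightarrow> if i < 5 \<and> j < s \<and> k < s then cball 0 1 else {0})"
            by (cases m) (simp only: prod.case fm)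
        qed (use vm in auto)
      qed
      have b2: "cnj (f (i, j, k)) = f (i, k, j)" if "i < 5" "j < s" "k < s" for i j k
        using psd[OF that(1)] that by (simp add: f psd_form_def)
      have b3: "0 \<le> Re (\<Sum>j<s. \<Sum>k<s. cnj (x j) * f (i, j, k) * x k)" if "i < 5" for i x
      proof -
        have "(\<Sum>j<s. \<Sum>k<s. cnj (x j) * f (i, j, k) * x k) = (\<Sum>j<s. \<Sum>k<s. of_real (1 / \<tau>) * (cnj (x j) * B i j k * x k))"
          by (intro sum.cong refl) (simp add: f that)
        also have "\<dots> = of_real (1 / \<tau>) * qform s (B i) x x"
          by (simp only: qform_def sum_distrib_left)
        finally show ?thesis using psd[OF that] \<tau> by (simp add: psd_form_def)
      qed
      have b4: "f (0, j, k) = f (1, j, k) - f (2, j, k) + f (3, j, k)"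
        "f (4, j, k) = of_real \<alpha> * f (1, j, k) - f (2, j, k) + of_real \<gamma> * f (3, j, k)"
        if "j < s" "k < s" for j k
        using adm that by (simp_all add: f admissible_def diff_divide_distrib add_divide_distrib)
      have b5: "(\<Sum>k<s. f (i, j, k) * v k) = 0" if "i < 5" "j < s" for i j
      proof -
        have "(\<Sum>k<s. f (i, j, k) * v k) = (\<Sum>k<s. (B i j k * w k) / (of_real \<tau> * of_real r))"
          by (intro sum.cong refl) (simp add: f v that)
        also have "\<dots> = (\<Sum>k<s. B i j k * w k) / (of_real \<tau> * of_real r)" by (simp only: sum_divide_distrib)
        finally show ?thesis using adm that by (simp add: admissible_def)
      qed
      have b6: "(\<Sum>i<5. \<Sum>j<s. Re (f (i, j, j))) = 1"
      proof -
        have "(\<Sum>i<5. \<Sum>j<s. Re (f (i, j, j))) = (\<Sum>i<5. \<Sum>j<s. Re (B i j j) / \<tau>)"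
          by (intro sum.cong refl) (simp add: f)
        also have "\<dots> = \<tau> / \<tau>" by (simp only: \<tau>_def ctrace_def sum_divide_distrib)
        finally show ?thesis using \<tau> by simp
      qed
      have b7: "(\<Sum>k<s. (cmod (v k))\<^sup>2) = 1"
      proof -
        have "(\<Sum>k<s. (cmod (v k))\<^sup>2) = (\<Sum>k<s. (cmod (w k))\<^sup>2 / r\<^sup>2)"
          by (intro sum.cong refl) (simp add: v norm_divide power_divide)
        also have "\<dots> = r\<^sup>2 / r\<^sup>2" by (simp only: rr sum_divide_distrib)
        finally show ?thesis using r by simp
      qed
      have "(f, v) \<in> K"
        unfolding K_def Int_iff mem_Collect_eq fst_conv snd_conv
        by (intro conjI allI impI b1 b2 b3 b4 b5 b6 b7)
      then have "\<delta> \<le> h (f, v)" by (rule \<delta>(2))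
      also have "h (f, v) = (\<Sum>i<5. \<Sum>p\<in>N i. Re (qform s (B i) (\<lambda>j. of_real (p j)) (\<lambda>j. of_real (p j))) / \<tau>)"
        unfolding h_def defect_def
      proof (intro sum.cong refl)
        fix i :: nat and p :: "nat \<Rightarrow> real" assume i: "i \<in> {..<5}"
        have "qform s (\<lambda>j k. fst (f, v) (i, j, k)) (\<lambda>j. of_real (p j)) (\<lambda>j. of_real (p j))
          = (\<Sum>j<s. \<Sum>k<s. of_real (1 / \<tau>) * (cnj (of_real (p j)) * B i j k * of_real (p k)))"
          unfolding qform_def using i by (intro sum.cong refl) (simp add: f)
        also have "\<dots> = of_real (1 / \<tau>) * qform s (B i) (\<lambda>j. of_real (p j)) (\<lambda>j. of_real (p j))"
          by (simp only: qform_def sum_distrib_left)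
        finally show "Re (qform s (\<lambda>j k. fst (f, v) (i, j, k)) (\<lambda>j. of_real (p j)) (\<lambda>j. of_real (p j)))
          = Re (qform s (B i) (\<lambda>j. of_real (p j)) (\<lambda>j. of_real (p j))) / \<tau>"
          by simp
      qed
      also have "\<dots> = defect s N B / \<tau>" by (simp only: defect_def sum_divide_distrib)
      finally show ?thesis using \<tau> by (simp add: \<tau>_def field_simps)
    qed
  qed
qed

subsection \<open>A criterion for not being subhomogeneous\<close>

text \<open>Makes the Cholesky factorisation over C*-algebras available for complex
  matrices.\<close>

lemma character_complex:
  assumes "character (\<omega> :: complex \<Rightarrow> complex)"
  shows "\<omega> z = z"
  using character_cscale[OF assms, of z 1] character_one[OF assms] by (simp add: cscale_complex_def)

lemma psd_mat_form:
  assumes "psd_mat s A"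
  shows "0 \<le> Re (\<Sum>j<s. \<Sum>k<s. cnj (v j) * A $$ (j, k) * v k)"
proof -
  let ?v = "Matrix.vec s v"
  have A: "A \<in> carrier_mat s s" using assms by (simp add: psd_mat_def)
  have "0 \<le> (A *\<^sub>v ?v) \<bullet>c ?v" using assms by (simp add: psd_mat_def)
  also have "(A *\<^sub>v ?v) \<bullet>c ?v = (\<Sum>j<s. (\<Sum>k<s. A $$ (j, k) * v k) * cnj (v j))"
    using A by (simp add: scalar_prod_def atLeast0LessThan)
  also have "\<dots> = (\<Sum>j<s. \<Sum>k<s. cnj (v j) * A $$ (j, k) * v k)"
    by (simp add: sum_distrib_left sum_distrib_right mult_ac)
  finally show ?thesis by (simp add: less_eq_complex_def)
qed

lemma sum_rotate: "(\<Sum>k\<in>B. \<Sum>a\<in>C. \<Sum>b\<in>D. g k a b) = (\<Sum>a\<in>C. \<Sum>b\<in>D. \<Sum>k\<in>B. g k a b)"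
proof -
  have "(\<Sum>k\<in>B. \<Sum>a\<in>C. \<Sum>b\<in>D. g k a b) = (\<Sum>a\<in>C. \<Sum>k\<in>B. \<Sum>b\<in>D. g k a b)" by (rule sum.swap)
  also have "\<dots> = (\<Sum>a\<in>C. \<Sum>b\<in>D. \<Sum>k\<in>B. g k a b)" by (intro sum.cong refl sum.swap)
  finally show ?thesis .
qed

text \<open>If R = Y^* Y, the sum adds up the values of the form of A at the rows of Y. Cholesky
  asks for a strictly positive matrix, so it is applied to R + \<eta>, and \<eta> tends to
  0.\<close>

lemma psd_trace_product_nonneg:
  assumes A: "psd_mat s A" and sym: "\<And>j k. R j k = R k j"
    and psd: "\<And>x :: nat \<Rightarrow> real. 0 \<le> (\<Sum>j<s. \<Sum>k<s. x j * R j k * x k)"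
  shows "0 \<le> (\<Sum>j<s. \<Sum>k<s. Re (A $$ (j, k)) * R j k)"
proof -
  define S where "S = (\<Sum>j<s. \<Sum>k<s. Re (A $$ (j, k)) * R j k)"
  define t where "t = (\<Sum>j<s. Re (A $$ (j, j)))"
  have main: "0 \<le> S + \<eta> * t" if \<eta>: "\<eta> > 0" for \<eta>
  proof -
    define H where "H j k = complex_of_real (R j k + (if j = k then \<eta> else 0))" for j k
    have "\<exists>Y. \<forall>i<s. \<forall>j<s. H i j = (\<Sum>k<s. star (Y k i) * Y k j)"
    proof (rule cholesky[OF _ \<eta>])
      show "star (H i j) = H j i" for i j by (simp add: H_def star_complex_def sym)
    next
      fix \<omega> :: "complex \<Rightarrow> complex" and x :: "nat \<Rightarrow> complex"
      assume "character \<omega>"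
      have "Re (\<Sum>i<s. \<Sum>j<s. cnj (x i) * \<omega> (H i j) * x j)
          = (\<Sum>i<s. \<Sum>j<s. (Re (x i) * R i j * Re (x j) + Im (x i) * R i j * Im (x j)) + (if i = j then \<eta> * (cmod (x i))\<^sup>2 else 0))"
        unfolding Re_sum character_complex[OF \<open>character \<omega>\<close>]
        by (intro sum.cong refl) (auto simp: H_def cmod_power2 power2_eq_square[of "Re _"] power2_eq_square[of "Im _"] algebra_simps)
      also have "\<dots> = (\<Sum>i<s. \<Sum>j<s. Re (x i) * R i j * Re (x j)) + (\<Sum>i<s. \<Sum>j<s. Im (x i) * R i j * Im (x j))
          + (\<Sum>i<s. \<eta> * (cmod (x i))\<^sup>2)"
        by (simp add: sum.distrib)
      also have "\<dots> \<ge> \<eta> * (\<Sum>i<s. (cmod (x i))\<^sup>2)"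
        using psd[of "\<lambda>i. Re (x i)"] psd[of "\<lambda>i. Im (x i)"] by (simp add: sum_distrib_left)
      finally show "\<eta> * (\<Sum>i<s. (cmod (x i))\<^sup>2) \<le> Re (\<Sum>i<s. \<Sum>j<s. cnj (x i) * \<omega> (H i j) * x j)" .
    qed
    then obtain Y where Y: "\<And>i j. i < s \<Longrightarrow> j < s \<Longrightarrow> H i j = (\<Sum>k<s. star (Y k i) * Y k j)" by blast
    have "S + \<eta> * t = (\<Sum>j<s. \<Sum>k<s. Re (A $$ (j, k)) * R j k + (if j = k then \<eta> * Re (A $$ (j, k)) else 0))"
      by (simp add: sum.distrib S_def t_def sum_distrib_left)
    also have "\<dots> = (\<Sum>j<s. \<Sum>k<s. Re (A $$ (j, k) * H j k))"
      by (intro sum.cong refl) (auto simp: H_def algebra_simps)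
    also have "\<dots> = (\<Sum>j<s. \<Sum>k<s. \<Sum>l<s. Re (cnj (Y l j) * A $$ (j, k) * Y l k))"
      by (intro sum.cong refl) (simp add: Y star_complex_def sum_distrib_left mult_ac del: times_complex.simps)
    also have "\<dots> = (\<Sum>l<s. \<Sum>j<s. \<Sum>k<s. Re (cnj (Y l j) * A $$ (j, k) * Y l k))"
      by (rule sum_rotate[symmetric])
    also have "\<dots> = (\<Sum>l<s. Re (\<Sum>j<s. \<Sum>k<s. cnj (Y l j) * A $$ (j, k) * Y l k))"
      by (simp only: Re_sum)
    also have "\<dots> \<ge> 0" by (intro sum_nonneg psd_mat_form A)
    finally show ?thesis .
  qed
  have "0 \<le> S"
  proof (rule ccontr)
    assume "\<not> 0 \<le> S"
    \<comment> \<open>Chosen so that \<eta> t is at most - S / 2.\<close>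
    define \<eta> where "\<eta> = - S / (2 * (\<bar>t\<bar> + 1))"
    have "\<eta> > 0" using \<open>\<not> 0 \<le> S\<close> by (simp add: \<eta>_def field_simps)
    have "\<eta> * t \<le> \<eta> * (\<bar>t\<bar> + 1)" using \<open>\<eta> > 0\<close> by (intro mult_left_mono) auto
    also have "\<dots> = - S / 2" by (simp add: \<eta>_def field_simps)
    finally show False using main[OF \<open>\<eta> > 0\<close>] \<open>\<not> 0 \<le> S\<close> by linarith
  qed
  then show ?thesis by (simp add: S_def)
qed

text \<open>On a tensor of A and c the sum is the trace pairing of the real part of A with
  \<open>\<phi> c\<close>, nonnegative by \<open>psd_trace_product_nonneg\<close>.\<close>

lemma min_cone_functional:
  fixes \<phi> :: "'a::real_vector \<Rightarrow> nat \<Rightarrow> nat \<Rightarrow> real"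
  assumes X: "Matrix.mat s s (\<lambda>(j, k). (x j k, 0)) \<in> min_cone C s"
    and lin: "\<And>j k. linear (\<lambda>v. \<phi> v j k)" and sym: "\<And>v j k. \<phi> v j k = \<phi> v k j"
    and psd: "\<And>c y :: nat \<Rightarrow> real. c \<in> C \<Longrightarrow> 0 \<le> (\<Sum>j<s. \<Sum>k<s. y j * \<phi> c j k * y k)"
  shows "0 \<le> (\<Sum>j<s. \<Sum>k<s. \<phi> (x j k) j k)"
proof -
  obtain n :: nat and t :: "nat \<Rightarrow> real" and A c where
    tAc: "\<And>m. m < n \<Longrightarrow> 0 \<le> t m \<and> psd_mat s (A m) \<and> c m \<in> C" and
    eq: "Matrix.mat s s (\<lambda>(j, k). (x j k, 0)) =
      Matrix.mat s s (\<lambda>ij. \<Sum>m<n. t m *\<^sub>R (elem_tensor (A m) (c m) $$ ij))"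
    using X unfolding min_cone_def by blast
  have x: "x j k = (\<Sum>m<n. (t m * Re (A m $$ (j, k))) *\<^sub>R c m)" if "j < s" "k < s" for j k
  proof -
    have "(x j k, 0) = (\<Sum>m<n. t m *\<^sub>R (elem_tensor (A m) (c m) $$ (j, k)))"
      using arg_cong[OF eq, of "\<lambda>M. M $$ (j, k)"] that by simp
    then have "x j k = (\<Sum>m<n. fst (t m *\<^sub>R (elem_tensor (A m) (c m) $$ (j, k))))"
      by (simp add: prod_eq_iff fst_sum)
    also have "\<dots> = (\<Sum>m<n. (t m * Re (A m $$ (j, k))) *\<^sub>R c m)"
    proof (intro sum.cong refl)
      fix m assume "m \<in> {..<n}"
      then have "A m \<in> carrier_mat s s" using tAc[of m] by (simp add: psd_mat_def)
      then show "fst (t m *\<^sub>R (elem_tensor (A m) (c m) $$ (j, k))) = (t m * Re (A m $$ (j, k))) *\<^sub>R c m"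
        using that by (simp add: elem_tensor_def)
    qed
    finally show ?thesis .
  qed
  have "(\<Sum>j<s. \<Sum>k<s. \<phi> (x j k) j k) = (\<Sum>j<s. \<Sum>k<s. \<Sum>m<n. t m * (Re (A m $$ (j, k)) * \<phi> (c m) j k))"
    by (intro sum.cong refl) (simp add: x linear_sum[OF lin] linear_scale[OF lin] mult.assoc)
  also have "\<dots> = (\<Sum>m<n. \<Sum>j<s. \<Sum>k<s. t m * (Re (A m $$ (j, k)) * \<phi> (c m) j k))"
    by (rule sum_rotate[symmetric])
  also have "\<dots> = (\<Sum>m<n. t m * (\<Sum>j<s. \<Sum>k<s. Re (A m $$ (j, k)) * \<phi> (c m) j k))"
    by (simp only: sum_distrib_left)
  also have "\<dots> \<ge> 0"
    using tAc by (intro sum_nonneg mult_nonneg_nonneg psd_trace_product_nonneg sym psd) auto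
  finally show ?thesis .
qed

text \<open>The entries of X; \<open>N i\<close> holds the chosen null vectors for the i-th
  ray.\<close>

definition witness ::
  "(nat \<Rightarrow> 'a::real_vector) \<Rightarrow> (nat \<Rightarrow> (nat \<Rightarrow> real) set) \<Rightarrow> real \<Rightarrow> real \<Rightarrow> 'a \<Rightarrow> nat \<Rightarrow> nat \<Rightarrow> 'a" where
  "witness c N \<delta> \<epsilon> u j k =
     (\<Sum>i<5. ((\<Sum>p\<in>N i. p j * p k) - (if j = k then \<delta> else 0)) *\<^sub>R c i) + (if j = k then \<epsilon> else 0) *\<^sub>R u"

text \<open>Used twice: for a compressed positive map, where the three terms are defect, trace and a
  squared norm, and for the degenerate map \<open>\<phi>\<close>, where the first term
  vanishes.\<close>

lemma witness_eval:
  fixes L :: "'a::real_vector \<Rightarrow> nat \<Rightarrow> nat \<Rightarrow> real"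
  assumes lin: "\<And>j k. linear (\<lambda>v. L v j k)"
  shows "(\<Sum>j<s. \<Sum>k<s. L (witness c N \<delta> \<epsilon> u j k) j k) =
    (\<Sum>i<5. \<Sum>p\<in>N i. \<Sum>j<s. \<Sum>k<s. p j * L (c i) j k * p k) - \<delta> * (\<Sum>i<5. \<Sum>j<s. L (c i) j j) + \<epsilon> * (\<Sum>j<s. L u j j)"
proof -
  have "L (witness c N \<delta> \<epsilon> u j k) j k = (\<Sum>i<5. \<Sum>p\<in>N i. p j * L (c i) j k * p k)
      - (if j = k then \<delta> * (\<Sum>i<5. L (c i) j k) else 0) + (if j = k then \<epsilon> * L u j k else 0)" for j k
  proof -
    have "L (witness c N \<delta> \<epsilon> u j k) j k = (\<Sum>i<5. ((\<Sum>p\<in>N i. p j * p k) - (if j = k then \<delta> else 0)) * L (c i) j k)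
        + (if j = k then \<epsilon> else 0) * L u j k"
      unfolding witness_def by (simp only: linear_add[OF lin] linear_sum[OF lin] linear_scale[OF lin] real_scaleR_def)
    also have "(\<Sum>i<5. ((\<Sum>p\<in>N i. p j * p k) - (if j = k then \<delta> else 0)) * L (c i) j k)
        = (\<Sum>i<5. (\<Sum>p\<in>N i. p j * L (c i) j k * p k) - (if j = k then \<delta> else 0) * L (c i) j k)"
    proof -
      have "(\<Sum>p\<in>N i. p j * p k) * y = (\<Sum>p\<in>N i. p j * y * p k)" for i y
        unfolding sum_distrib_right by (intro sum.cong refl) simp
      then show ?thesis by (simp only: left_diff_distrib)
    qed
    also have "\<dots> = (\<Sum>i<5. \<Sum>p\<in>N i. p j * L (c i) j k * p k) - (if j = k then \<delta> else 0) * (\<Sum>i<5. L (c i) j k)"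
      by (simp only: sum_subtractf sum_distrib_left)
    finally show ?thesis by simp
  qed
  then have "(\<Sum>j<s. \<Sum>k<s. L (witness c N \<delta> \<epsilon> u j k) j k)
      = (\<Sum>j<s. \<Sum>k<s. \<Sum>i<5. \<Sum>p\<in>N i. p j * L (c i) j k * p k)
        - (\<Sum>j<s. \<Sum>k<s. if j = k then \<delta> * (\<Sum>i<5. L (c i) j k) else 0)
        + (\<Sum>j<s. \<Sum>k<s. if j = k then \<epsilon> * L u j k else 0)"
    by (simp only: sum.distrib sum_subtractf)
  also have "(\<Sum>j<s. \<Sum>k<s. if j = k then \<delta> * (\<Sum>i<5. L (c i) j k) else 0) = \<delta> * (\<Sum>i<5. \<Sum>j<s. L (c i) j j)"
  proof -
    have "(\<Sum>j<s. \<Sum>k<s. if j = k then \<delta> * (\<Sum>i<5. L (c i) j k) else 0) = (\<Sum>j<s. \<delta> * (\<Sum>i<5. L (c i) j j))"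
      by simp
    also have "\<dots> = \<delta> * (\<Sum>j<s. \<Sum>i<5. L (c i) j j)" by (simp only: sum_distrib_left)
    also have "(\<Sum>j<s. \<Sum>i<5. L (c i) j j) = (\<Sum>i<5. \<Sum>j<s. L (c i) j j)" by (rule sum.swap)
    finally show ?thesis .
  qed
  also have "(\<Sum>j<s. \<Sum>k<s. if j = k then \<epsilon> * L u j k else 0) = \<epsilon> * (\<Sum>j<s. L u j j)"
    by (simp add: sum_distrib_left)
  also have "(\<Sum>j<s. \<Sum>k<s. \<Sum>i<5. \<Sum>p\<in>N i. p j * L (c i) j k * p k)
      = (\<Sum>i<5. \<Sum>j<s. \<Sum>k<s. \<Sum>p\<in>N i. p j * L (c i) j k * p k)"
    by (rule sum_rotate[symmetric])
  also have "\<dots> = (\<Sum>i<5. \<Sum>p\<in>N i. \<Sum>j<s. \<Sum>k<s. p j * L (c i) j k * p k)"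
    by (intro sum.cong refl sum_rotate[symmetric])
  finally show ?thesis .
qed

text \<open>Two evaluations of \<open>witness\<close> collide. A unital positive map into d x d
  matrices gives at least \<epsilon> times the squared norm of \<xi>, by the spectral gap;
  \<open>\<phi>\<close> gives - \<delta> \<tau> + \<epsilon> \<upsilon> < 0. The bound d < s
  provides the common null vector.\<close>

lemma not_subhomogeneous_criterion:
  fixes C :: "'a::real_vector set" and c :: "nat \<Rightarrow> 'a" and \<phi> :: "'a \<Rightarrow> nat \<Rightarrow> nat \<Rightarrow> real"
  assumes ds: "d < s" and cC: "\<And>i. i < 5 \<Longrightarrow> c i \<in> C" and uC: "u \<in> C"
    and rel: "c 0 = c 1 - c 2 + c 3" "c 4 = \<alpha> *\<^sub>R c 1 - c 2 + \<gamma> *\<^sub>R c 3"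
    and fin: "\<And>i. finite (N i)"
    and lin: "\<And>j k. linear (\<lambda>v. \<phi> v j k)" and sym: "\<And>v j k. \<phi> v j k = \<phi> v k j"
    and psd: "\<And>v y :: nat \<Rightarrow> real. v \<in> C \<Longrightarrow> 0 \<le> (\<Sum>j<s. \<Sum>k<s. y j * \<phi> v j k * y k)"
    and null: "\<And>i p. i < 5 \<Longrightarrow> p \<in> N i \<Longrightarrow> (\<Sum>j<s. \<Sum>k<s. p j * \<phi> (c i) j k * p k) = 0"
    and tr: "(\<Sum>i<5. \<Sum>j<s. \<phi> (c i) j j) > 0"
    and rigid: "\<And>B w. admissible s \<alpha> \<gamma> B w \<Longrightarrow> \<exists>k<s. w k \<noteq> 0 \<Longrightarrow> defect s N B = 0 \<Longrightarrow> ctrace s B = 0"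
  shows "\<not> subhomogeneous_of_degree TYPE('b::comm_cstar_algebra) d (min_cone C) u"
proof
  assume sub: "subhomogeneous_of_degree TYPE('b::comm_cstar_algebra) d (min_cone C) u"
  have "\<exists>\<delta>>0. \<forall>B w. admissible s \<alpha> \<gamma> B w \<longrightarrow> (\<exists>k<s. w k \<noteq> 0) \<longrightarrow> \<delta> * ctrace s B \<le> defect s N B"
    by (rule spectral_gap[OF fin rigid])
  then obtain \<delta> where \<delta>: "\<delta> > 0"
    "\<forall>B w. admissible s \<alpha> \<gamma> B w \<longrightarrow> (\<exists>k<s. w k \<noteq> 0) \<longrightarrow> \<delta> * ctrace s B \<le> defect s N B"
    by (elim exE conjE) (rule that)
  define \<tau> where "\<tau> = (\<Sum>i<5. \<Sum>j<s. \<phi> (c i) j j)"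
  define \<upsilon> where "\<upsilon> = (\<Sum>j<s. \<phi> u j j)"
  \<comment> \<open>Makes \<epsilon> \<upsilon> at most \<delta> \<tau> / 2, whatever the sign of
    \<upsilon>.\<close>
  define \<epsilon> where "\<epsilon> = \<delta> * \<tau> / (2 * (\<bar>\<upsilon>\<bar> + 1))"
  have e: "\<epsilon> > 0" using \<delta>(1) tr by (simp add: \<epsilon>_def \<tau>_def)
  have wsym: "witness c N \<delta> \<epsilon> u j k = witness c N \<delta> \<epsilon> u k j" for j k
    by (simp add: witness_def mult.commute eq_commute[of j k])
  have "Matrix.mat s s (\<lambda>(j, k). (witness c N \<delta> \<epsilon> u j k, 0)) \<in> min_cone C s"
  proof (rule min_cone_test[OF sub _ wsym e])
    show "1 \<le> s" using ds by simp
    fix \<psi> :: "'a \<Rightarrow> nat \<Rightarrow> nat \<Rightarrow> complex" and \<xi> :: "nat \<Rightarrow> nat \<Rightarrow> complex"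
    assume pos: "pos_map d C \<psi>" and unit: "\<And>a b. a < d \<Longrightarrow> b < d \<Longrightarrow> \<psi> u a b = (if a = b then 1 else 0)"
    have plin: "linear (\<lambda>v. \<psi> v a b)" and pherm: "cnj (\<psi> v a b) = \<psi> v b a" for v a b
      using pos by (simp_all add: pos_map_def)
    \<comment> \<open>\<open>G v\<close> is Xi^* \<psi>(v) Xi for the d x s matrix Xi with columns
      \<xi> j, so a vector annihilated by Xi is null for every \<open>G v\<close>.\<close>
    define G where "G v j k = (\<Sum>a<d. \<Sum>b<d. cnj (\<xi> j a) * \<psi> v a b * \<xi> k b)" for v j k
    have Glin: "linear (\<lambda>v. G v j k)" for j k
      by (intro linearI)
         (simp_all add: G_def linear_add[OF plin] linear_scale[OF plin] distrib_left distrib_right sum.distrib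
          scaleR_sum_right)
    have qG: "qform s (G v) x y = (\<Sum>a<d. \<Sum>b<d. cnj (\<Sum>j<s. x j * \<xi> j a) * \<psi> v a b * (\<Sum>k<s. y k * \<xi> k b))" for v x y
    proof -
      have "qform s (G v) x y = (\<Sum>j<s. \<Sum>k<s. \<Sum>a<d. \<Sum>b<d. cnj (x j * \<xi> j a) * \<psi> v a b * (y k * \<xi> k b))"
        by (simp add: qform_def G_def sum_distrib_left sum_distrib_right mult_ac)
      also have "\<dots> = (\<Sum>j<s. \<Sum>a<d. \<Sum>b<d. \<Sum>k<s. cnj (x j * \<xi> j a) * \<psi> v a b * (y k * \<xi> k b))"
        by (intro sum.cong refl sum_rotate)
      also have "\<dots> = (\<Sum>a<d. \<Sum>b<d. \<Sum>j<s. \<Sum>k<s. cnj (x j * \<xi> j a) * \<psi> v a b * (y k * \<xi> k b))"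
        by (rule sum_rotate)
      also have "\<dots> = (\<Sum>a<d. \<Sum>b<d. cnj (\<Sum>j<s. x j * \<xi> j a) * \<psi> v a b * (\<Sum>k<s. y k * \<xi> k b))"
        by (simp only: cnj_sum sum_distrib_left sum_distrib_right) (intro sum.cong refl sum.swap)
      finally show ?thesis .
    qed
    obtain w where w: "\<exists>k<s. w k \<noteq> 0" "\<And>a. a < d \<Longrightarrow> (\<Sum>k<s. \<xi> k a * w k) = 0"
      using common_null_vector[OF ds] by blast
    have "admissible s \<alpha> \<gamma> (\<lambda>i. G (c i)) w"
      unfolding admissible_def
    proof (intro conjI allI impI)
      fix i :: nat assume i: "i < 5"
      have "cnj (G (c i) j k) = G (c i) k j" for j k
      proof -
        have "cnj (G (c i) j k) = (\<Sum>a<d. \<Sum>b<d. cnj (\<xi> k b) * \<psi> (c i) b a * \<xi> j a)"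
          by (simp add: G_def cnj_sum pherm mult_ac)
        also have "\<dots> = G (c i) k j" unfolding G_def by (rule sum.swap)
        finally show ?thesis .
      qed
      moreover have "0 \<le> Re (qform s (G (c i)) x x)" for x
      proof -
        have "0 \<le> Re (\<Sum>a<d. \<Sum>b<d. cnj (\<eta> a) * \<psi> (c i) a b * \<eta> b)" for \<eta>
          using pos cC[OF i] unfolding pos_map_def by blast
        from this[of "\<lambda>a. \<Sum>j<s. x j * \<xi> j a"] show ?thesis unfolding qG .
      qed
      ultimately show "psd_form s (G (c i))" by (simp add: psd_form_def)
      fix j assume "j < s"
      have "(\<Sum>k<s. G (c i) j k * w k) = (\<Sum>k<s. \<Sum>a<d. \<Sum>b<d. cnj (\<xi> j a) * \<psi> (c i) a b * (\<xi> k b * w k))"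
        by (simp only: G_def sum_distrib_right mult.assoc)
      also have "\<dots> = (\<Sum>a<d. \<Sum>b<d. \<Sum>k<s. cnj (\<xi> j a) * \<psi> (c i) a b * (\<xi> k b * w k))"
        by (rule sum_rotate)
      also have "\<dots> = (\<Sum>a<d. \<Sum>b<d. cnj (\<xi> j a) * \<psi> (c i) a b * (\<Sum>k<s. \<xi> k b * w k))"
        by (simp only: sum_distrib_left)
      also have "\<dots> = 0" by (simp add: w(2))
      finally show "(\<Sum>k<s. G (c i) j k * w k) = 0" .
    next
      fix j k
      show "G (c 0) j k = G (c 1) j k - G (c 2) j k + G (c 3) j k"
        by (simp only: rel linear_add[OF Glin] linear_diff[OF Glin])
      show "G (c 4) j k = of_real \<alpha> * G (c 1) j k - G (c 2) j k + of_real \<gamma> * G (c 3) j k"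
        by (simp only: rel linear_add[OF Glin] linear_diff[OF Glin] linear_scale[OF Glin] scaleR_conv_of_real)
    qed
    then have gap: "\<delta> * ctrace s (\<lambda>i. G (c i)) \<le> defect s N (\<lambda>i. G (c i))"
      using w(1) \<delta>(2) by simp
    have RGlin: "linear (\<lambda>v. Re (G v j k))" for j k
      using linear_compose[OF Glin, of Re] by (simp add: o_def bounded_linear.linear[OF bounded_linear_Re])
    have "(\<Sum>j<s. \<Sum>a<d. \<Sum>k<s. \<Sum>b<d. cnj (\<xi> j a) * \<psi> (witness c N \<delta> \<epsilon> u j k) a b * \<xi> k b)
      = (\<Sum>j<s. \<Sum>k<s. G (witness c N \<delta> \<epsilon> u j k) j k)"
      unfolding G_def by (intro sum.cong refl sum.swap)
    then have "Re (\<Sum>j<s. \<Sum>a<d. \<Sum>k<s. \<Sum>b<d. cnj (\<xi> j a) * \<psi> (witness c N \<delta> \<epsilon> u j k) a b * \<xi> k b)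
      = (\<Sum>j<s. \<Sum>k<s. Re (G (witness c N \<delta> \<epsilon> u j k) j k))"
      by (simp only: Re_sum)
    also have "\<dots> = (\<Sum>i<5. \<Sum>p\<in>N i. \<Sum>j<s. \<Sum>k<s. p j * Re (G (c i) j k) * p k)
        - \<delta> * (\<Sum>i<5. \<Sum>j<s. Re (G (c i) j j)) + \<epsilon> * (\<Sum>j<s. Re (G u j j))"
      by (rule witness_eval[OF RGlin])
    also have "(\<Sum>i<5. \<Sum>p\<in>N i. \<Sum>j<s. \<Sum>k<s. p j * Re (G (c i) j k) * p k) = defect s N (\<lambda>i. G (c i))"
      by (simp add: defect_def qform_def)
    also have "(\<Sum>i<5. \<Sum>j<s. Re (G (c i) j j)) = ctrace s (\<lambda>i. G (c i))"
      by (simp add: ctrace_def)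
    also have "(\<Sum>j<s. Re (G u j j)) = (\<Sum>j<s. \<Sum>a<d. (cmod (\<xi> j a))\<^sup>2)"
    proof (intro sum.cong refl)
      fix j
      have "G u j j = (\<Sum>a<d. \<Sum>b<d. if a = b then cnj (\<xi> j a) * \<xi> j a else 0)"
        unfolding G_def by (intro sum.cong refl) (simp add: unit)
      also have "\<dots> = (\<Sum>a<d. cnj (\<xi> j a) * \<xi> j a)" by simp
      finally have "Re (G u j j) = (\<Sum>a<d. Re (cnj (\<xi> j a) * \<xi> j a))" by (simp only: Re_sum)
      also have "\<dots> = (\<Sum>a<d. (cmod (\<xi> j a))\<^sup>2)"
        by (intro sum.cong refl) (simp add: cmod_power2 power2_eq_square[of "Re _"] power2_eq_square[of "Im _"])
      finally show "Re (G u j j) = (\<Sum>a<d. (cmod (\<xi> j a))\<^sup>2)" .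
    qed
    finally show "\<epsilon> * (\<Sum>j<s. \<Sum>a<d. (cmod (\<xi> j a))\<^sup>2) \<le>
      Re (\<Sum>j<s. \<Sum>a<d. \<Sum>k<s. \<Sum>b<d. cnj (\<xi> j a) * \<psi> (witness c N \<delta> \<epsilon> u j k) a b * \<xi> k b)"
      using gap by linarith
  qed
  then have "0 \<le> (\<Sum>j<s. \<Sum>k<s. \<phi> (witness c N \<delta> \<epsilon> u j k) j k)"
    by (rule min_cone_functional[OF _ lin sym psd])
  also have "\<dots> = (\<Sum>i<5. \<Sum>p\<in>N i. \<Sum>j<s. \<Sum>k<s. p j * \<phi> (c i) j k * p k) - \<delta> * \<tau> + \<epsilon> * \<upsilon>"
    unfolding \<tau>_def \<upsilon>_def by (rule witness_eval[OF lin])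
  also have "(\<Sum>i<5. \<Sum>p\<in>N i. \<Sum>j<s. \<Sum>k<s. p j * \<phi> (c i) j k * p k) = 0"
    by (simp add: null)
  finally have "\<delta> * \<tau> \<le> \<epsilon> * \<upsilon>" by simp
  also have "\<dots> \<le> \<epsilon> * (\<bar>\<upsilon>\<bar> + 1)" using e by (intro mult_left_mono) auto
  also have "\<dots> = \<delta> * \<tau> / 2" by (simp add: \<epsilon>_def field_simps)
  finally show False using \<delta>(1) tr by (simp add: \<tau>_def)
qed

subsection \<open>A rigid pair of matrices\<close>

lemma sum_double: "(\<Sum>j<2 * n. f j) = (\<Sum>j<n. f j) + (\<Sum>j<n. f (n + j))" for f :: "nat \<Rightarrow> 'c::comm_monoid_add"
proof -
  have "(\<Sum>j<2 * n. f j) = (\<Sum>i<2. \<Sum>a<n. f (i * n + a))" by (rule sum_blocks)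
  then show ?thesis by (simp add: numeral_2_eq_2)
qed

definition mv :: "nat \<Rightarrow> (nat \<Rightarrow> nat \<Rightarrow> real) \<Rightarrow> (nat \<Rightarrow> real) \<Rightarrow> nat \<Rightarrow> real" where
  "mv n X x i = (\<Sum>j<n. X i j * x j)"

definition dot :: "nat \<Rightarrow> (nat \<Rightarrow> real) \<Rightarrow> (nat \<Rightarrow> real) \<Rightarrow> real" where
  "dot n x y = (\<Sum>j<n. x j * y j)"

lemma dot_commute: "dot n x y = dot n y x"
  by (simp add: dot_def mult.commute)

lemma dot_add_right: "dot n x (\<lambda>i. y i + z i) = dot n x y + dot n x z"
  by (simp add: dot_def distrib_left sum.distrib)

lemma dot_cong: "(\<And>i. i < n \<Longrightarrow> x i = x' i) \<Longrightarrow> (\<And>i. i < n \<Longrightarrow> y i = y' i) \<Longrightarrow> dot n x y = dot n x' y'"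
  by (simp add: dot_def)

lemma dot_mv: "dot n x (mv n X y) = (\<Sum>i<n. \<Sum>j<n. x i * X i j * y j)"
  by (simp add: dot_def mv_def sum_distrib_left mult.assoc)

lemma dot_mv_flip:
  assumes "\<And>i j. X i j = X j i"
  shows "dot n x (mv n X y) = dot n y (mv n X x)"
proof -
  have "dot n x (mv n X y) = (\<Sum>j<n. \<Sum>i<n. x i * X i j * y j)"
    unfolding dot_mv by (rule sum.swap)
  also have "\<dots> = dot n y (mv n X x)"
    unfolding dot_mv by (intro sum.cong refl) (subst assms, simp)
  finally show ?thesis .
qed

lemma mv_lin: "mv n X (\<lambda>i. r * x i - y i) i = r * mv n X x i - mv n X y i"
  by (simp add: mv_def right_diff_distrib sum_subtractf sum_distrib_left mult_ac)

text \<open>Young's inequality, from nonnegativity of the form at r x - w.\<close>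

lemma dot_mv_young:
  assumes sym: "\<And>i j. X i j = X j i" and psd: "\<And>x. 0 \<le> dot n x (mv n X x)" and r: "r > 0"
  shows "2 * dot n w (mv n X x) \<le> r * dot n x (mv n X x) + dot n w (mv n X w) / r"
proof -
  have "dot n (\<lambda>i. r * x i - w i) (mv n X (\<lambda>i. r * x i - w i))
      = r * r * dot n x (mv n X x) - r * dot n x (mv n X w) - r * dot n w (mv n X x) + dot n w (mv n X w)"
    unfolding mv_lin[abs_def]
    by (simp add: dot_def algebra_simps sum_subtractf sum.distrib sum_distrib_left)
  then have "0 \<le> r * r * dot n x (mv n X x) - 2 * r * dot n w (mv n X x) + dot n w (mv n X w)"
    using psd[of "\<lambda>i. r * x i - w i"] dot_mv_flip[OF sym, where x = x and y = w and n = n] by simp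
  moreover have "r * (r * dot n x (mv n X x) + dot n w (mv n X w) / r) = r * r * dot n x (mv n X x) + dot n w (mv n X w)"
    using r by (simp add: distrib_left)
  ultimately have "r * (2 * dot n w (mv n X x)) \<le> r * (r * dot n x (mv n X x) + dot n w (mv n X w) / r)"
    by (simp add: mult_ac)
  then show ?thesis using r by (simp only: mult_le_cancel_left_pos)
qed

lemma mv_inverse:
  assumes inv: "\<And>i j. i < n \<Longrightarrow> j < n \<Longrightarrow> (\<Sum>l<n. X i l * Y l j) = (if i = j then 1 else 0)" and "i < n"
  shows "mv n X (mv n Y x) i = x i"
proof -
  have "mv n X (mv n Y x) i = (\<Sum>l<n. \<Sum>j<n. X i l * Y l j * x j)"
    by (simp add: mv_def sum_distrib_left mult.assoc)
  also have "\<dots> = (\<Sum>j<n. \<Sum>l<n. X i l * Y l j * x j)" by (rule sum.swap)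
  also have "\<dots> = (\<Sum>j<n. (\<Sum>l<n. X i l * Y l j) * x j)" by (simp only: sum_distrib_right)
  also have "\<dots> = (\<Sum>j<n. if j = i then x j else 0)"
    using assms by (intro sum.cong refl) simp
  finally show ?thesis using \<open>i < n\<close> by simp
qed

text \<open>The real \<open>c\<close> is the constant b of the second relation. \<open>sumMN\<close>
  gives the matrix of the first outer ray a kernel of dimension n - 1; \<open>combMN\<close> with
  \<open>t 0 = 0\<close> gives that of the last ray a one-dimensional kernel. Distinct values of
  \<open>t\<close> and a nowhere zero \<open>v\<close> leave only scalars commuting with both
  gaps.\<close>

locale rigid_pair =
  fixes n :: nat and a c :: real and M N Mi Ni :: "nat \<Rightarrow> nat \<Rightarrow> real" and v t :: "nat \<Rightarrow> real"
  assumes n: "0 < n" and a: "0 < a" and c: "0 < c"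
    and sym: "M i j = M j i" "N i j = N j i" "Mi i j = Mi j i" "Ni i j = Ni j i"
    and invM: "i < n \<Longrightarrow> j < n \<Longrightarrow> (\<Sum>l<n. M i l * Mi l j) = (if i = j then 1 else 0)"
    and invN: "i < n \<Longrightarrow> j < n \<Longrightarrow> (\<Sum>l<n. N i l * Ni l j) = (if i = j then 1 else 0)"
    and psdM: "0 \<le> dot n x (mv n M x)" and psdN: "0 \<le> dot n x (mv n N x)"
    and sumMN: "i < n \<Longrightarrow> j < n \<Longrightarrow> M i j + N i j = (if i = j then 1 else 0) - v i * v j"
    and combMN: "i < n \<Longrightarrow> j < n \<Longrightarrow> M i j / a + N i j / c = (if i = j then 1 - t i else 0)"
    and t_inj: "inj_on t {..<n}" and t0: "t 0 = 0" and t_nonneg: "i < n \<Longrightarrow> 0 \<le> t i"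
    and v: "i < n \<Longrightarrow> v i \<noteq> 0"
begin

text \<open>
  The operator \<open>\<alpha> A + \<beta> B + \<gamma> D\<close>, where \<open>A = diag(M\<^sup>-\<^sup>1, 0)\<close>, \<open>D = diag(0, N\<^sup>-\<^sup>1)\<close> and all four
  blocks of \<open>B\<close> are the identity.
\<close>

definition blk :: "real \<Rightarrow> real \<Rightarrow> real \<Rightarrow> nat \<Rightarrow> nat \<Rightarrow> real" where
  "blk \<alpha> \<beta> \<gamma> j k = (if j < n \<and> k < n then \<alpha> * Mi j k else 0) + (if j mod n = k mod n then \<beta> else 0)
     + (if n \<le> j \<and> n \<le> k then \<gamma> * Ni (j - n) (k - n) else 0)"

lemma blk_form:
  "(\<Sum>j<2 * n. \<Sum>k<2 * n. y j * blk \<alpha> \<beta> \<gamma> j k * y k) =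
    \<alpha> * dot n y (mv n Mi y) + \<beta> * (\<Sum>j<n. (y j + y (n + j))\<^sup>2)
    + \<gamma> * dot n (\<lambda>j. y (n + j)) (mv n Ni (\<lambda>j. y (n + j)))"
proof -
  let ?z = "\<lambda>j. y (n + j)"
  have "(\<Sum>j<2 * n. \<Sum>k<2 * n. y j * blk \<alpha> \<beta> \<gamma> j k * y k) =
      (\<Sum>j<n. \<Sum>k<n. y j * blk \<alpha> \<beta> \<gamma> j k * y k) + (\<Sum>j<n. \<Sum>k<n. y j * blk \<alpha> \<beta> \<gamma> j (n + k) * ?z k)
      + ((\<Sum>j<n. \<Sum>k<n. ?z j * blk \<alpha> \<beta> \<gamma> (n + j) k * y k) + (\<Sum>j<n. \<Sum>k<n. ?z j * blk \<alpha> \<beta> \<gamma> (n + j) (n + k) * ?z k))"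
    by (simp add: sum_double sum.distrib)
  also have "(\<Sum>j<n. \<Sum>k<n. y j * blk \<alpha> \<beta> \<gamma> j k * y k)
      = (\<Sum>j<n. \<Sum>k<n. \<alpha> * (y j * Mi j k * y k) + (if j = k then \<beta> * (y j * y j) else 0))"
    by (intro sum.cong refl) (auto simp: blk_def algebra_simps)
  also have "\<dots> = \<alpha> * dot n y (mv n Mi y) + (\<Sum>j<n. \<beta> * (y j * y j))"
    by (simp add: sum.distrib dot_mv sum_distrib_left)
  also have "(\<Sum>j<n. \<Sum>k<n. ?z j * blk \<alpha> \<beta> \<gamma> (n + j) (n + k) * ?z k)
      = (\<Sum>j<n. \<Sum>k<n. \<gamma> * (?z j * Ni j k * ?z k) + (if j = k then \<beta> * (?z j * ?z j) else 0))"
    by (intro sum.cong refl) (auto simp: blk_def algebra_simps)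
  also have "\<dots> = \<gamma> * dot n ?z (mv n Ni ?z) + (\<Sum>j<n. \<beta> * (?z j * ?z j))"
    by (simp add: sum.distrib dot_mv sum_distrib_left)
  also have "(\<Sum>j<n. \<Sum>k<n. y j * blk \<alpha> \<beta> \<gamma> j (n + k) * ?z k)
      = (\<Sum>j<n. \<Sum>k<n. if j = k then \<beta> * (y j * ?z j) else 0)"
    by (intro sum.cong refl) (auto simp: blk_def)
  also have "\<dots> = (\<Sum>j<n. \<beta> * (y j * ?z j))" by simp
  also have "(\<Sum>j<n. \<Sum>k<n. ?z j * blk \<alpha> \<beta> \<gamma> (n + j) k * y k)
      = (\<Sum>j<n. \<Sum>k<n. if j = k then \<beta> * (y j * ?z j) else 0)"
    by (intro sum.cong refl) (auto simp: blk_def)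
  also have "\<dots> = (\<Sum>j<n. \<beta> * (y j * ?z j))" by simp
  finally show ?thesis
    by (simp add: power2_eq_square sum_distrib_left distrib_left distrib_right sum.distrib mult_ac)
qed

lemma blk_sym: "blk \<alpha> \<beta> \<gamma> j k = blk \<alpha> \<beta> \<gamma> k j"
  by (auto simp: blk_def sym)

lemma blk_add: "blk (\<alpha> + \<alpha>') (\<beta> + \<beta>') (\<gamma> + \<gamma>') j k = blk \<alpha> \<beta> \<gamma> j k + blk \<alpha>' \<beta>' \<gamma>' j k"
  by (simp add: blk_def distrib_right)

lemma blk_scale: "blk (r * \<alpha>) (r * \<beta>) (r * \<gamma>) j k = r * blk \<alpha> \<beta> \<gamma> j k"
  by (simp add: blk_def distrib_left mult_ac)

lemma mvM: "i < n \<Longrightarrow> mv n M (mv n Mi x) i = x i"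
  by (rule mv_inverse[OF invM])

lemma mvN: "i < n \<Longrightarrow> mv n N (mv n Ni x) i = x i"
  by (rule mv_inverse[OF invN])

text \<open>Substituting x = M (Mi x) turns the form of the inverse into that of \<open>M\<close>,
  so that \<open>psdM\<close> also yields positivity of \<open>Mi\<close>.\<close>

lemma dot_Mi: "dot n x (mv n Mi x) = dot n (mv n Mi x) (mv n M (mv n Mi x))"
  by (subst dot_commute) (rule dot_cong, simp_all add: mvM)

lemma dot_Ni: "dot n x (mv n Ni x) = dot n (mv n Ni x) (mv n N (mv n Ni x))"
  by (subst dot_commute) (rule dot_cong, simp_all add: mvN)

lemma blk_psd_nonneg:
  assumes "0 \<le> \<alpha>" "0 \<le> \<beta>" "0 \<le> \<gamma>"
  shows "0 \<le> (\<Sum>j<2 * n. \<Sum>k<2 * n. y j * blk \<alpha> \<beta> \<gamma> j k * y k)"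
  unfolding blk_form dot_Mi dot_Ni
  using assms by (intro add_nonneg_nonneg mult_nonneg_nonneg psdM psdN sum_nonneg) auto

text \<open>Schur complement: \<alpha> A + \<gamma> D dominates the matrix of four identity blocks
  once M/\<alpha> + N/\<gamma> <= 1. With the halves of y written as M x and N z, their sum w has
  |w|^2 = w.Mx + w.Nz, and Young's inequality with weights \<alpha> and \<gamma> bounds the two
  terms.\<close>

lemma blk_psd_minus:
  assumes \<alpha>: "0 < \<alpha>" and \<gamma>: "0 < \<gamma>"
    and dom: "\<And>w. dot n w (mv n M w) / \<alpha> + dot n w (mv n N w) / \<gamma> \<le> dot n w w"
  shows "0 \<le> (\<Sum>j<2 * n. \<Sum>k<2 * n. y j * blk \<alpha> (- 1) \<gamma> j k * y k)"
proof -
  define x where "x = mv n Mi y"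
  define z where "z = mv n Ni (\<lambda>j. y (n + j))"
  define w where "w j = y j + y (n + j)" for j
  have "dot n w w = dot n w (\<lambda>j. mv n M x j + mv n N z j)"
    by (rule dot_cong) (simp_all add: w_def x_def z_def mvM mvN)
  then have "2 * dot n w w = 2 * dot n w (mv n M x) + 2 * dot n w (mv n N z)"
    by (simp add: dot_add_right)
  also have "\<dots> \<le> (\<alpha> * dot n x (mv n M x) + dot n w (mv n M w) / \<alpha>)
      + (\<gamma> * dot n z (mv n N z) + dot n w (mv n N w) / \<gamma>)"
    by (intro add_mono dot_mv_young sym psdM psdN \<alpha> \<gamma>)
  also have "\<dots> \<le> \<alpha> * dot n x (mv n M x) + \<gamma> * dot n z (mv n N z) + dot n w w"
    using dom[of w] by simp
  finally have "dot n w w \<le> \<alpha> * dot n x (mv n M x) + \<gamma> * dot n z (mv n N z)" by simp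
  moreover have "dot n w w = (\<Sum>j<n. (y j + y (n + j))\<^sup>2)"
    by (simp add: dot_def w_def power2_eq_square)
  ultimately show ?thesis
    unfolding blk_form dot_Mi dot_Ni x_def z_def by simp
qed

text \<open>The slack is the square of \<open>dot n w v\<close>. This is the hypothesis of
  \<open>blk_psd_minus\<close> for the outer ray (1, -1, 1).\<close>

lemma dom_one: "dot n w (mv n M w) / 1 + dot n w (mv n N w) / 1 \<le> dot n w w"
proof -
  have "dot n w (mv n M w) + dot n w (mv n N w) = (\<Sum>i<n. \<Sum>j<n. w i * (M i j + N i j) * w j)"
    by (simp add: dot_mv sum.distrib distrib_left distrib_right)
  also have "\<dots> = (\<Sum>i<n. \<Sum>j<n. (if i = j then w i * w i else 0) - (w i * v i) * (w j * v j))"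
    by (intro sum.cong refl) (auto simp: sumMN algebra_simps)
  also have "\<dots> = dot n w w - dot n w v * dot n w v"
    by (simp add: sum_subtractf dot_def sum_product)
  finally show ?thesis by simp
qed

text \<open>The slack is the form of diag t; this serves the outer ray (a, -1, c).\<close>

lemma dom_ac: "dot n w (mv n M w) / a + dot n w (mv n N w) / c \<le> dot n w w"
proof -
  have "dot n w (mv n M w) / a + dot n w (mv n N w) / c = (\<Sum>i<n. \<Sum>j<n. w i * (M i j / a + N i j / c) * w j)"
    by (simp add: dot_mv sum.distrib distrib_left distrib_right sum_divide_distrib)
  also have "\<dots> = (\<Sum>i<n. \<Sum>j<n. if i = j then (1 - t i) * (w i * w i) else 0)"
    by (intro sum.cong refl) (auto simp: combMN)
  also have "\<dots> = (\<Sum>i<n. (1 - t i) * (w i * w i))" by simp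
  also have "\<dots> \<le> (\<Sum>i<n. w i * w i)"
  proof (intro sum_mono)
    fix i assume "i \<in> {..<n}"
    then have "0 \<le> t i * (w i * w i)" using t_nonneg by simp
    then show "(1 - t i) * (w i * w i) \<le> w i * w i" by (simp add: left_diff_distrib)
  qed
  finally show ?thesis by (simp add: dot_def)
qed

section \<open>Explicit null vectors of the five matrices\<close>

definition ev :: "nat \<Rightarrow> nat \<Rightarrow> real" where "ev m j = (if j = m then 1 else 0)"

text \<open>Orthogonal to \<open>v\<close>, hence fixed by M + N. For 0 < m < n these vectors span
  the orthogonal complement of \<open>v\<close>; for m = 0 the vector is 0.\<close>

definition kv :: "nat \<Rightarrow> nat \<Rightarrow> real" where "kv m j = v 0 * ev m j - v m * ev 0 j"

definition join :: "(nat \<Rightarrow> real) \<Rightarrow> (nat \<Rightarrow> real) \<Rightarrow> nat \<Rightarrow> real" where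
  "join x y j = (if j < n then x j else y (j - n))"

text \<open>For i = 0 the pair (x, y) is null when Mi x = x + y = Ni y; with k = x + y this says x =
  M k, y = N k and (M + N) k = k. For i = 4 it is null when a Mi x = x + y = c Ni y, so x = M k / a,
  y = N k / c with k in the kernel of diag t.\<close>

definition nullv :: "nat \<Rightarrow> (nat \<Rightarrow> real) set" where
  "nullv i = (if i = 0 then (\<lambda>m. join (mv n M (kv m)) (mv n N (kv m))) ` {..<n}
    else if i = 1 then (\<lambda>m. join (\<lambda>_. 0) (ev m)) ` {..<n}
    else if i = 2 then (\<lambda>m. join (ev m) (\<lambda>j. - ev m j)) ` {..<n}
    else if i = 3 then (\<lambda>m. join (ev m) (\<lambda>_. 0)) ` {..<n}
    else {join (\<lambda>j. mv n M (ev 0) j / a) (\<lambda>j. mv n N (ev 0) j / c)})"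

lemma finite_nullv: "finite (nullv i)"
  by (simp add: nullv_def)

lemma mv_ev: "m < n \<Longrightarrow> mv n X (ev m) i = X i m"
  by (simp add: mv_def ev_def if_distrib[of "\<lambda>x. _ * x"] cong: if_cong)

lemma mv_kv: "m < n \<Longrightarrow> mv n X (kv m) i = v 0 * X i m - v m * X i 0"
proof -
  assume "m < n"
  have "mv n X (kv m) i = v 0 * mv n X (ev m) i - v m * mv n X (ev 0) i"
    by (simp add: mv_def kv_def right_diff_distrib sum_subtractf sum_distrib_left mult_ac)
  then show ?thesis using \<open>m < n\<close> n by (simp add: mv_ev)
qed

lemma kv_fixed:
  assumes "m < n" "j < n"
  shows "mv n M (kv m) j + mv n N (kv m) j = kv m j"
proof -
  have "mv n M (kv m) j + mv n N (kv m) j = v 0 * (M j m + N j m) - v m * (M j 0 + N j 0)"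
    using assms by (simp add: mv_kv algebra_simps)
  also have "\<dots> = kv m j"
    using assms n by (simp add: sumMN kv_def ev_def algebra_simps)
  finally show ?thesis .
qed

lemma ev0_fixed: "j < n \<Longrightarrow> mv n M (ev 0) j / a + mv n N (ev 0) j / c = ev 0 j"
  using combMN[of j 0] n by (auto simp: mv_ev ev_def t0)

lemma MiM: "i < n \<Longrightarrow> mv n Mi (mv n M x) i = x i"
proof (rule mv_inverse)
  show "(\<Sum>l<n. Mi i l * M l j) = (if i = j then 1 else 0)" if "i < n" "j < n" for i j
  proof -
    have "(\<Sum>l<n. Mi i l * M l j) = (\<Sum>l<n. M j l * Mi l i)"
      by (intro sum.cong refl) (simp add: sym(1)[of j] sym(3)[of i] mult.commute)
    then show ?thesis using invM[OF that(2,1)] by auto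
  qed
qed

lemma NiN: "i < n \<Longrightarrow> mv n Ni (mv n N x) i = x i"
proof (rule mv_inverse)
  show "(\<Sum>l<n. Ni i l * N l j) = (if i = j then 1 else 0)" if "i < n" "j < n" for i j
  proof -
    have "(\<Sum>l<n. Ni i l * N l j) = (\<Sum>l<n. N j l * Ni l i)"
      by (intro sum.cong refl) (simp add: sym(2)[of j] sym(4)[of i] mult.commute)
    then show ?thesis using invN[OF that(2,1)] by auto
  qed
qed

text \<open>Coordinates of the five rays with respect to the three middle ones.\<close>

definition coef :: "nat \<Rightarrow> real \<times> real \<times> real" where
  "coef i = (if i = 0 then (1, - 1, 1) else if i = 1 then (1, 0, 0) else if i = 2 then (0, 1, 0)
     else if i = 3 then (0, 0, 1) else (a, - 1, c))"

definition blkc :: "nat \<Rightarrow> nat \<Rightarrow> nat \<Rightarrow> real" where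
  "blkc i j k = (case coef i of (\<alpha>, \<beta>, \<gamma>) \<Rightarrow> blk \<alpha> \<beta> \<gamma> j k)"

lemma join_form:
  "(\<Sum>j<2 * n. \<Sum>k<2 * n. join x y j * blk \<alpha> \<beta> \<gamma> j k * join x y k) =
    \<alpha> * dot n x (mv n Mi x) + \<beta> * (\<Sum>j<n. (x j + y j)\<^sup>2) + \<gamma> * dot n y (mv n Ni y)"
proof -
  have "mv n Mi (join x y) = mv n Mi x"
    by (rule ext) (simp add: mv_def join_def)
  then have "dot n (join x y) (mv n Mi (join x y)) = dot n x (mv n Mi x)"
    by (intro dot_cong) (simp_all add: join_def)
  moreover have "(\<lambda>j. join x y (n + j)) = y" by (rule ext) (simp add: join_def)
  moreover have "(\<Sum>j<n. (join x y j + join x y (n + j))\<^sup>2) = (\<Sum>j<n. (x j + y j)\<^sup>2)"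
    by (intro sum.cong refl) (simp add: join_def)
  ultimately show ?thesis by (simp add: blk_form)
qed

lemma mv_divide: "mv n X (\<lambda>j. x j / r) i = mv n X x i / r"
  by (simp add: mv_def sum_divide_distrib)

lemma nullv_null:
  assumes i: "i < 5" and p: "p \<in> nullv i"
  shows "(\<Sum>j<2 * n. \<Sum>k<2 * n. p j * blkc i j k * p k) = 0"
proof -
  consider "i = 0" | "i = 1" | "i = 2" | "i = 3" | "i = 4" using i by linarith
  then show ?thesis
  proof cases
    case 1
    then obtain m where m: "m < n" "p = join (mv n M (kv m)) (mv n N (kv m))"
      using p by (auto simp: nullv_def)
    let ?k = "kv m"
    have "dot n (mv n M ?k) (mv n Mi (mv n M ?k)) = dot n (mv n M ?k) ?k"
      "dot n (mv n N ?k) (mv n Ni (mv n N ?k)) = dot n (mv n N ?k) ?k"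
      by (intro dot_cong; simp add: MiM NiN)+
    moreover have "(\<Sum>j<n. (mv n M ?k j + mv n N ?k j)\<^sup>2) = dot n ?k ?k"
      unfolding dot_def by (intro sum.cong refl) (simp add: kv_fixed m power2_eq_square)
    moreover have "dot n (mv n M ?k) ?k + dot n (mv n N ?k) ?k = dot n ?k ?k"
    proof -
      have "dot n (mv n M ?k) ?k + dot n (mv n N ?k) ?k = dot n ?k (\<lambda>j. mv n M ?k j + mv n N ?k j)"
        by (simp only: dot_add_right dot_commute[of n ?k])
      also have "\<dots> = dot n ?k ?k" by (rule dot_cong) (simp_all add: kv_fixed m)
      finally show ?thesis .
    qed
    ultimately show ?thesis by (simp add: 1 m(2) blkc_def coef_def join_form)
  next
    case 2
    then show ?thesis using p by (auto simp: nullv_def blkc_def coef_def join_form dot_def)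
  next
    case 3
    then show ?thesis using p by (auto simp: nullv_def blkc_def coef_def join_form)
  next
    case 4
    then show ?thesis using p by (auto simp: nullv_def blkc_def coef_def join_form dot_def)
  next
    case 5
    define x where "x j = mv n M (ev 0) j / a" for j
    define y where "y j = mv n N (ev 0) j / c" for j
    have p': "p = join x y" using p 5 by (simp add: nullv_def x_def[abs_def] y_def[abs_def])
    have xy: "x j + y j = ev 0 j" if "j < n" for j using ev0_fixed[OF that] by (simp add: x_def y_def)
    have "a * dot n x (mv n Mi x) = a * dot n x (\<lambda>j. ev 0 j / a)"
      unfolding x_def[abs_def] by (intro arg_cong[where f = "\<lambda>y. a * y"] dot_cong) (simp_all add: mv_divide MiM)
    also have "\<dots> = dot n x (ev 0)" using a by (simp add: dot_def sum_distrib_left)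
    finally have 1: "a * dot n x (mv n Mi x) = dot n x (ev 0)" .
    have "c * dot n y (mv n Ni y) = c * dot n y (\<lambda>j. ev 0 j / c)"
      unfolding y_def[abs_def] by (intro arg_cong[where f = "\<lambda>y. c * y"] dot_cong) (simp_all add: mv_divide NiN)
    also have "\<dots> = dot n y (ev 0)" using c by (simp add: dot_def sum_distrib_left)
    finally have 2: "c * dot n y (mv n Ni y) = dot n y (ev 0)" .
    have "dot n x (ev 0) + dot n y (ev 0) = dot n (ev 0) (\<lambda>j. x j + y j)"
      by (simp only: dot_add_right dot_commute[of n "ev 0"])
    also have "\<dots> = dot n (ev 0) (ev 0)" by (rule dot_cong) (simp_all add: xy)
    finally have 3: "dot n x (ev 0) + dot n y (ev 0) = dot n (ev 0) (ev 0)" .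
    have 4: "(\<Sum>j<n. (x j + y j)\<^sup>2) = dot n (ev 0) (ev 0)"
      unfolding dot_def by (intro sum.cong refl) (simp add: xy power2_eq_square)
    show ?thesis using 1 2 3 4 by (simp add: 5 p' blkc_def coef_def join_form)
  qed
qed

lemma blk_diag_nonneg:
  assumes "\<And>y. 0 \<le> (\<Sum>j<2 * n. \<Sum>k<2 * n. y j * blk \<alpha> \<beta> \<gamma> j k * y k)" "m < 2 * n"
  shows "0 \<le> blk \<alpha> \<beta> \<gamma> m m"
proof -
  have "(\<Sum>j<2 * n. \<Sum>k<2 * n. ev m j * blk \<alpha> \<beta> \<gamma> j k * ev m k)
      = (\<Sum>j<2 * n. \<Sum>k<2 * n. if k = m then (if j = m then blk \<alpha> \<beta> \<gamma> j k else 0) else 0)"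
    by (intro sum.cong refl) (simp add: ev_def)
  also have "\<dots> = (\<Sum>j<2 * n. if j = m then blk \<alpha> \<beta> \<gamma> j m else 0)"
    using assms(2) by simp
  also have "\<dots> = blk \<alpha> \<beta> \<gamma> m m" using assms(2) by simp
  finally show ?thesis using assms(1)[of "ev m"] by simp
qed

lemma blkc_psd: "0 \<le> (\<Sum>j<2 * n. \<Sum>k<2 * n. y j * blkc i j k * y k)"
  using blk_psd_nonneg blk_psd_minus[OF _ _ dom_one] blk_psd_minus[OF a c dom_ac]
  by (simp add: blkc_def coef_def)

lemma blkc_trace: "0 < (\<Sum>i<5. \<Sum>j<2 * n. blkc i j j)"
proof -
  have nn: "0 \<le> blkc i j j" if "j < 2 * n" for i j
    using blk_diag_nonneg[OF _ that] blkc_psd[of _ i] by (cases "coef i") (auto simp: blkc_def)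
  have "(\<Sum>j<2 * n. blkc 2 j j) = (\<Sum>j<2 * n. 1)"
    by (intro sum.cong refl) (simp add: blkc_def coef_def blk_def)
  then have "0 < (\<Sum>j<2 * n. blkc 2 j j)" using n by simp
  also have "\<dots> \<le> (\<Sum>i<5. \<Sum>j<2 * n. blkc i j j)"
    using nn by (intro member_le_sum[of 2 "{..<5}" "\<lambda>i. \<Sum>j<2 * n. blkc i j j"] sum_nonneg) auto
  finally show ?thesis .
qed

text \<open>Vanishing on the null vectors of the three middle rays leaves three n x n blocks,
  \<open>A\<close>, \<open>D\<close> and a single \<open>Z\<close>. The outer rays give A M = Z = D
  N, and as Z is Hermitian it commutes with M and N. The diagonal gap makes Z diagonal, the rank-one
  gap makes it scalar, and the common null vector makes the scalar 0.\<close>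

lemma rigid:
  assumes adm: "admissible (2 * n) a c B w" and w: "\<exists>k<2 * n. w k \<noteq> 0" and def: "defect (2 * n) nullv B = 0"
  shows "ctrace (2 * n) B = 0"
proof -
  note One_nat_def [simp del]
  have psd: "psd_form (2 * n) (B i)" if "i < 5" for i using adm that by (simp add: admissible_def)
  have herm: "cnj (B i j k) = B i k j" if "i < 5" "j < 2 * n" "k < 2 * n" for i j k
    using psd[OF that(1)] that(2,3) by (simp add: psd_form_def)
  have B0: "B 0 j k = B 1 j k - B 2 j k + B 3 j k" 
    and B4: "B 4 j k = of_real a * B 1 j k - B 2 j k + of_real c * B 3 j k"
    if "j < 2 * n" "k < 2 * n" for j k using adm that by (simp_all add: admissible_def)
  have wnull: "(\<Sum>k<2 * n. B i j k * w k) = 0" if "i < 5" "j < 2 * n" for i j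
    using adm that by (simp add: admissible_def)
  have row: "(\<Sum>k<2 * n. B i j k * of_real (p k)) = 0" if i: "i < 5" and p: "p \<in> nullv i" and j: "j < 2 * n" for i j p
  proof -
    let ?q = "\<lambda>i p. Re (qform (2 * n) (B i) (\<lambda>j. of_real (p j)) (\<lambda>j. of_real (p j)))"
    have nn: "0 \<le> ?q i p" if "i < 5" for i and p :: "nat \<Rightarrow> real" using psd[OF that] by (simp add: psd_form_def)
    have "(\<Sum>i<5. \<Sum>p\<in>nullv i. ?q i p) = 0" using def by (simp add: defect_def)
    then have "(\<Sum>p\<in>nullv i. ?q i p) = 0"
      using i nn by (subst (asm) sum_nonneg_eq_0_iff) (auto intro: sum_nonneg)
    then have "?q i p = 0"
      using p nn[OF i] finite_nullv by (subst (asm) sum_nonneg_eq_0_iff) auto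
    \<comment> \<open>A null vector of a positive semidefinite form lies in its kernel; unit vectors
      read off the rows.\<close>
    then have "qform (2 * n) (B i) (\<lambda>l. if l = j then 1 else 0) (\<lambda>j. of_real (p j)) = 0"
      by (rule psd_form_null[OF psd[OF i]])
    moreover have "qform (2 * n) (B i) (\<lambda>l. if l = j then 1 else 0) (\<lambda>j. of_real (p j))
        = (\<Sum>l<2 * n. if l = j then (\<Sum>k<2 * n. B i l k * of_real (p k)) else 0)"
      unfolding qform_def by (intro sum.cong refl) simp
    ultimately show ?thesis using j by simp
  qed
  have row2: "(\<Sum>k<n. B i j k * of_real (x k)) + (\<Sum>k<n. B i j (n + k) * of_real (y k)) = 0"
    if "i < 5" "join x y \<in> nullv i" "j < 2 * n" for i j x y
    using row[OF that] by (simp add: sum_double join_def)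
  have ev_sum: "(\<Sum>k<n. f k * of_real (ev m k)) = f m" if "m < n" for f :: "nat \<Rightarrow> complex" and m
  proof -
    have "(\<Sum>k<n. f k * of_real (ev m k)) = (\<Sum>k<n. if k = m then f k else 0)"
      by (intro sum.cong refl) (simp add: ev_def)
    then show ?thesis using that by simp
  qed
  have B1z: "B 1 j (n + m) = 0" if "m < n" "j < 2 * n" for j m
    using row2[of 1 "\<lambda>_. 0" "ev m" j] that by (simp add: nullv_def ev_sum)
  have B3z: "B 3 j m = 0" if "m < n" "j < 2 * n" for j m
    using row2[of 3 "ev m" "\<lambda>_. 0" j] that by (simp add: nullv_def ev_sum)
  have B2e: "B 2 j (n + m) = B 2 j m" if "m < n" "j < 2 * n" for j m
    using row2[of 2 "ev m" "\<lambda>j. - ev m j" j] that by (simp add: nullv_def ev_sum sum_negf)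
  have B1z': "B 1 (n + m) j = 0" if "m < n" "j < 2 * n" for j m
    using herm[of 1 j "n + m"] B1z[OF that] that by simp
  have B3z': "B 3 m j = 0" if "m < n" "j < 2 * n" for j m
    using herm[of 3 j m] B3z[OF that] that by simp
  have B2e': "B 2 (n + m) j = B 2 m j" if "m < n" "j < 2 * n" for j m
    using herm[of 2 j "n + m"] herm[of 2 j m] B2e[OF that] that by simp
  define A where "A j k = B 1 j k" for j k
  define Z where "Z j k = B 2 j k" for j k
  define D where "D j k = B 3 (n + j) (n + k)" for j k
  have hA: "cnj (A j k) = A k j" and hZ: "cnj (Z j k) = Z k j" and hD: "cnj (D j k) = D k j"
    if "j < n" "k < n" for j k
    using that by (simp_all add: A_def Z_def D_def herm)
  have ZL: "B 2 j k = Z j k" "B 2 j (n + k) = Z j k" "B 2 (n + j) k = Z j k" "B 2 (n + j) (n + k) = Z j k"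
    if "j < n" "k < n" for j k
    using that by (simp_all add: Z_def B2e B2e')
  \<comment> \<open>Upper and lower half of the kernel equation of \<open>B 0\<close> at (x, y): A x
    = Z (x + y) = D y.\<close>
  have kvA: "(\<Sum>k<n. A j k * of_real (x k)) = (\<Sum>k<n. Z j k * of_real (x k + y k))"
    and kvD: "(\<Sum>k<n. D j k * of_real (y k)) = (\<Sum>k<n. Z j k * of_real (x k + y k))"
    if "join x y \<in> nullv 0" "j < n" for x y j
  proof -
    have "(\<Sum>k<n. B 0 j k * of_real (x k)) + (\<Sum>k<n. B 0 j (n + k) * of_real (y k))
        = (\<Sum>k<n. (A j k - Z j k) * of_real (x k)) + (\<Sum>k<n. (- Z j k) * of_real (y k))"
      using that by (intro arg_cong2[where f = "(+)"] sum.cong refl)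
        (simp_all add: B0 ZL B3z B3z' B1z A_def)
    then show "(\<Sum>k<n. A j k * of_real (x k)) = (\<Sum>k<n. Z j k * of_real (x k + y k))"
      using row2[of 0 x y j] that by (simp add: algebra_simps sum_subtractf sum.distrib sum_negf)
    have "(\<Sum>k<n. B 0 (n + j) k * of_real (x k)) + (\<Sum>k<n. B 0 (n + j) (n + k) * of_real (y k))
        = (\<Sum>k<n. (- Z j k) * of_real (x k)) + (\<Sum>k<n. (D j k - Z j k) * of_real (y k))"
      using that by (intro arg_cong2[where f = "(+)"] sum.cong refl)
        (simp_all add: B0 ZL B3z B1z' D_def)
    then show "(\<Sum>k<n. D j k * of_real (y k)) = (\<Sum>k<n. Z j k * of_real (x k + y k))"
      using row2[of 0 x y "n + j"] that by (simp add: algebra_simps sum_subtractf sum.distrib sum_negf)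
  qed
  have e0A: "(\<Sum>k<n. A j k * of_real (a * x k)) = (\<Sum>k<n. Z j k * of_real (x k + y k))"
    and e0D: "(\<Sum>k<n. D j k * of_real (c * y k)) = (\<Sum>k<n. Z j k * of_real (x k + y k))"
    if "join x y \<in> nullv 4" "j < n" for x y j
  proof -
    have "(\<Sum>k<n. B 4 j k * of_real (x k)) + (\<Sum>k<n. B 4 j (n + k) * of_real (y k))
        = (\<Sum>k<n. A j k * of_real (a * x k) - Z j k * of_real (x k)) + (\<Sum>k<n. (- Z j k) * of_real (y k))"
      using that by (intro arg_cong2[where f = "(+)"] sum.cong refl)
        (simp_all add: B4 ZL B3z B3z' B1z A_def left_diff_distrib right_diff_distrib distrib_right distrib_left mult_ac)
    then show "(\<Sum>k<n. A j k * of_real (a * x k)) = (\<Sum>k<n. Z j k * of_real (x k + y k))"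
      using row2[of 4 x y j] that by (simp add: algebra_simps sum_subtractf sum.distrib sum_negf)
    have "(\<Sum>k<n. B 4 (n + j) k * of_real (x k)) + (\<Sum>k<n. B 4 (n + j) (n + k) * of_real (y k))
        = (\<Sum>k<n. (- Z j k) * of_real (x k)) + (\<Sum>k<n. D j k * of_real (c * y k) - Z j k * of_real (y k))"
      using that by (intro arg_cong2[where f = "(+)"] sum.cong refl)
        (simp_all add: B4 ZL B3z B1z' D_def left_diff_distrib right_diff_distrib distrib_right distrib_left mult_ac)
    then show "(\<Sum>k<n. D j k * of_real (c * y k)) = (\<Sum>k<n. Z j k * of_real (x k + y k))"
      using row2[of 4 x y "n + j"] that by (simp add: algebra_simps sum_subtractf sum.distrib sum_negf)
  qed
  \<comment> \<open>The kernel vector of \<open>B 4\<close> has x + y = e_0, which gives column 0 of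
    A M = Z = D N.\<close>
  have col0: "(\<Sum>k<n. A j k * of_real (M k 0)) = Z j 0" "(\<Sum>k<n. D j k * of_real (N k 0)) = Z j 0" if "j < n" for j
  proof -
    let ?x = "\<lambda>j. mv n M (ev 0) j / a" and ?y = "\<lambda>j. mv n N (ev 0) j / c"
    have "join ?x ?y \<in> nullv 4" by (simp add: nullv_def)
    note e = e0A[OF this that] e0D[OF this that]
    have r: "(\<Sum>k<n. Z j k * of_real (?x k + ?y k)) = Z j 0"
    proof -
      have "(\<Sum>k<n. Z j k * of_real (?x k + ?y k)) = (\<Sum>k<n. Z j k * of_real (ev 0 k))"
        by (intro sum.cong refl) (simp only: ev0_fixed lessThan_iff)
      then show ?thesis using n by (simp add: ev_sum)
    qed
    have "(\<Sum>k<n. A j k * of_real (M k 0)) = (\<Sum>k<n. A j k * of_real (a * ?x k))"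
      "(\<Sum>k<n. D j k * of_real (N k 0)) = (\<Sum>k<n. D j k * of_real (c * ?y k))"
      using a c n by (intro sum.cong refl; simp add: mv_ev)+
    then show "(\<Sum>k<n. A j k * of_real (M k 0)) = Z j 0" "(\<Sum>k<n. D j k * of_real (N k 0)) = Z j 0"
      using e r by simp_all
  qed
  \<comment> \<open>The vectors \<open>kv m\<close> give v_0 times column m minus v_m times column
    0. Column 0 is known and v_0 is not zero, so all columns follow.\<close>
  have col: "(\<Sum>k<n. A j k * of_real (M k m)) = Z j m" "(\<Sum>k<n. D j k * of_real (N k m)) = Z j m"
    if j: "j < n" and m: "m < n" for j m
  proof -
    have mem: "join (mv n M (kv m)) (mv n N (kv m)) \<in> nullv 0" using m by (auto simp: nullv_def)
    have "(\<Sum>k<n. Z j k * of_real (mv n M (kv m) k + mv n N (kv m) k))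
        = (\<Sum>k<n. of_real (v 0) * (Z j k * of_real (ev m k)) - of_real (v m) * (Z j k * of_real (ev 0 k)))"
      using m by (intro sum.cong refl) (simp add: kv_fixed kv_def algebra_simps flip: of_real_add)
    also have "\<dots> = of_real (v 0) * Z j m - of_real (v m) * Z j 0"
      using m n by (simp only: sum_subtractf sum_distrib_left[symmetric] ev_sum)
    finally have r: "(\<Sum>k<n. Z j k * of_real (mv n M (kv m) k + mv n N (kv m) k))
        = of_real (v 0) * Z j m - of_real (v m) * Z j 0" .
    have l: "(\<Sum>k<n. Y j k * of_real (mv n X (kv m) k)) =
        of_real (v 0) * (\<Sum>k<n. Y j k * of_real (X k m)) - of_real (v m) * (\<Sum>k<n. Y j k * of_real (X k 0))"
      for Y :: "nat \<Rightarrow> nat \<Rightarrow> complex" and X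
      using m by (simp add: mv_kv sum_distrib_left sum_subtractf[symmetric] algebra_simps)
    have "complex_of_real (v 0) \<noteq> 0" using v n by simp
    moreover note kvA[OF mem j, unfolded r l col0(1)[OF j]] kvD[OF mem j, unfolded r l col0(2)[OF j]]
    ultimately show "(\<Sum>k<n. A j k * of_real (M k m)) = Z j m" "(\<Sum>k<n. D j k * of_real (N k m)) = Z j m"
      by simp_all
  qed
  text \<open>Both \<open>Z = A M\<close> and \<open>Z = M A\<close>, as \<open>Z\<close> is Hermitian.\<close>
  have col': "(\<Sum>k<n. of_real (M j k) * A k m) = Z j m" "(\<Sum>k<n. of_real (N j k) * D k m) = Z j m"
    if j: "j < n" and m: "m < n" for j m
  proof -
    have "cnj (Z m j) = (\<Sum>k<n. of_real (M j k) * A k m)"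
      unfolding col(1)[OF m j, symmetric] cnj_sum
      using m by (intro sum.cong refl) (simp add: hA sym(1)[of j] mult.commute)
    then show "(\<Sum>k<n. of_real (M j k) * A k m) = Z j m" using hZ[OF m j] by simp
    have "cnj (Z m j) = (\<Sum>k<n. of_real (N j k) * D k m)"
      unfolding col(2)[OF m j, symmetric] cnj_sum
      using m by (intro sum.cong refl) (simp add: hD sym(2)[of j] mult.commute)
    then show "(\<Sum>k<n. of_real (N j k) * D k m) = Z j m" using hZ[OF m j] by simp
  qed
  \<comment> \<open>M Z = M A M = Z M.\<close>
  have commM: "(\<Sum>k<n. of_real (M i k) * Z k j) = (\<Sum>k<n. Z i k * of_real (M k j))" if "i < n" "j < n" for i j
  proof -
    have "(\<Sum>k<n. of_real (M i k) * Z k j) = (\<Sum>k<n. \<Sum>l<n. of_real (M i k) * A k l * of_real (M l j))"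
      using that by (intro sum.cong refl) (simp add: col(1)[symmetric] sum_distrib_left mult.assoc)
    also have "\<dots> = (\<Sum>l<n. \<Sum>k<n. of_real (M i k) * A k l * of_real (M l j))" by (rule sum.swap)
    also have "\<dots> = (\<Sum>l<n. Z i l * of_real (M l j))"
      using that by (intro sum.cong refl) (simp add: col'(1)[symmetric] sum_distrib_right)
    finally show ?thesis .
  qed
  have commN: "(\<Sum>k<n. of_real (N i k) * Z k j) = (\<Sum>k<n. Z i k * of_real (N k j))" if "i < n" "j < n" for i j
  proof -
    have "(\<Sum>k<n. of_real (N i k) * Z k j) = (\<Sum>k<n. \<Sum>l<n. of_real (N i k) * D k l * of_real (N l j))"
      using that by (intro sum.cong refl) (simp add: col(2)[symmetric] sum_distrib_left mult.assoc)
    also have "\<dots> = (\<Sum>l<n. \<Sum>k<n. of_real (N i k) * D k l * of_real (N l j))" by (rule sum.swap)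
    also have "\<dots> = (\<Sum>l<n. Z i l * of_real (N l j))"
      using that by (intro sum.cong refl) (simp add: col'(2)[symmetric] sum_distrib_right)
    finally show ?thesis .
  qed
  have comm: "(\<Sum>k<n. of_real (r * M i k + q * N i k) * Z k j) = (\<Sum>k<n. Z i k * of_real (r * M k j + q * N k j))"
    if "i < n" "j < n" for i j r q
  proof -
    have "(\<Sum>k<n. of_real (r * M i k + q * N i k) * Z k j)
        = of_real r * (\<Sum>k<n. of_real (M i k) * Z k j) + of_real q * (\<Sum>k<n. of_real (N i k) * Z k j)"
      by (simp add: sum_distrib_left sum.distrib algebra_simps)
    also have "\<dots> = (\<Sum>k<n. Z i k * of_real (r * M k j + q * N k j))"
      unfolding commM[OF that] commN[OF that] by (simp add: sum_distrib_left sum.distrib algebra_simps)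
    finally show ?thesis .
  qed
  \<comment> \<open>Commuting with 1 - diag t multiplies the entry by t i - t j, which is not zero
    off the diagonal.\<close>
  have Zdiag: "Z i j = 0" if "i < n" "j < n" "i \<noteq> j" for i j
  proof -
    have "(\<Sum>k<n. of_real (1 / a * M i k + 1 / c * N i k) * Z k j)
        = (\<Sum>k<n. if k = i then of_real (1 - t i) * Z k j else 0)"
      using that combMN[OF that(1)] by (intro sum.cong refl) simp
    moreover have "(\<Sum>k<n. Z i k * of_real (1 / a * M k j + 1 / c * N k j))
        = (\<Sum>k<n. if k = j then Z i k * of_real (1 - t j) else 0)"
      using that combMN[OF _ that(2)] by (intro sum.cong refl) simp
    ultimately have "of_real (1 - t i) * Z i j = Z i j * of_real (1 - t j)"
      using comm[OF that(1,2), of "1 / a" "1 / c"] that by simp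
    then have "of_real (t i - t j) * Z i j = 0" by (auto simp: algebra_simps)
    moreover have "t i \<noteq> t j" using t_inj that by (auto simp: inj_on_def)
    ultimately show ?thesis by simp
  qed
  have Zsum: "(\<Sum>k<n. f k * Z k j) = f j * Z j j" "(\<Sum>k<n. Z j k * f k) = Z j j * f j" if "j < n" for f j
  proof -
    have "(\<Sum>k<n. f k * Z k j) = (\<Sum>k<n. if k = j then f k * Z k j else 0)"
      "(\<Sum>k<n. Z j k * f k) = (\<Sum>k<n. if k = j then Z j k * f k else 0)"
      using that by (intro sum.cong refl; auto simp: Zdiag)+
    then show "(\<Sum>k<n. f k * Z k j) = f j * Z j j" "(\<Sum>k<n. Z j k * f k) = Z j j * f j"
      using that by simp_all
  qed
  \<comment> \<open>Entry (i, 0) of the commutation with M + N, whose own entry there, - v_i v_0,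
    does not vanish.\<close>
  have Zeq: "Z i i = Z 0 0" if "i < n" for i
  proof (cases "i = 0")
    case False
    define q where "q = 1 * M i 0 + 1 * N i 0"
    have "of_real q * Z 0 0 = Z i i * of_real q"
      unfolding q_def using comm[OF that n, of 1 1] Zsum(1)[OF n, of "\<lambda>k. of_real (1 * M i k + 1 * N i k)"]
        Zsum(2)[OF that, of "\<lambda>k. of_real (1 * M k 0 + 1 * N k 0)"] by simp
    moreover have "q \<noteq> 0" unfolding q_def using False sumMN[OF that n] v[OF that] v[OF n] by simp
    ultimately show ?thesis by simp
  qed simp
  define z where "z = Z 0 0"
  \<comment> \<open>On the upper half of the null vector 0 = M A w = Z w = z w, and on the lower
    half the same with N D; so z = 0 unless w = 0.\<close>
  have z0: "z = 0"
  proof (rule ccontr)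
    assume nz: "z \<noteq> 0"
    have w1: "w i = 0" if i: "i < n" for i
    proof -
      have A0: "(\<Sum>l<n. A k l * w l) = 0" if "k < n" for k
        using wnull[of 1 k] that by (simp add: sum_double A_def B1z)
      have "0 = (\<Sum>k<n. of_real (M i k) * (\<Sum>l<n. A k l * w l))" by (simp add: A0)
      also have "\<dots> = (\<Sum>k<n. \<Sum>l<n. of_real (M i k) * A k l * w l)"
        by (simp add: sum_distrib_left mult.assoc)
      also have "\<dots> = (\<Sum>l<n. \<Sum>k<n. of_real (M i k) * A k l * w l)" by (rule sum.swap)
      also have "\<dots> = (\<Sum>l<n. Z i l * w l)"
        using i by (intro sum.cong refl) (simp add: col'(1)[symmetric] sum_distrib_right)
      also have "\<dots> = z * w i" using Zsum(2)[OF i, of w] Zeq[OF i] by (simp add: z_def)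
      finally show ?thesis using nz by simp
    qed
    have w2: "w (n + i) = 0" if i: "i < n" for i
    proof -
      have D0: "(\<Sum>l<n. D k l * w (n + l)) = 0" if "k < n" for k
        using wnull[of 3 "n + k"] that by (simp add: sum_double D_def B3z)
      have "0 = (\<Sum>k<n. of_real (N i k) * (\<Sum>l<n. D k l * w (n + l)))" by (simp add: D0)
      also have "\<dots> = (\<Sum>k<n. \<Sum>l<n. of_real (N i k) * D k l * w (n + l))"
        by (simp add: sum_distrib_left mult.assoc)
      also have "\<dots> = (\<Sum>l<n. \<Sum>k<n. of_real (N i k) * D k l * w (n + l))" by (rule sum.swap)
      also have "\<dots> = (\<Sum>l<n. Z i l * w (n + l))"
        using i by (intro sum.cong refl) (simp add: col'(2)[symmetric] sum_distrib_right)
      also have "\<dots> = z * w (n + i)" using Zsum(2)[OF i, of "\<lambda>l. w (n + l)"] Zeq[OF i] by (simp add: z_def)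
      finally show ?thesis using nz by simp
    qed
    obtain k where k: "k < 2 * n" "w k \<noteq> 0" using w by blast
    show False
    proof (cases "k < n")
      case True
      then show ?thesis using w1 k by simp
    next
      case False
      then have "k - n < n" using k(1) by linarith
      then show ?thesis using w2[of "k - n"] k False by simp
    qed
  qed
  have Z0: "Z i j = 0" if "i < n" "j < n" for i j
    using Zdiag[OF that] Zeq[OF that(1)] z0 by (cases "i = j") (auto simp: z_def)
  \<comment> \<open>Cancels an invertible X from Y X = 0, to be used for A M = 0 and D N =
    0.\<close>
  have inv: "Y i m = 0" if "i < n" "m < n" and 0: "\<And>j. j < n \<Longrightarrow> (\<Sum>k<n. Y i k * of_real (X k j)) = 0"
    and XI: "\<And>k m. k < n \<Longrightarrow> m < n \<Longrightarrow> (\<Sum>l<n. X k l * I l m) = (if k = m then 1 else 0)"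
    for Y :: "nat \<Rightarrow> nat \<Rightarrow> complex" and X I :: "nat \<Rightarrow> nat \<Rightarrow> real" and i m
  proof -
    have "0 = (\<Sum>j<n. (\<Sum>k<n. Y i k * of_real (X k j)) * of_real (I j m))" by (simp add: 0)
    also have "\<dots> = (\<Sum>j<n. \<Sum>k<n. Y i k * of_real (X k j * I j m))"
      by (simp add: sum_distrib_right mult.assoc)
    also have "\<dots> = (\<Sum>k<n. \<Sum>j<n. Y i k * of_real (X k j * I j m))" by (rule sum.swap)
    also have "\<dots> = (\<Sum>k<n. Y i k * of_real (\<Sum>j<n. X k j * I j m))"
      by (simp only: sum_distrib_left of_real_sum)
    also have "\<dots> = (\<Sum>k<n. if k = m then Y i k else 0)"
      using that by (intro sum.cong refl) (simp add: XI)
    also have "\<dots> = Y i m" using that by simp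
    finally show ?thesis by simp
  qed
  have A0: "A i i = 0" if i: "i < n" for i
    by (rule inv[OF i i, of A M Mi]) (simp_all only: col(1)[OF i] Z0[OF i] invM)
  have D0: "D i i = 0" if i: "i < n" for i
    by (rule inv[OF i i, of D N Ni]) (simp_all only: col(2)[OF i] Z0[OF i] invN)
  have diag: "B 1 j j = 0" "B 2 j j = 0" "B 3 j j = 0" if "j < 2 * n" for j
  proof -
    have "(B 1 j j = 0) \<and> (B 2 j j = 0) \<and> (B 3 j j = 0)"
    proof (cases "j < n")
      case True
      then show ?thesis using A0[OF True] ZL(1)[OF True True] Z0[OF True True] B3z[OF True] that by (simp add: A_def)
    next
      case False
      define m where "m = j - n"
      have m: "j = n + m" "m < n" using that False unfolding m_def by linarith+
      show ?thesis
        unfolding m(1) using m that D0[OF m(2)] ZL(4)[OF m(2) m(2)] Z0[OF m(2) m(2)] B1z[OF m(2)] that by (simp add: D_def)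
    qed
    then show "B 1 j j = 0" "B 2 j j = 0" "B 3 j j = 0" by simp_all
  qed
  have "B i j j = 0" if "i < 5" "j < 2 * n" for i j
  proof -
    consider "i = 0" | "i = 1" | "i = 2" | "i = 3" | "i = 4" using \<open>i < 5\<close> by linarith
    then show ?thesis using diag[OF that(2)] B0[OF that(2,2)] B4[OF that(2,2)] by cases simp_all
  qed
  then show ?thesis by (simp add: ctrace_def)
qed

end

subsection \<open>Existence of rigid pairs\<close>

text \<open>Diagonal plus rank one: the shape of \<open>M\<close>, \<open>N\<close> and of their
  inverses.\<close>

definition rank1 :: "(nat \<Rightarrow> real) \<Rightarrow> real \<Rightarrow> (nat \<Rightarrow> real) \<Rightarrow> nat \<Rightarrow> nat \<Rightarrow> real" where
  "rank1 d e v i j = (if i = j then d i else 0) + e * v i * v j"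

lemma rank1_sym: "rank1 d e v i j = rank1 d e v j i"
  by (simp add: rank1_def)

lemma rank1_form:
  "dot n x (mv n (rank1 d e v) x) = (\<Sum>i<n. d i * (x i)\<^sup>2) + e * (dot n v x)\<^sup>2"
proof -
  have "dot n x (mv n (rank1 d e v) x)
      = (\<Sum>i<n. \<Sum>j<n. (if i = j then d i * (x i)\<^sup>2 else 0) + e * ((v i * x i) * (v j * x j)))"
    unfolding dot_mv by (intro sum.cong refl) (auto simp: rank1_def power2_eq_square algebra_simps)
  also have "\<dots> = (\<Sum>i<n. \<Sum>j<n. if i = j then d i * (x i)\<^sup>2 else 0)
      + e * ((\<Sum>i<n. v i * x i) * (\<Sum>j<n. v j * x j))"
    by (simp only: sum.distrib sum_product) (simp only: sum_distrib_left)
  finally show ?thesis by (simp add: dot_def power2_eq_square)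
qed

lemma cauchy_schwarz_weighted:
  fixes x v d :: "nat \<Rightarrow> real"
  assumes "\<And>i. i < n \<Longrightarrow> 0 < d i"
  shows "(\<Sum>i<n. v i * x i)\<^sup>2 \<le> (\<Sum>i<n. (v i)\<^sup>2 / d i) * (\<Sum>i<n. d i * (x i)\<^sup>2)"
proof -
  have "(\<Sum>i<n. v i * x i) = (\<Sum>i<n. (v i / sqrt (d i)) * (sqrt (d i) * x i))"
  proof (intro sum.cong refl)
    fix i assume "i \<in> {..<n}"
    then have "sqrt (d i) \<noteq> 0" using assms[of i] by simp
    then show "v i * x i = (v i / sqrt (d i)) * (sqrt (d i) * x i)" by simp
  qed
  then have "(\<Sum>i<n. v i * x i)\<^sup>2 \<le> (\<Sum>i<n. (v i / sqrt (d i))\<^sup>2) * (\<Sum>i<n. (sqrt (d i) * x i)\<^sup>2)"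
    by (simp only: Cauchy_Schwarz_ineq_sum)
  also have "(\<Sum>i<n. (v i / sqrt (d i))\<^sup>2) = (\<Sum>i<n. (v i)\<^sup>2 / d i)"
    using assms by (intro sum.cong refl) (simp add: power_divide less_imp_le)
  also have "(\<Sum>i<n. (sqrt (d i) * x i)\<^sup>2) = (\<Sum>i<n. d i * (x i)\<^sup>2)"
    using assms by (intro sum.cong refl) (simp add: power_mult_distrib less_imp_le)
  finally show ?thesis .
qed

text \<open>For e < 0 the weighted Cauchy-Schwarz inequality bounds the rank-one part by the
  diagonal part.\<close>

lemma rank1_psd:
  assumes d: "\<And>i. i < n \<Longrightarrow> 0 < d i" and e: "0 \<le> 1 + e * (\<Sum>i<n. (v i)\<^sup>2 / d i)"
  shows "0 \<le> dot n x (mv n (rank1 d e v) x)"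
proof -
  define \<sigma> where "\<sigma> = (\<Sum>i<n. (v i)\<^sup>2 / d i)"
  define X where "X = (\<Sum>i<n. d i * (x i)\<^sup>2)"
  have X: "0 \<le> X" unfolding X_def using d by (intro sum_nonneg mult_nonneg_nonneg) (auto simp: less_imp_le)
  show ?thesis
  proof (cases "0 \<le> e")
    case True
    then show ?thesis using X by (simp add: rank1_form X_def)
  next
    case False
    have "(dot n v x)\<^sup>2 \<le> \<sigma> * X"
      unfolding dot_def \<sigma>_def X_def by (rule cauchy_schwarz_weighted[OF d])
    then have "e * (\<sigma> * X) \<le> e * (dot n v x)\<^sup>2" using False by (intro mult_left_mono_neg) auto
    moreover have "0 \<le> (1 + e * \<sigma>) * X" using e X by (simp add: \<sigma>_def)
    ultimately show ?thesis by (simp add: rank1_form X_def[symmetric] algebra_simps)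
  qed
qed

text \<open>Sherman-Morrison formula.\<close>

lemma rank1_inverse:
  assumes d: "\<And>i. i < n \<Longrightarrow> d i \<noteq> 0" and e: "1 + e * (\<Sum>i<n. (v i)\<^sup>2 / d i) \<noteq> 0" and ij: "i < n" "j < n"
  shows "(\<Sum>l<n. rank1 d e v i l * rank1 (\<lambda>i. 1 / d i) (- (e / (1 + e * (\<Sum>i<n. (v i)\<^sup>2 / d i)))) (\<lambda>i. v i / d i) l j)
    = (if i = j then 1 else 0)"
proof -
  define \<sigma> where "\<sigma> = (\<Sum>i<n. (v i)\<^sup>2 / d i)"
  define f where "f = e / (1 + e * \<sigma>)"
  define y where "y = v j / d j"
  have "f * (1 + e * \<sigma>) = e" using e by (simp add: f_def \<sigma>_def)
  moreover have "e - f - e * f * \<sigma> = e - f * (1 + e * \<sigma>)" by (simp add: algebra_simps)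
  ultimately have fe: "e - f - e * f * \<sigma> = 0" by simp
  have "(\<Sum>l<n. rank1 d e v i l * rank1 (\<lambda>i. 1 / d i) (- f) (\<lambda>i. v i / d i) l j)
      = (\<Sum>l<n. (if l = i then (if i = j then 1 else 0) - f * v i * y else 0)
          + ((if l = j then e * v i * y else 0) - e * f * v i * y * ((v l)\<^sup>2 / d l)))"
    using d ij by (intro sum.cong refl) (auto simp: rank1_def y_def power2_eq_square field_simps)
  also have "\<dots> = ((if i = j then 1 else 0) - f * v i * y) + (e * v i * y - e * f * v i * y * \<sigma>)"
  proof -
    have "(\<Sum>l<n. e * f * v i * y * ((v l)\<^sup>2 / d l)) = e * f * v i * y * \<sigma>"
      by (simp only: \<sigma>_def sum_distrib_left)
    then show ?thesis using ij by (simp only: sum.distrib sum_subtractf) simp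
  qed
  also have "\<dots> = (if i = j then 1 else 0) + v i * y * (e - f - e * f * \<sigma>)"
    by (simp add: algebra_simps)
  finally have eq: "(\<Sum>l<n. rank1 d e v i l * rank1 (\<lambda>i. 1 / d i) (- f) (\<lambda>i. v i / d i) l j)
      = (if i = j then 1 else 0) + v i * y * (e - f - e * f * \<sigma>)" .
  show ?thesis using eq[unfolded fe, unfolded f_def \<sigma>_def] by simp
qed

text \<open>
  \<open>M\<close> and \<open>N\<close> solve \<open>1 - M - N = v v\<^sup>T\<close> and \<open>1 - M / a - N / c = diag t\<close>. In the limit \<open>\<eta> = 0\<close> they are
  \<open>a E\<close> and \<open>1 - E\<close> for the projection \<open>E\<close> to the coordinate 0, for which the strict inequality
  required in the last clause holds; a small perturbation makes \<open>t\<close> injective and \<open>v\<close> nowhere zero.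
\<close>

lemma exists_rigid_pair:
  fixes a c \<rho> :: real
  assumes a: "0 < a" "a < 1" and c: "1 < c" and \<rho>: "0 < \<rho>" and n: "0 < n"
  shows "\<exists>M N Mi Ni v t. rigid_pair n a c M N Mi Ni v t \<and>
    (\<forall>w. dot n w (mv n M w) / (a + \<rho>) + dot n w (mv n N w) / (1 + \<rho>) \<le> dot n w w)"
proof -
  \<comment> \<open>These constants solve the two matrix equations. The diagonal parts g / \<kappa>
    and h / \<kappa> must satisfy g + h = \<kappa> and g / a + h / c = \<kappa> (1 - t), which
    forces g = T - t and h = S + t. The rank-one coefficients 1 / (c \<kappa>) and - 1 / (a
    \<kappa>) add up to -1 and cancel in M / a + N / c.\<close>
  define T where "T = 1 - 1 / c"
  define S where "S = 1 / a - 1"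
  define \<kappa> where "\<kappa> = 1 / a - 1 / c"
  have T: "0 < T" "T < 1" using c by (simp_all add: T_def)
  have S: "0 < S" using a by (simp add: S_def)
  have "\<kappa> = S + T" by (simp add: \<kappa>_def S_def T_def)
  with S T have \<kappa>: "\<kappa> = S + T" "0 < \<kappa>" by simp_all
  \<comment> \<open>For the limit pair, (a / (a + \<rho>)) E + (1 / (1 + \<rho>)) (1 - E) <=
    \<theta>. The room 1 - \<theta> pays for the errors of order \<eta>, whose total constant is
    \<open>K\<close>.\<close>
  define \<theta> where "\<theta> = max (a / (a + \<rho>)) (1 / (1 + \<rho>))"
  have \<theta>: "\<theta> < 1" using a \<rho> by (simp add: \<theta>_def)
  define K where "K = 2 / (\<kappa> * (a + \<rho>)) + 6 * S / (\<kappa> * (1 + \<rho>))"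
  have K: "0 < K" unfolding K_def using \<kappa> S a \<rho> by (intro add_pos_pos divide_pos_pos mult_pos_pos) auto
  define \<eta> where "\<eta> = min (1 / 2) ((1 - \<theta>) / K)"
  have \<eta>: "0 < \<eta>" "\<eta> < 1" "\<eta> * K \<le> 1 - \<theta>"
    using \<theta> K by (auto simp: \<eta>_def min_def field_simps)
  \<comment> \<open>Positive entries, close to e_0, with entry sum at most 1 and norm below 1. The
    factor q makes v v^T tend to (1 - a) E.\<close>
  define p where "p i = (if i = 0 then 1 - \<eta> else \<eta> / n)" for i :: nat
  define q where "q = sqrt (1 - a)"
  have q: "0 < q" "q * q = 1 - a" using a by (simp_all add: q_def)
  define v where "v i = q * p i" for i
  \<comment> \<open>Strictly increasing from 0 and below T, so that \<open>g\<close> stays positive;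
    the entries with i >= 1 tend to T.\<close>
  define t where "t i = (if i = 0 then 0 else T * (1 - \<eta> / i))" for i :: nat
  define g where "g i = T - t i" for i
  define h where "h i = S + t i" for i
  have g: "0 < g i" for i using T \<eta> by (simp add: g_def t_def algebra_simps)
  have t: "0 \<le> t i" "t i \<le> T" for i
  proof -
    have "\<eta> / i \<le> 1" if "i \<noteq> 0"
    proof -
      have "\<eta> \<le> real i" using that \<eta> by (cases i) auto
      then show ?thesis using that by simp
    qed
    then show "0 \<le> t i" using T by (simp add: t_def)
    show "t i \<le> T" using g[of i] by (simp add: g_def)
  qed
  have h: "S \<le> h i" "0 < h i" for i using t[of i] S by (simp_all add: h_def)
  have p_pos: "0 < p i" for i using \<eta> n by (simp add: p_def)
  define M where "M = rank1 (\<lambda>i. g i / \<kappa>) (1 / (c * \<kappa>)) v"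
  define N where "N = rank1 (\<lambda>i. h i / \<kappa>) (- 1 / (a * \<kappa>)) v"
  have split0: "(\<Sum>i<n. if i = 0 then f i else (0::real)) = f 0" for f :: "nat \<Rightarrow> real"
    using n by simp
  have p2: "(\<Sum>i<n. (p i)\<^sup>2) < 1"
  proof -
    have "(\<Sum>i<n. (p i)\<^sup>2) \<le> (\<Sum>i<n. (if i = 0 then (1 - \<eta>)\<^sup>2 else 0) + \<eta> * \<eta> / n)"
    proof (rule sum_mono)
      fix i
      have "(\<eta> / n)\<^sup>2 \<le> \<eta> * \<eta> / n" using n \<eta> by (simp add: power2_eq_square field_simps)
      then show "(p i)\<^sup>2 \<le> (if i = 0 then (1 - \<eta>)\<^sup>2 else 0) + \<eta> * \<eta> / n"
        using \<eta> by (simp add: p_def)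
    qed
    also have "\<dots> = (1 - \<eta>)\<^sup>2 + \<eta> * \<eta>" using n by (simp add: sum.distrib)
    also have "\<dots> = 1 - 2 * (\<eta> * (1 - \<eta>))" by (simp add: power2_eq_square algebra_simps)
    also have "\<dots> < 1" using \<eta> by simp
    finally show ?thesis .
  qed
  \<comment> \<open>Positivity and invertibility of N reduce to this bound. It follows from h >= S,
    (1 - a) / S = a and the norm of \<open>p\<close> being below 1.\<close>
  have \<tau>: "(\<Sum>i<n. (v i)\<^sup>2 / h i) < a"
  proof -
    have "(\<Sum>i<n. (v i)\<^sup>2 / h i) \<le> (\<Sum>i<n. (v i)\<^sup>2 / S)"
      using h S by (intro sum_mono divide_left_mono mult_pos_pos) auto
    also have "\<dots> = (1 - a) / S * (\<Sum>i<n. (p i)\<^sup>2)"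
      by (simp add: v_def power_mult_distrib power2_eq_square[of q] q(2) sum_distrib_left)
    also have "(1 - a) / S = a" using a by (simp add: S_def field_simps)
    also have "a * (\<Sum>i<n. (p i)\<^sup>2) < a" using p2 a by simp
    finally show ?thesis .
  qed
  have eN: "0 < 1 + (- 1 / (a * \<kappa>)) * (\<Sum>i<n. (v i)\<^sup>2 / (h i / \<kappa>))"
  proof -
    have "(\<Sum>i<n. (v i)\<^sup>2 / (h i / \<kappa>)) = \<kappa> * (\<Sum>i<n. (v i)\<^sup>2 / h i)"
      by (simp add: sum_distrib_left mult.commute)
    then have "1 + (- 1 / (a * \<kappa>)) * (\<Sum>i<n. (v i)\<^sup>2 / (h i / \<kappa>)) = 1 - (\<Sum>i<n. (v i)\<^sup>2 / h i) / a"
      using \<kappa>(2) by (simp only:) simp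
    moreover have "(\<Sum>i<n. (v i)\<^sup>2 / h i) / a < 1" using \<tau> a by simp
    ultimately show ?thesis by linarith
  qed
  have eM: "0 < 1 + (1 / (c * \<kappa>)) * (\<Sum>i<n. (v i)\<^sup>2 / (g i / \<kappa>))"
    using g \<kappa> c by (intro add_pos_nonneg mult_nonneg_nonneg sum_nonneg) (auto simp: less_imp_le)
  define Mi where "Mi = rank1 (\<lambda>i. 1 / (g i / \<kappa>)) (- ((1 / (c * \<kappa>)) / (1 + (1 / (c * \<kappa>)) * (\<Sum>i<n. (v i)\<^sup>2 / (g i / \<kappa>))))) (\<lambda>i. v i / (g i / \<kappa>))"
  define Ni where "Ni = rank1 (\<lambda>i. 1 / (h i / \<kappa>)) (- ((- 1 / (a * \<kappa>)) / (1 + (- 1 / (a * \<kappa>)) * (\<Sum>i<n. (v i)\<^sup>2 / (h i / \<kappa>))))) (\<lambda>i. v i / (h i / \<kappa>))"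
  have gk: "0 < g i / \<kappa>" "g i / \<kappa> \<noteq> 0" and hk: "0 < h i / \<kappa>" "h i / \<kappa> \<noteq> 0" for i
    using g[of i] h(2)[of i] \<kappa> by simp_all
  have gh: "g i + h i = \<kappa>" for i by (simp add: g_def h_def \<kappa>)
  have "rigid_pair n a c M N Mi Ni v t"
  proof
    show "0 < n" "0 < a" "0 < c" using n a c by simp_all
    show "M i j = M j i" "N i j = N j i" "Mi i j = Mi j i" "Ni i j = Ni j i" for i j
      by (simp_all only: M_def N_def Mi_def Ni_def rank1_sym[of _ _ _ i j])
    show "(\<Sum>l<n. M i l * Mi l j) = (if i = j then 1 else 0)" if "i < n" "j < n" for i j
      unfolding M_def Mi_def by (rule rank1_inverse[OF gk(2) _ that]) (use eM in linarith)
    show "(\<Sum>l<n. N i l * Ni l j) = (if i = j then 1 else 0)" if "i < n" "j < n" for i j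
      unfolding N_def Ni_def by (rule rank1_inverse[OF hk(2) _ that]) (use eN in linarith)
    show "0 \<le> dot n x (mv n M x)" for x
      unfolding M_def by (rule rank1_psd[OF gk(1)]) (use eM in linarith)
    show "0 \<le> dot n x (mv n N x)" for x
      unfolding N_def by (rule rank1_psd[OF hk(1)]) (use eN in linarith)
    show "M i j + N i j = (if i = j then 1 else 0) - v i * v j" for i j
    proof -
      have "1 / (c * \<kappa>) + - 1 / (a * \<kappa>) = (1 / c - 1 / a) / \<kappa>" by (simp add: diff_divide_distrib)
      also have "1 / c - 1 / a = - \<kappa>" by (simp add: \<kappa>_def)
      finally have e: "1 / (c * \<kappa>) + - 1 / (a * \<kappa>) = - 1" using \<kappa>(2) by simp
      have g1: "g i / \<kappa> + h i / \<kappa> = 1" using gh[of i] \<kappa>(2) by (simp flip: add_divide_distrib)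
      define X where "X = 1 / (c * \<kappa>) * v i * v j"
      define Y where "Y = - 1 / (a * \<kappa>) * v i * v j"
      have "X + Y = (1 / (c * \<kappa>) + - 1 / (a * \<kappa>)) * (v i * v j)"
        by (simp only: X_def Y_def distrib_right mult.assoc)
      then have "X + Y = - (v i * v j)" unfolding e by simp
      moreover have "M i j = (if i = j then g i / \<kappa> else 0) + X" "N i j = (if i = j then h i / \<kappa> else 0) + Y"
        by (simp_all only: M_def N_def rank1_def X_def Y_def)
      ultimately show ?thesis using g1 by auto
    qed
    show "M i j / a + N i j / c = (if i = j then 1 - t i else 0)" for i j
    proof -
      have "g i / \<kappa> / a + h i / \<kappa> / c = (g i / a + h i / c) / \<kappa>" by (simp add: add_divide_distrib mult.commute)
      also have "g i / a + h i / c = \<kappa> * (1 - t i)"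
        using a c by (simp add: g_def h_def T_def S_def \<kappa>_def field_simps)
      finally have 1: "g i / \<kappa> / a + h i / \<kappa> / c = 1 - t i" using \<kappa> by simp
      define X where "X = 1 / (c * \<kappa>) * v i * v j"
      define Y where "Y = - 1 / (a * \<kappa>) * v i * v j"
      have 2: "X / a + Y / c = 0" by (simp add: X_def Y_def mult_ac)
      have "M i j = (if i = j then g i / \<kappa> else 0) + X" "N i j = (if i = j then h i / \<kappa> else 0) + Y"
        by (simp_all only: M_def N_def rank1_def X_def Y_def)
      then show ?thesis using 1 2 by (auto simp: add_divide_distrib)
    qed
    show "inj_on t {..<n}"
    proof (rule inj_onI)
      fix i j assume "t i = t j"
      have nz: "t k \<noteq> 0" if "k \<noteq> 0" for k
      proof -
        have "\<eta> < real k" using that \<eta> by (cases k) auto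
        then show ?thesis using that T by (simp add: t_def)
      qed
      show "i = j"
      proof (cases "i = 0 \<or> j = 0")
        case True
        then show ?thesis using \<open>t i = t j\<close> nz by (metis t_def)
      next
        case False
        then show ?thesis using \<open>t i = t j\<close> T \<eta> by (simp add: t_def)
      qed
    qed
    show "t 0 = 0" by (simp add: t_def)
    show "0 \<le> t i" for i by (rule t)
    show "v i \<noteq> 0" for i using q p_pos[of i] by (simp add: v_def)
  qed
  moreover have "dot n w (mv n M w) / (a + \<rho>) + dot n w (mv n N w) / (1 + \<rho>) \<le> dot n w w" for w
  proof -
    define w0 where "w0 = (w 0)\<^sup>2"
    define W where "W = dot n w w"
    define P where "P = dot n p w"
    have W2: "W = (\<Sum>i<n. (w i)\<^sup>2)" by (simp add: W_def dot_def power2_eq_square)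
    have w0W: "w0 \<le> W" unfolding w0_def W2 using n by (intro member_le_sum) auto
    have w0: "0 \<le> w0" by (simp add: w0_def)
    have vw: "(dot n v w)\<^sup>2 = (1 - a) * P\<^sup>2"
      by (simp add: v_def P_def dot_def mult.assoc sum_distrib_left[symmetric] power_mult_distrib power2_eq_square[of q] q)
    \<comment> \<open>P^2 agrees with w_0^2 up to order \<eta>. The upper bound serves
      \<open>M\<close>, whose rank-one part is positive; the lower bound serves \<open>N\<close>,
      whose rank-one part is negative.\<close>
    have Pup: "P\<^sup>2 \<le> w0 + \<eta> * W"
    proof -
      have "P\<^sup>2 \<le> (\<Sum>i<n. (p i)\<^sup>2 / p i) * (\<Sum>i<n. p i * (w i)\<^sup>2)"
        unfolding P_def dot_def by (rule cauchy_schwarz_weighted) (rule p_pos)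
      also have "(\<Sum>i<n. (p i)\<^sup>2 / p i) = (\<Sum>i<n. p i)"
        by (intro sum.cong refl) (simp add: power2_eq_square)
      also have "(\<Sum>i<n. p i) * (\<Sum>i<n. p i * (w i)\<^sup>2) \<le> 1 * (\<Sum>i<n. p i * (w i)\<^sup>2)"
      proof (rule mult_right_mono)
        have "(\<Sum>i<n. p i) \<le> (\<Sum>i<n. (if i = 0 then 1 - \<eta> else 0) + \<eta> / n)"
          using \<eta> by (intro sum_mono) (simp add: p_def)
        also have "\<dots> = 1" using n by (simp add: sum.distrib)
        finally show "(\<Sum>i<n. p i) \<le> 1" .
        show "0 \<le> (\<Sum>i<n. p i * (w i)\<^sup>2)"
          by (intro sum_nonneg mult_nonneg_nonneg) (auto intro: less_imp_le p_pos)
      qed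
      also have "1 * (\<Sum>i<n. p i * (w i)\<^sup>2) \<le> (\<Sum>i<n. (if i = 0 then w0 else 0) + \<eta> * (w i)\<^sup>2)"
      proof (simp only: mult_1_left, rule sum_mono)
        fix i
        have "\<eta> / n \<le> \<eta>" using n \<eta> by (simp add: divide_le_eq_1 field_simps)
        then have "(\<eta> / n) * (w i)\<^sup>2 \<le> \<eta> * (w i)\<^sup>2" by (rule mult_right_mono) simp
        moreover have "(1 - \<eta>) * (w 0)\<^sup>2 \<le> w0 + \<eta> * (w 0)\<^sup>2"
          using \<eta> w0 unfolding w0_def by (simp add: algebra_simps)
        ultimately show "p i * (w i)\<^sup>2 \<le> (if i = 0 then w0 else 0) + \<eta> * (w i)\<^sup>2"
          by (simp add: p_def)
      qed
      also have "\<dots> = w0 + \<eta> * W" using n by (simp add: sum.distrib W2 sum_distrib_left)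
      finally show ?thesis .
    qed
    have Plow: "w0 - 6 * \<eta> * W \<le> P\<^sup>2"
    proof -
      define s where "s = (\<eta> / n) * (\<Sum>i<n. w i) - (\<eta> + \<eta> / n) * w 0"
      have "P = (\<Sum>i<n. (\<eta> / n) * w i + (if i = 0 then (1 - \<eta> - \<eta> / n) * w 0 else 0))"
        unfolding P_def dot_def by (intro sum.cong refl) (simp add: p_def algebra_simps)
      also have "\<dots> = w 0 + s"
      proof -
        have 1: "(\<Sum>i<n. (\<eta> / n) * w i) = (\<eta> / n) * (\<Sum>i<n. w i)" by (simp only: sum_distrib_left)
        have 2: "(\<Sum>i<n. if i = 0 then (1 - \<eta> - \<eta> / n) * w 0 else 0) = (1 - \<eta> - \<eta> / n) * w 0" using n by simp
        show ?thesis unfolding sum.distrib 1 2 s_def by (simp add: algebra_simps)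
      qed
      finally have P: "P = w 0 + s" .
      \<comment> \<open>The cross term of P^2 = (w_0 + s)^2 is bounded below through 2 w_0 w_i >= -
        (w_0^2 + w_i^2); the term s^2 is dropped.\<close>
      have "- (n * w0 + W) \<le> 2 * (w 0 * (\<Sum>i<n. w i))"
      proof -
        have "- (n * w0 + W) = (\<Sum>i<n. - (w0 + (w i)\<^sup>2))" by (simp add: W2 sum_negf sum_subtractf)
        also have "\<dots> \<le> (\<Sum>i<n. 2 * (w 0 * w i))"
        proof (rule sum_mono)
          fix i
          have "0 \<le> (w 0 + w i)\<^sup>2" by simp
          then show "- (w0 + (w i)\<^sup>2) \<le> 2 * (w 0 * w i)" by (simp add: w0_def power2_sum)
        qed
        finally show ?thesis by (simp only: sum_distrib_left)
      qed
      then have "(\<eta> / n) * - (n * w0 + W) \<le> (\<eta> / n) * (2 * (w 0 * (\<Sum>i<n. w i)))"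
        using \<eta> by (intro mult_left_mono) auto
      moreover have "(\<eta> / n) * - (n * w0 + W) = - (\<eta> * w0 + (\<eta> / n) * W)"
        using n by (simp add: field_simps)
      ultimately have "2 * (w 0 * s) \<ge> - (\<eta> * w0) - (\<eta> / n) * W - 2 * (\<eta> * w0) - 2 * ((\<eta> / n) * w0)"
        by (simp add: s_def w0_def power2_eq_square algebra_simps)
      moreover have "\<eta> * w0 \<le> \<eta> * W" "(\<eta> / n) * W \<le> \<eta> * W" "(\<eta> / n) * w0 \<le> \<eta> * W"
      proof -
        have en: "\<eta> / n \<le> \<eta>" "0 \<le> \<eta> / n" using n \<eta> by (simp_all add: field_simps)
        show "\<eta> * w0 \<le> \<eta> * W" using w0W \<eta> by simp
        show "(\<eta> / n) * W \<le> \<eta> * W" using en(1) w0 w0W by (intro mult_right_mono) auto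
        show "(\<eta> / n) * w0 \<le> \<eta> * W" using en w0 w0W \<eta> by (intro mult_mono) auto
      qed
      ultimately have "2 * (w 0 * s) \<ge> - (6 * (\<eta> * W))" by linarith
      moreover have "P\<^sup>2 = w0 + 2 * (w 0 * s) + s\<^sup>2" by (simp add: P w0_def power2_sum)
      ultimately show ?thesis using zero_le_power2[of s] mult.assoc[of 6 \<eta> W] by linarith
    qed
    \<comment> \<open>As forms, M <= a E and below N <= 1 - E, both up to order \<eta>.\<close>
    have Mw: "dot n w (mv n M w) \<le> a * w0 + (2 * \<eta> / \<kappa>) * W"
    proof -
      have "(\<Sum>i<n. g i * (w i)\<^sup>2) \<le> (\<Sum>i<n. (if i = 0 then T * w0 else 0) + \<eta> * (w i)\<^sup>2)"
      proof (rule sum_mono)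
        fix i :: nat
        have "T * \<eta> / i \<le> \<eta>" if "i \<noteq> 0"
        proof -
          have "T * \<eta> \<le> 1 * \<eta>" using T \<eta> by (intro mult_right_mono) auto
          also have "\<dots> \<le> real i * \<eta>" using that \<eta> by (intro mult_right_mono) auto
          finally show ?thesis using that by (simp add: divide_le_eq mult.commute)
        qed
        then have "g i \<le> \<eta>" if "i \<noteq> 0" using that by (simp add: g_def t_def algebra_simps)
        then show "g i * (w i)\<^sup>2 \<le> (if i = 0 then T * w0 else 0) + \<eta> * (w i)\<^sup>2"
          using \<eta> by (auto simp: g_def t_def w0_def mult_right_mono)
      qed
      also have "\<dots> = T * w0 + \<eta> * W" using n by (simp add: sum.distrib W2 sum_distrib_left)
      finally have g1: "(\<Sum>i<n. g i * (w i)\<^sup>2) \<le> T * w0 + \<eta> * W" .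
      have "(1 - a) / c * P\<^sup>2 \<le> (1 - a) / c * (w0 + \<eta> * W)"
        using a c Pup by (intro mult_left_mono) auto
      also have "\<dots> \<le> (1 - a) / c * w0 + \<eta> * W"
      proof -
        have "(1 - a) / c \<le> 1" using a c by simp
        then have "(1 - a) / c * (\<eta> * W) \<le> 1 * (\<eta> * W)"
          using \<eta> w0 w0W by (intro mult_right_mono) auto
        then show ?thesis by (simp add: distrib_left)
      qed
      finally have g2: "(1 - a) / c * P\<^sup>2 \<le> (1 - a) / c * w0 + \<eta> * W" .
      have "dot n w (mv n M w) = ((\<Sum>i<n. g i * (w i)\<^sup>2) + (1 - a) / c * P\<^sup>2) / \<kappa>"
        by (simp add: M_def rank1_form vw add_divide_distrib sum_divide_distrib)
      also have "\<dots> \<le> ((T + (1 - a) / c) * w0 + 2 * \<eta> * W) / \<kappa>"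
        using g1 g2 \<kappa> by (intro divide_right_mono) (auto simp: distrib_right)
      also have "T + (1 - a) / c = a * \<kappa>"
        using a c by (simp add: T_def \<kappa>_def field_simps)
      finally show ?thesis using \<kappa> by (simp add: add_divide_distrib)
    qed
    have Nw: "dot n w (mv n N w) \<le> (W - w0) + (6 * S * \<eta> / \<kappa>) * W"
    proof -
      have "(\<Sum>i<n. h i * (w i)\<^sup>2) \<le> (\<Sum>i<n. \<kappa> * (w i)\<^sup>2 - (if i = 0 then T * w0 else 0))"
      proof (rule sum_mono)
        fix i
        have "t i * (w i)\<^sup>2 \<le> T * (w i)\<^sup>2" using t(2) by (intro mult_right_mono) auto
        then show "h i * (w i)\<^sup>2 \<le> \<kappa> * (w i)\<^sup>2 - (if i = 0 then T * w0 else 0)"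
          by (auto simp: h_def \<kappa>(1) w0_def t_def algebra_simps)
      qed
      also have "\<dots> = \<kappa> * W - T * w0" using n by (simp add: sum_subtractf W2 sum_distrib_left)
      finally have h1: "(\<Sum>i<n. h i * (w i)\<^sup>2) \<le> \<kappa> * W - T * w0" .
      have "S * (w0 - 6 * \<eta> * W) \<le> S * P\<^sup>2" using S Plow by (intro mult_left_mono) auto
      moreover have Sa: "(1 - a) / a = S" using a by (simp add: S_def field_simps)
      moreover have "dot n w (mv n N w) = ((\<Sum>i<n. h i * (w i)\<^sup>2) - (1 - a) / a * P\<^sup>2) / \<kappa>"
      proof -
        have 1: "(\<Sum>i<n. h i / \<kappa> * (w i)\<^sup>2) = (\<Sum>i<n. h i * (w i)\<^sup>2) / \<kappa>"
          by (simp add: sum_divide_distrib)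
        show ?thesis unfolding N_def rank1_form vw 1 by (subst diff_divide_distrib) simp
      qed
      ultimately have "dot n w (mv n N w) \<le> ((\<kappa> * W - T * w0) - S * (w0 - 6 * \<eta> * W)) / \<kappa>"
        using h1 \<kappa>(2) by (simp add: divide_right_mono)
      also have "(\<kappa> * W - T * w0) - S * (w0 - 6 * \<eta> * W) = \<kappa> * (W - w0) + 6 * S * \<eta> * W"
        by (simp add: \<kappa>(1) algebra_simps)
      finally show ?thesis using \<kappa>(2) by (simp add: add_divide_distrib)
    qed
    have "dot n w (mv n M w) / (a + \<rho>) + dot n w (mv n N w) / (1 + \<rho>)
        \<le> (a * w0 + (2 * \<eta> / \<kappa>) * W) / (a + \<rho>) + ((W - w0) + (6 * S * \<eta> / \<kappa>) * W) / (1 + \<rho>)"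
      using Mw Nw a \<rho> by (intro add_mono divide_right_mono) auto
    also have "\<dots> = a / (a + \<rho>) * w0 + 1 / (1 + \<rho>) * (W - w0) + \<eta> * K * W"
      by (simp add: K_def add_divide_distrib distrib_left distrib_right mult_ac)
    also have "\<dots> \<le> \<theta> * w0 + \<theta> * (W - w0) + (1 - \<theta>) * W"
      using w0 w0W \<eta>(3) by (intro add_mono mult_right_mono) (auto simp: \<theta>_def)
    also have "\<dots> = W" by (simp add: algebra_simps)
    finally show ?thesis by (simp add: W_def)
  qed
  ultimately show ?thesis by blast
qed

subsection \<open>Pentagonal configurations\<close>

text \<open>
  Coordinates of a ray with respect to the three middle rays of five consecutive ones: the outer
  two of the five are \<open>(1, -1, 1)\<close> and \<open>(a, -1, b)\<close>.
\<close>

definition pentagonal :: "real \<Rightarrow> real \<Rightarrow> real \<times> real \<times> real \<Rightarrow> bool" where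
  "pentagonal a b z \<longleftrightarrow> (case z of (x, y, w) \<Rightarrow> 0 \<le> x \<and> 0 \<le> w \<and>
     (y < 0 \<longrightarrow> (x = - y \<and> w = - y) \<or> (x = - y * a \<and> w = - y * b) \<or> (- y * a < x \<and> - y < w)))"

text \<open>Finitely many strict inequalities have a common margin.\<close>

lemma pentagonal_margin:
  assumes "finite G" "\<And>z. z \<in> G \<Longrightarrow> pentagonal a b z"
  shows "\<exists>\<rho>>0. \<forall>(x, y, w)\<in>G. y < 0 \<longrightarrow> (x = - y \<and> w = - y) \<or> (x = - y * a \<and> w = - y * b) \<or>
    (- y * (a + \<rho>) \<le> x \<and> - y * (1 + \<rho>) \<le> w)"
  using assms
proof (induction G rule: finite_induct)
  case empty
  then show ?case by (auto intro: exI[of _ 1])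
next
  case (insert z G)
  obtain x y w where z: "z = (x, y, w)" by (cases z)
  obtain \<rho> where \<rho>: "\<rho> > 0" "\<forall>(x, y, w)\<in>G. y < 0 \<longrightarrow> (x = - y \<and> w = - y) \<or> (x = - y * a \<and> w = - y * b) \<or>
    (- y * (a + \<rho>) \<le> x \<and> - y * (1 + \<rho>) \<le> w)"
    using insert.IH insert.prems by auto
  have mono: "- y' * (a + \<rho>') \<le> - y' * (a + \<rho>) \<and> - y' * (1 + \<rho>') \<le> - y' * (1 + \<rho>)" if "y' < 0" "\<rho>' \<le> \<rho>" for y' \<rho> \<rho>' :: real
    using that by (intro conjI mult_left_mono) auto
  show ?case
  proof (cases "y < 0 \<and> - y * a < x \<and> - y < w")
    case True
    \<comment> \<open>The slack of the new ray, relative to - y, caps the previous margin.\<close>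
    define \<rho>' where "\<rho>' = min \<rho> (min ((x + y * a) / - y) ((w + y) / - y))"
    have "\<rho>' > 0" unfolding \<rho>'_def using \<rho>(1) True by (simp add: divide_pos_neg divide_neg_neg zero_less_divide_iff)
    moreover have "\<rho>' \<le> (x + y * a) / - y" "\<rho>' \<le> (w + y) / - y" "\<rho>' \<le> \<rho>" by (simp_all add: \<rho>'_def)
    moreover have "- y * (a + \<rho>') \<le> x" "- y * (1 + \<rho>') \<le> w"
    proof -
      have "0 < - y" using True by simp
      then have "\<rho>' * - y \<le> x + y * a" "\<rho>' * - y \<le> w + y"
        using \<open>\<rho>' \<le> (x + y * a) / - y\<close> \<open>\<rho>' \<le> (w + y) / - y\<close> by (simp_all only: pos_le_divide_eq)
      then show "- y * (a + \<rho>') \<le> x" "- y * (1 + \<rho>') \<le> w" by (simp_all add: algebra_simps)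
    qed
    moreover have "\<forall>(x, y, w)\<in>G. y < 0 \<longrightarrow> (x = - y \<and> w = - y) \<or> (x = - y * a \<and> w = - y * b) \<or>
      (- y * (a + \<rho>') \<le> x \<and> - y * (1 + \<rho>') \<le> w)"
    proof (rule ballI)
      fix z' assume z'G: "z' \<in> G"
      obtain x' y' w' where z': "z' = (x', y', w')" by (cases z')
      have "(x' = - y' \<and> w' = - y') \<or> (x' = - y' * a \<and> w' = - y' * b) \<or>
        (- y' * (a + \<rho>') \<le> x' \<and> - y' * (1 + \<rho>') \<le> w')" if "y' < 0"
      proof -
        have "(x' = - y' \<and> w' = - y') \<or> (x' = - y' * a \<and> w' = - y' * b) \<or>
          (- y' * (a + \<rho>) \<le> x' \<and> - y' * (1 + \<rho>) \<le> w')"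
          using bspec[OF \<rho>(2) z'G] that unfolding z' prod.case by blast
        then show ?thesis
          using mono[OF that \<open>\<rho>' \<le> \<rho>\<close>] by (elim disjE conjE) (blast intro: order_trans)+
      qed
      then show "case z' of (x, y, w) \<Rightarrow> y < 0 \<longrightarrow> (x = - y \<and> w = - y) \<or> (x = - y * a \<and> w = - y * b) \<or>
          (- y * (a + \<rho>') \<le> x \<and> - y * (1 + \<rho>') \<le> w)"
        unfolding z' prod.case by blast
    qed
    ultimately show ?thesis unfolding z by (intro exI[of _ \<rho>']) simp
  next
    case False
    then have "y < 0 \<longrightarrow> (x = - y \<and> w = - y) \<or> (x = - y * a \<and> w = - y * b)"
      using insert.prems[of z] by (auto simp: z pentagonal_def)
    then show ?thesis using \<rho> unfolding z by (intro exI[of _ \<rho>]) (simp, blast)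
  qed
qed

text \<open>Tells how large a multiple of the identity absorbs an indefinite matrix.\<close>

lemma form_bound:
  fixes b :: "nat \<Rightarrow> nat \<Rightarrow> real"
  shows "\<bar>\<Sum>j<s. \<Sum>k<s. y j * b j k * y k\<bar> \<le> (\<Sum>j<s. \<Sum>k<s. \<bar>b j k\<bar>) * (\<Sum>j<s. (y j)\<^sup>2)"
proof -
  have yy: "\<bar>y j\<bar> * \<bar>y k\<bar> \<le> (\<Sum>j<s. (y j)\<^sup>2)" if "j < s" "k < s" for j k
  proof -
    have le: "(y i)\<^sup>2 \<le> (\<Sum>j<s. (y j)\<^sup>2)" if "i < s" for i using that by (intro member_le_sum) auto
    have "0 \<le> (\<bar>y j\<bar> - \<bar>y k\<bar>)\<^sup>2" by simp
    then have "2 * (\<bar>y j\<bar> * \<bar>y k\<bar>) \<le> (y j)\<^sup>2 + (y k)\<^sup>2" by (simp add: power2_diff)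
    then show ?thesis using le[OF that(1)] le[OF that(2)] by linarith
  qed
  have "\<bar>\<Sum>j<s. \<Sum>k<s. y j * b j k * y k\<bar> \<le> (\<Sum>j<s. \<bar>\<Sum>k<s. y j * b j k * y k\<bar>)" by (rule sum_abs)
  also have "\<dots> \<le> (\<Sum>j<s. \<Sum>k<s. \<bar>y j * b j k * y k\<bar>)" by (intro sum_mono sum_abs)
  also have "\<dots> \<le> (\<Sum>j<s. \<Sum>k<s. \<bar>b j k\<bar> * (\<Sum>j<s. (y j)\<^sup>2))"
  proof (intro sum_mono)
    fix j k assume "j \<in> {..<s}" "k \<in> {..<s}"
    then have "\<bar>b j k\<bar> * (\<bar>y j\<bar> * \<bar>y k\<bar>) \<le> \<bar>b j k\<bar> * (\<Sum>j<s. (y j)\<^sup>2)" by (intro mult_left_mono yy) auto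
    then show "\<bar>y j * b j k * y k\<bar> \<le> \<bar>b j k\<bar> * (\<Sum>j<s. (y j)\<^sup>2)" by (simp add: abs_mult mult_ac)
  qed
  finally show ?thesis by (simp only: sum_distrib_right)
qed

text \<open>Covers faces and quotients at once. On generators with \<open>l x = 0\<close> the block
  matrices are positive by the pentagonal conditions. The coordinates of the other generators are
  uncontrolled, and there \<open>\<phi>\<close> adds a large multiple of \<open>l\<close> times the
  identity. Since \<open>l\<close> vanishes on the five rays, their degeneracy is untouched.\<close>

lemma pentagonal_not_subhomogeneous:
  fixes C S :: "'a::real_vector set" and c :: "nat \<Rightarrow> 'a" and \<alpha> \<beta> \<gamma> l :: "'a \<Rightarrow> real"
  assumes S: "finite S" "C = convex_cone hull S" and u: "u \<in> C"
    and cC: "\<And>i. i < 5 \<Longrightarrow> c i \<in> C"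
    and rel: "c 0 = c 1 - c 2 + c 3" "c 4 = a *\<^sub>R c 1 - c 2 + b *\<^sub>R c 3"
    and ab: "0 < a" "a < 1" "1 < b"
    and lin: "linear \<alpha>" "linear \<beta>" "linear \<gamma>" "linear l"
    and c1: "\<alpha> (c 1) = 1" "\<beta> (c 1) = 0" "\<gamma> (c 1) = 0" "l (c 1) = 0"
    and c2: "\<alpha> (c 2) = 0" "\<beta> (c 2) = 1" "\<gamma> (c 2) = 0" "l (c 2) = 0"
    and c3: "\<alpha> (c 3) = 0" "\<beta> (c 3) = 0" "\<gamma> (c 3) = 1" "l (c 3) = 0"
    and G: "finite G" "\<And>z. z \<in> G \<Longrightarrow> pentagonal a b z"
    and gen: "\<And>x. x \<in> S \<Longrightarrow> 0 < l x \<or> (l x = 0 \<and> (\<alpha> x, \<beta> x, \<gamma> x) \<in> convex_cone hull G)"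
  shows "\<not> subhomogeneous TYPE('b::comm_cstar_algebra) (min_cone C) u"
proof -
  have "\<not> subhomogeneous_of_degree TYPE('b) d (min_cone C) u" for d
  proof -
    \<comment> \<open>Makes n positive and 2 n larger than d.\<close>
    define n where "n = d + 1"
    obtain \<rho> where \<rho>: "\<rho> > 0" "\<forall>(x, y, w)\<in>G. y < 0 \<longrightarrow> (x = - y \<and> w = - y) \<or> (x = - y * a \<and> w = - y * b) \<or>
      (- y * (a + \<rho>) \<le> x \<and> - y * (1 + \<rho>) \<le> w)"
      using pentagonal_margin[OF G] by blast
    have "0 < n" by (simp add: n_def)
    obtain M N Mi Ni v t where rp: "rigid_pair n a b M N Mi Ni v t"
      and dom: "\<forall>w. dot n w (mv n M w) / (a + \<rho>) + dot n w (mv n N w) / (1 + \<rho>) \<le> dot n w w"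
      using exists_rigid_pair[OF ab \<rho>(1) \<open>0 < n\<close>] by (elim exE conjE) (rule that)
    interpret rigid_pair n a b M N Mi Ni v t by (rule rp)
    define psd where "psd z \<longleftrightarrow> (case z of (x, y, w) \<Rightarrow>
      \<forall>e. 0 \<le> (\<Sum>j<2 * n. \<Sum>k<2 * n. e j * blk x y w j k * e k))" for z
    have blk_G: "psd z" if "z \<in> G" for z
    proof -
      obtain x y w where z: "z = (x, y, w)" by (cases z)
      have nn: "0 \<le> x" "0 \<le> w" using G(2)[OF that] by (simp_all add: z pentagonal_def)
      show ?thesis
      proof (cases "y < 0")
        case False
        then show ?thesis using nn blk_psd_nonneg by (simp add: psd_def z)
      next
        case True
        have ps: "psd z" if "0 < x'" "0 < w'" "x = - y * x'" "w = - y * w'"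
          "\<And>e. dot n e (mv n M e) / x' + dot n e (mv n N e) / w' \<le> dot n e e" for x' w'
        proof -
          have "(\<Sum>j<2 * n. \<Sum>k<2 * n. e j * blk x y w j k * e k)
              = - y * (\<Sum>j<2 * n. \<Sum>k<2 * n. e j * blk x' (- 1) w' j k * e k)" for e
            using blk_scale[of "- y" x' "- 1" w'] that(3,4)
            by (simp add: sum_distrib_left mult_ac sum_negf)
          moreover have "0 \<le> - y * (\<Sum>j<2 * n. \<Sum>k<2 * n. e j * blk x' (- 1) w' j k * e k)" for e
            using True by (intro mult_nonneg_nonneg blk_psd_minus that) auto
          ultimately show ?thesis by (simp add: psd_def z)
        qed
        \<comment> \<open>A multiple of one of the two outer rays, or a ray beyond the corner (a,
          -1, 1) with margin \<rho>.\<close>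
        consider "x = - y" "w = - y" | "x = - y * a" "w = - y * b" | "- y * (a + \<rho>) \<le> x" "- y * (1 + \<rho>) \<le> w"
          using \<rho>(2) \<open>z \<in> G\<close> True z by auto
        then show ?thesis
        proof cases
          case 1
          show ?thesis by (rule ps[of 1 1, OF _ _ _ _ dom_one]) (use 1 in auto)
        next
          case 2
          show ?thesis by (rule ps[of a b, OF _ _ _ _ dom_ac]) (use 2 ab in auto)
        next
          case 3
          define x' where "x' = x / - y"
          define w' where "w' = w / - y"
          have le: "a + \<rho> \<le> x'" "1 + \<rho> \<le> w'"
          proof -
            have "0 < - y" using True by simp
            then show "a + \<rho> \<le> x'" "1 + \<rho> \<le> w'"
              using 3 by (simp_all only: x'_def w'_def pos_le_divide_eq mult.commute)
          qed
          have pos: "0 < x'" "0 < w'" using le ab \<rho>(1) by linarith+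
          have "dot n e (mv n M e) / x' + dot n e (mv n N e) / w' \<le> dot n e e" for e
          proof -
            have "dot n e (mv n M e) / x' \<le> dot n e (mv n M e) / (a + \<rho>)"
              using le pos ab \<rho>(1) by (intro divide_left_mono psdM mult_pos_pos) auto
            moreover have "dot n e (mv n N e) / w' \<le> dot n e (mv n N e) / (1 + \<rho>)"
              using le pos \<rho>(1) by (intro divide_left_mono psdN mult_pos_pos) auto
            ultimately show ?thesis using dom by (meson add_mono order_trans)
          qed
          moreover have "x = - y * x'" "w = - y * w'" using True by (simp_all add: x'_def w'_def)
          ultimately show ?thesis using ps pos by blast
        qed
      qed
    qed
    have hullG: "psd z" if "z \<in> convex_cone hull G" for z
    proof -
      have "convex_cone {z. psd z}"
        unfolding convex_cone_iff
      proof (intro conjI ballI allI impI)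
        show "0 \<in> {z. psd z}" by (simp add: psd_def zero_prod_def blk_psd_nonneg)
      next
        fix p q assume "p \<in> {z. psd z}" "q \<in> {z. psd z}"
        then show "p + q \<in> {z. psd z}"
          by (auto simp: psd_def blk_add distrib_left distrib_right sum.distrib split: prod.splits)
      next
        fix p :: "real \<times> real \<times> real" and r :: real
        assume p: "p \<in> {z. psd z}" and r: "0 \<le> r"
        obtain x y w where xyw: "p = (x, y, w)" by (cases p)
        have "(\<Sum>j<2 * n. \<Sum>k<2 * n. e j * blk (r * x) (r * y) (r * w) j k * e k)
            = r * (\<Sum>j<2 * n. \<Sum>k<2 * n. e j * blk x y w j k * e k)" for e
          by (simp add: blk_scale sum_distrib_left mult_ac)
        then show "r *\<^sub>R p \<in> {z. psd z}" using p r by (simp add: psd_def xyw)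
      qed
      then have "convex_cone hull G \<subseteq> {z. psd z}" using blk_G by (intro hull_minimal) auto
      then show ?thesis using that by blast
    qed
    define K where "K x = (\<Sum>j<2 * n. \<Sum>k<2 * n. \<bar>blk (\<alpha> x) (\<beta> x) (\<gamma> x) j k\<bar>)" for x
    have K: "0 \<le> K x" for x unfolding K_def by (intro sum_nonneg) auto
    \<comment> \<open>The sum dominates each ratio, so that one factor serves all generators with
      \<open>l\<close> positive.\<close>
    define r where "r = (\<Sum>x\<in>{x \<in> S. 0 < l x}. K x / l x)"
    have r: "K x \<le> r * l x" if "x \<in> S" "0 < l x" for x
    proof -
      have "K x / l x \<le> r" unfolding r_def
        using that S(1) K by (intro member_le_sum) (auto intro!: divide_nonneg_pos)
      then show ?thesis using that by (simp add: pos_divide_le_eq)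
    qed
    define \<phi> where "\<phi> x j k = blk (\<alpha> x) (\<beta> x) (\<gamma> x) j k + (if j = k then r * l x else 0)" for x j k
    have \<phi>lin: "linear (\<lambda>x. \<phi> x j k)" for j k
    proof (rule linearI)
      show "\<phi> (x + y) j k = \<phi> x j k + \<phi> y j k" for x y
        by (simp add: \<phi>_def linear_add[OF lin(1)] linear_add[OF lin(2)] linear_add[OF lin(3)] linear_add[OF lin(4)]
            blk_add distrib_left)
      show "\<phi> (s *\<^sub>R x) j k = s *\<^sub>R \<phi> x j k" for s x
        by (simp add: \<phi>_def linear_scale[OF lin(1)] linear_scale[OF lin(2)] linear_scale[OF lin(3)] linear_scale[OF lin(4)]
            blk_scale distrib_left)
    qed
    have \<phi>form: "(\<Sum>j<2 * n. \<Sum>k<2 * n. e j * \<phi> x j k * e k)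
        = (\<Sum>j<2 * n. \<Sum>k<2 * n. e j * blk (\<alpha> x) (\<beta> x) (\<gamma> x) j k * e k) + r * l x * (\<Sum>j<2 * n. (e j)\<^sup>2)" for x e
    proof -
      have "(\<Sum>j<2 * n. \<Sum>k<2 * n. e j * \<phi> x j k * e k)
        = (\<Sum>j<2 * n. \<Sum>k<2 * n. e j * blk (\<alpha> x) (\<beta> x) (\<gamma> x) j k * e k + (if j = k then r * l x * (e j)\<^sup>2 else 0))"
        by (intro sum.cong refl) (auto simp: \<phi>_def power2_eq_square algebra_simps)
      then show ?thesis by (simp add: sum.distrib sum_distrib_left)
    qed
    have \<phi>S: "0 \<le> (\<Sum>j<2 * n. \<Sum>k<2 * n. e j * \<phi> x j k * e k)" if x: "x \<in> S" for x e
      using gen[OF x]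
    proof
      assume "0 < l x"
      have "K x * (\<Sum>j<2 * n. (e j)\<^sup>2) \<le> r * l x * (\<Sum>j<2 * n. (e j)\<^sup>2)"
        using r[OF x \<open>0 < l x\<close>] by (intro mult_right_mono sum_nonneg) auto
      then show ?thesis
        using form_bound[where s = "2 * n" and y = e and b = "blk (\<alpha> x) (\<beta> x) (\<gamma> x)"] unfolding \<phi>form K_def by linarith
    next
      assume "l x = 0 \<and> (\<alpha> x, \<beta> x, \<gamma> x) \<in> convex_cone hull G"
      then show ?thesis using hullG[of "(\<alpha> x, \<beta> x, \<gamma> x)"] unfolding \<phi>form by (simp add: psd_def)
    qed
    have \<phi>C: "0 \<le> (\<Sum>j<2 * n. \<Sum>k<2 * n. e j * \<phi> x j k * e k)" if "x \<in> C" for x e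
    proof -
      let ?P = "{x. 0 \<le> (\<Sum>j<2 * n. \<Sum>k<2 * n. e j * \<phi> x j k * e k)}"
      have "convex_cone ?P"
        unfolding convex_cone_iff
      proof (intro conjI ballI allI impI)
        show "0 \<in> ?P" by (simp add: linear_0[OF \<phi>lin])
      next
        fix p q assume "p \<in> ?P" "q \<in> ?P"
        then show "p + q \<in> ?P" by (simp add: linear_add[OF \<phi>lin] distrib_left distrib_right sum.distrib)
      next
        fix p and s :: real assume p: "p \<in> ?P" and s: "0 \<le> s"
        have "(\<Sum>j<2 * n. \<Sum>k<2 * n. e j * \<phi> (s *\<^sub>R p) j k * e k) = s * (\<Sum>j<2 * n. \<Sum>k<2 * n. e j * \<phi> p j k * e k)"
          by (simp add: linear_scale[OF \<phi>lin] sum_distrib_left mult_ac)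
        then show "s *\<^sub>R p \<in> ?P" using p s by simp
      qed
      then have "convex_cone hull S \<subseteq> ?P" using \<phi>S by (intro hull_minimal) auto
      then show ?thesis using that S(2) by blast
    qed
    have c0: "\<alpha> (c 0) = 1" "\<beta> (c 0) = - 1" "\<gamma> (c 0) = 1" "l (c 0) = 0"
      by (simp_all add: rel(1) linear_add[OF lin(1)] linear_diff[OF lin(1)] linear_add[OF lin(2)] linear_diff[OF lin(2)]
          linear_add[OF lin(3)] linear_diff[OF lin(3)] linear_add[OF lin(4)] linear_diff[OF lin(4)] c1 c2 c3 del: One_nat_def)
    have c4: "\<alpha> (c 4) = a" "\<beta> (c 4) = - 1" "\<gamma> (c 4) = b" "l (c 4) = 0"
      by (simp_all add: rel(2) linear_add[OF lin(1)] linear_diff[OF lin(1)] linear_scale[OF lin(1)]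
          linear_add[OF lin(2)] linear_diff[OF lin(2)] linear_scale[OF lin(2)]
          linear_add[OF lin(3)] linear_diff[OF lin(3)] linear_scale[OF lin(3)]
          linear_add[OF lin(4)] linear_diff[OF lin(4)] linear_scale[OF lin(4)] c1 c2 c3 del: One_nat_def)
    have \<phi>c: "\<phi> (c i) j k = blkc i j k" if "i < 5" for i j k
    proof -
      consider "i = 0" | "i = 1" | "i = 2" | "i = 3" | "i = 4" using \<open>i < 5\<close> by linarith
      then show ?thesis
        by cases (simp_all add: \<phi>_def blkc_def coef_def c0 c1 c2 c3 c4 del: One_nat_def)
    qed
    show ?thesis
    proof (rule not_subhomogeneous_criterion[where s = "2 * n" and c = c and N = nullv and \<phi> = \<phi>])
      show "d < 2 * n" by (simp add: n_def)
      show "c i \<in> C" if "i < 5" for i using that by (rule cC)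
      show "u \<in> C" by (rule u)
      show "c 0 = c 1 - c 2 + c 3" "c 4 = a *\<^sub>R c 1 - c 2 + b *\<^sub>R c 3" by (rule rel)+
      show "finite (nullv i)" for i by (rule finite_nullv)
      show "linear (\<lambda>v. \<phi> v j k)" for j k by (rule \<phi>lin)
      show "\<phi> v j k = \<phi> v k j" for v j k using blk_sym[of _ _ _ j k] by (simp add: \<phi>_def)
      show "0 \<le> (\<Sum>j<2 * n. \<Sum>k<2 * n. y j * \<phi> v j k * y k)" if "v \<in> C" for v y using that by (rule \<phi>C)
      show "(\<Sum>j<2 * n. \<Sum>k<2 * n. p j * \<phi> (c i) j k * p k) = 0" if "i < 5" "p \<in> nullv i" for i p
        using nullv_null[OF that] by (simp only: \<phi>c[OF that(1)])
      show "0 < (\<Sum>i<5. \<Sum>j<2 * n. \<phi> (c i) j j)"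
        using blkc_trace by (simp add: \<phi>c)
      show "ctrace (2 * n) B = 0" if "admissible (2 * n) a b B w" "\<exists>k<2 * n. w k \<noteq> 0" "defect (2 * n) nullv B = 0" for B w
        using that by (rule rigid)
    qed
  qed
  then show ?thesis by (simp add: subhomogeneous_def)
qed

subsection \<open>Consecutive rays of a three-dimensional cone\<close>

text \<open>\<open>X\<close>, \<open>Y\<close>, \<open>Z\<close> are functionals on the whole space
  that restrict to coordinates on the three-dimensional span of \<open>T\<close>. Irredundant
  generators of a pointed cone lie one on each extreme ray.\<close>

locale irredundant_cone =
  fixes T :: "'a::real_vector set" and X Y Z :: "'a \<Rightarrow> real"
  assumes lin: "linear X" "linear Y" "linear Z"
    and sep: "x \<in> span T \<Longrightarrow> X x = 0 \<Longrightarrow> Y x = 0 \<Longrightarrow> Z x = 0 \<Longrightarrow> x = 0"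
    and surj: "\<exists>x\<in>span T. X x = r1 \<and> Y x = r2 \<and> Z x = r3"
    and pointed: "x \<in> convex_cone hull T \<Longrightarrow> - x \<in> convex_cone hull T \<Longrightarrow> x = 0"
    and irredundant: "t \<in> T \<Longrightarrow> t \<notin> convex_cone hull (T - {t})"
begin

text \<open>Determinant of the coordinate vectors, used as an orientation.\<close>

definition D :: "'a \<Rightarrow> 'a \<Rightarrow> 'a \<Rightarrow> real" where
  "D x y z = X x * (Y y * Z z - Z y * Y z) - Y x * (X y * Z z - Z y * X z) + Z x * (X y * Y z - Y y * X z)"

lemmas lin_simps = linear_add[OF lin(1)] linear_add[OF lin(2)] linear_add[OF lin(3)]
  linear_diff[OF lin(1)] linear_diff[OF lin(2)] linear_diff[OF lin(3)]
  linear_scale[OF lin(1)] linear_scale[OF lin(2)] linear_scale[OF lin(3)]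

lemma D_add: "D (x + x') y z = D x y z + D x' y z" "D x (y + y') z = D x y z + D x y' z" "D x y (z + z') = D x y z + D x y z'"
  by (simp_all add: D_def lin_simps algebra_simps)

lemma D_diff: "D (x - x') y z = D x y z - D x' y z" "D x (y - y') z = D x y z - D x y' z" "D x y (z - z') = D x y z - D x y z'"
  by (simp_all add: D_def lin_simps algebra_simps)

lemma D_scale: "D (r *\<^sub>R x) y z = r * D x y z" "D x (r *\<^sub>R y) z = r * D x y z" "D x y (r *\<^sub>R z) = r * D x y z"
  by (simp_all add: D_def lin_simps algebra_simps)

lemma D_same: "D x x z = 0" "D x z x = 0" "D z x x = 0"
  by (simp_all add: D_def algebra_simps)

lemma D_swap: "D y x z = - D x y z" "D x z y = - D x y z"
  by (simp_all add: D_def algebra_simps)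

lemma D_cycle: "D x y z = D y z x"
  by (simp add: D_def algebra_simps)

lemma cramer:
  assumes "p \<in> span T" "q \<in> span T" "r \<in> span T" "s \<in> span T"
  shows "D q r s *\<^sub>R p - D p r s *\<^sub>R q + D p q s *\<^sub>R r - D p q r *\<^sub>R s = 0"
proof (rule sep)
  show "D q r s *\<^sub>R p - D p r s *\<^sub>R q + D p q s *\<^sub>R r - D p q r *\<^sub>R s \<in> span T"
    using assms by (intro span_diff span_add span_scale)
qed (simp_all add: lin_simps D_def algebra_simps)

text \<open>A generator expressed by nonnegative multiples of others would be redundant.\<close>

lemma relA:
  assumes "p \<in> T" "q \<in> T" "q \<noteq> p" "r \<in> T" "r \<noteq> p" "s \<in> T" "s \<noteq> p" "0 < x" "0 \<le> y" "0 \<le> z" "0 \<le> w"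
    and eq: "x *\<^sub>R p = y *\<^sub>R q + z *\<^sub>R r + w *\<^sub>R s"
  shows False
proof -
  have "(1 / x) *\<^sub>R (y *\<^sub>R q + z *\<^sub>R r + w *\<^sub>R s) \<in> convex_cone hull (T - {p})"
    using assms by (intro convex_cone_hull_mul convex_cone_hull_add hull_inc) auto
  moreover have "(1 / x) *\<^sub>R (y *\<^sub>R q + z *\<^sub>R r + w *\<^sub>R s) = p"
    using \<open>0 < x\<close> by (simp flip: eq)
  ultimately show False using irredundant \<open>p \<in> T\<close> by simp
qed

lemma nonzero: "t \<in> T \<Longrightarrow> t \<noteq> 0"
  using irredundant convex_cone_hull_contains_0 by blast

text \<open>A relation with all coefficients of one sign would put a line into the cone.\<close>

lemma relB:
  assumes "p \<in> T" "q \<in> T" "r \<in> T" "s \<in> T" "0 < x" "0 \<le> y" "0 \<le> z" "0 \<le> w"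
    and eq: "x *\<^sub>R p + y *\<^sub>R q + z *\<^sub>R r + w *\<^sub>R s = 0"
  shows False
proof -
  have "x *\<^sub>R p \<in> convex_cone hull T" "y *\<^sub>R q + z *\<^sub>R r + w *\<^sub>R s \<in> convex_cone hull T"
    using assms by (intro convex_cone_hull_mul convex_cone_hull_add hull_inc; simp)+
  moreover have "y *\<^sub>R q + z *\<^sub>R r + w *\<^sub>R s = - (x *\<^sub>R p)"
    using eq by (simp add: eq_neg_iff_add_eq_0 algebra_simps)
  ultimately have "x *\<^sub>R p = 0" using pointed[of "x *\<^sub>R p"] by simp
  then show False using nonzero[OF \<open>p \<in> T\<close>] \<open>0 < x\<close> by simp
qed

text \<open>Up to a global sign there are four sign patterns: all of one sign, against pointedness,
  or one generator on one side and two on the other, against irredundancy.\<close>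

lemma no_relation:
  assumes T: "p \<in> T" "q \<in> T" "r \<in> T" "p \<noteq> q" "p \<noteq> r" "q \<noteq> r"
    and eq: "x *\<^sub>R p + y *\<^sub>R q + z *\<^sub>R r = 0"
  shows "x = 0"
proof -
  have main: False if "0 < x" and eq: "x *\<^sub>R p + y *\<^sub>R q + z *\<^sub>R r = 0" for x y z
  proof -
    consider "0 \<le> y" "0 \<le> z" | "y \<le> 0" "z \<le> 0" | "y < 0" "0 < z" | "0 < y" "z < 0" by linarith
    then show False
    proof cases
      case 1
      show ?thesis by (rule relB[of p q r r x y z 0]) (use that 1 T in auto)
    next
      case 2
      have "x *\<^sub>R p = (- y) *\<^sub>R q + (- z) *\<^sub>R r + 0 *\<^sub>R r" using eq by (simp add: algebra_simps eq_neg_iff_add_eq_0)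
      then show ?thesis by (rule relA[rotated -1]) (use that 2 T in auto)
    next
      case 3
      have "(- y) *\<^sub>R q = x *\<^sub>R p + z *\<^sub>R r + 0 *\<^sub>R r" using eq by (simp add: algebra_simps neg_eq_iff_add_eq_0)
      then show ?thesis by (rule relA[rotated -1]) (use that 3 T in auto)
    next
      case 4
      have "(- z) *\<^sub>R r = x *\<^sub>R p + y *\<^sub>R q + 0 *\<^sub>R q" using eq by (simp add: algebra_simps neg_eq_iff_add_eq_0)
      then show ?thesis by (rule relA[rotated -1]) (use that 4 T in auto)
    qed
  qed
  show ?thesis
  proof (rule ccontr)
    assume "x \<noteq> 0"
    then consider "0 < x" | "0 < - x" by linarith
    then show False
    proof cases
      case 1
      then show ?thesis using main eq by blast
    next
      case 2
      have "(- x) *\<^sub>R p + (- y) *\<^sub>R q + (- z) *\<^sub>R r = - (x *\<^sub>R p + y *\<^sub>R q + z *\<^sub>R r)" by simp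
      then show ?thesis using main[OF 2, of "- y" "- z"] eq by simp
    qed
  qed
qed

text \<open>If the determinant vanished, Cramer's relation with any s would lose its s term, and
  \<open>no_relation\<close> would give \<open>D p q s = 0\<close>. For s with the cross product of
  p and q as coordinates this is its squared length, so p and q would be parallel, which
  \<open>no_relation\<close> excludes again.\<close>

lemma D_nonzero:
  assumes T: "p \<in> T" "q \<in> T" "r \<in> T" "p \<noteq> q" "p \<noteq> r" "q \<noteq> r"
  shows "D p q r \<noteq> 0"
proof
  assume 0: "D p q r = 0"
  have sp: "p \<in> span T" "q \<in> span T" "r \<in> span T" using T by (auto intro: span_base)
  obtain s where s: "s \<in> span T" "X s = Y p * Z q - Z p * Y q" "Y s = Z p * X q - X p * Z q" "Z s = X p * Y q - Y p * X q"
    using surj by blast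
  have "D q r s *\<^sub>R p + (- D p r s) *\<^sub>R q + D p q s *\<^sub>R r = 0"
    using cramer[OF sp s(1)] 0 by (simp add: algebra_simps)
  then have "D p q s *\<^sub>R r + D q r s *\<^sub>R p + (- D p r s) *\<^sub>R q = 0" by (simp add: algebra_simps)
  then have "D p q s = 0" by (rule no_relation[rotated -1]) (use T in auto)
  moreover have "D p q s = (X s)\<^sup>2 + (Y s)\<^sup>2 + (Z s)\<^sup>2"
    unfolding D_def s(2-4) by (simp add: power2_eq_square algebra_simps)
  ultimately have "(X s)\<^sup>2 + (Y s)\<^sup>2 + (Z s)\<^sup>2 = 0" by simp
  then have n: "X s = 0" "Y s = 0" "Z s = 0"
    by (smt (verit) zero_le_power2 power2_eq_iff zero_eq_power2)+
  have par: "W q *\<^sub>R p - W p *\<^sub>R q = 0" if "W \<in> {X, Y, Z}" for W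
  proof (rule sep)
    show "W q *\<^sub>R p - W p *\<^sub>R q \<in> span T" using sp by (intro span_diff span_scale)
  qed (use n s that in \<open>auto simp: lin_simps mult.commute\<close>)
  have "W p = 0" if "W \<in> {X, Y, Z}" for W
  proof -
    have "(- W p) *\<^sub>R q + W q *\<^sub>R p + 0 *\<^sub>R r = 0" using par[OF that] by (simp add: algebra_simps)
    then have "- W p = 0" by (rule no_relation[rotated -1]) (use T in auto)
    then show ?thesis by simp
  qed
  then have "p = 0" using sep[OF sp(1)] by simp
  then show False using nonzero T by blast
qed

section \<open>Cyclic order of the generators\<close>

context
  fixes e :: 'a
  assumes e: "e \<in> T"
begin

definition before :: "'a \<Rightarrow> 'a \<Rightarrow> bool" where "before i j \<longleftrightarrow> 0 < D e i j"

lemma before_total: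
  assumes "i \<in> T - {e}" "j \<in> T - {e}" "i \<noteq> j"
  shows "before i j \<or> before j i"
  using D_nonzero[of e i j] assms e D_swap(2)[of e i j] by (auto simp: before_def)

lemma before_asym: "before i j \<Longrightarrow> \<not> before j i"
  using D_swap(2)[of e i j] by (simp add: before_def)

text \<open>Otherwise i, j, k run in a cycle around e, and Cramer's rule writes
  \<open>D i j k\<close> times e as a positive combination of them. A positive factor contradicts
  irredundancy, any other pointedness.\<close>

lemma before_trans:
  assumes ijk: "i \<in> T - {e}" "j \<in> T - {e}" "k \<in> T - {e}" and b: "before i j" "before j k"
  shows "before i k"
proof (rule ccontr)
  assume "\<not> before i k"
  have "i \<noteq> k" using b before_asym by blast
  then have ki: "0 < D e k i" using before_total[OF ijk(1,3)] \<open>\<not> before i k\<close> by (simp add: before_def)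
  have sp: "e \<in> span T" "i \<in> span T" "j \<in> span T" "k \<in> span T" using ijk e by (auto intro: span_base)
  have eq: "D i j k *\<^sub>R e = D e j k *\<^sub>R i + D e k i *\<^sub>R j + D e i j *\<^sub>R k"
    using cramer[OF sp] D_swap(2)[of e k i] by (simp add: algebra_simps)
  show False
  proof (cases "0 < D i j k")
    case True
    show False by (rule relA[OF _ _ _ _ _ _ _ True _ _ _ eq]) (use ijk e b ki in \<open>auto simp: before_def\<close>)
  next
    case False
    have "D e k i *\<^sub>R j + D e j k *\<^sub>R i + D e i j *\<^sub>R k + (- D i j k) *\<^sub>R e = 0"
      using eq by (simp add: algebra_simps)
    then show False by (rule relB[rotated -1]) (use ijk e b ki False in \<open>auto simp: before_def\<close>)
  qed
qed

text \<open>Otherwise Cramer's rule makes j a nonnegative combination of e, i, k.\<close>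

lemma triple_pos:
  assumes ijk: "i \<in> T - {e}" "j \<in> T - {e}" "k \<in> T - {e}" and b: "before i j" "before j k"
  shows "0 < D i j k"
proof (rule ccontr)
  assume "\<not> 0 < D i j k"
  have ik: "before i k" using ijk b by (rule before_trans)
  have sp: "e \<in> span T" "i \<in> span T" "j \<in> span T" "k \<in> span T" using ijk e by (auto intro: span_base)
  have eq: "D e i k *\<^sub>R j = (- D i j k) *\<^sub>R e + D e j k *\<^sub>R i + D e i j *\<^sub>R k"
    using cramer[OF sp] by (simp add: algebra_simps)
  have ne: "i \<noteq> j" "k \<noteq> j" using b before_asym by blast+
  have "0 < D e i k" using ik by (simp add: before_def)
  then show False
    by (rule relA[OF _ _ _ _ _ _ _ _ _ _ _ eq, rotated 7]) (use ijk e b ne \<open>\<not> 0 < D i j k\<close> in \<open>auto simp: before_def\<close>)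
qed

lemma before_first:
  assumes "finite A" "A \<noteq> {}" "A \<subseteq> T - {e}"
  shows "\<exists>m\<in>A. \<forall>x\<in>A - {m}. before m x"
  using assms
proof (induction A rule: finite_ne_induct)
  case (insert x A)
  then obtain m where m: "m \<in> A" "\<forall>y\<in>A - {m}. before m y" by auto
  have mx: "m \<in> T - {e}" "x \<in> T - {e}" "m \<noteq> x" using insert m by auto
  from before_total[OF mx] show ?case
  proof
    assume "before m x"
    then show ?case using m by (intro bexI[of _ m]) auto
  next
    assume xm: "before x m"
    have "before x y" if "y \<in> A" for y
    proof (cases "y = m")
      case False
      then have "before m y" using m that by blast
      then show ?thesis using before_trans[OF mx(2,1) _ xm] that insert.prems by blast
    qed (use xm in simp)
    then show ?case by (intro bexI[of _ x]) auto
  qed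
qed auto

end

text \<open>r1 is arbitrary, and r2, ..., r5 are the first four rays after it in the order seen from
  r1. Consecutive ones span sides of the cone, so further rays are on the positive side of
  each.\<close>

lemma five_consecutive:
  assumes fin: "finite T" and card: "5 \<le> card T"
  obtains r1 r2 r3 r4 r5 where
    "r1 \<in> T" "r2 \<in> T" "r3 \<in> T" "r4 \<in> T" "r5 \<in> T"
    "0 < D r1 r2 r3" "0 < D r1 r2 r4" "0 < D r1 r2 r5" "0 < D r1 r3 r4" "0 < D r1 r4 r5"
    "0 < D r2 r3 r4" "0 < D r2 r4 r5" "0 < D r3 r4 r5"
    "\<And>t. t \<in> T \<Longrightarrow> t \<notin> {r1, r2, r3, r4, r5} \<Longrightarrow> 0 < D r1 r2 t \<and> 0 < D r2 r3 t \<and> 0 < D r3 r4 t \<and> 0 < D r4 r5 t"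
proof -
  obtain r1 where r1: "r1 \<in> T" using card by fastforce
  have pick: "\<exists>m\<in>A. \<forall>x\<in>A - {m}. before r1 m x" if "A \<subseteq> T - {r1}" "1 \<le> card A" for A
    by (rule before_first[OF r1]) (use that fin finite_subset in \<open>auto intro: finite_subset\<close>)
  have c1: "4 \<le> card (T - {r1})" using r1 card by (simp add: card_Diff_singleton)
  then obtain r2 where r2: "r2 \<in> T - {r1}" "\<forall>x\<in>T - {r1} - {r2}. before r1 r2 x"
    using pick[of "T - {r1}"] by auto
  have c2: "3 \<le> card (T - {r1} - {r2})" using r2(1) c1 by (simp only: card_Diff_singleton)
  then obtain r3 where r3: "r3 \<in> T - {r1} - {r2}" "\<forall>x\<in>T - {r1} - {r2} - {r3}. before r1 r3 x"
    using pick[of "T - {r1} - {r2}"] by auto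
  have c3: "2 \<le> card (T - {r1} - {r2} - {r3})" using r3(1) c2 by (simp only: card_Diff_singleton)
  then obtain r4 where r4: "r4 \<in> T - {r1} - {r2} - {r3}" "\<forall>x\<in>T - {r1} - {r2} - {r3} - {r4}. before r1 r4 x"
    using pick[of "T - {r1} - {r2} - {r3}"] by auto
  have c4: "1 \<le> card (T - {r1} - {r2} - {r3} - {r4})" using r4(1) c3 by (simp only: card_Diff_singleton)
  then obtain r5 where r5: "r5 \<in> T - {r1} - {r2} - {r3} - {r4}" "\<forall>x\<in>T - {r1} - {r2} - {r3} - {r4} - {r5}. before r1 r5 x"
    using pick[of "T - {r1} - {r2} - {r3} - {r4}"] by auto
  have b: "before r1 r2 r3" "before r1 r2 r4" "before r1 r2 r5" "before r1 r3 r4" "before r1 r3 r5" "before r1 r4 r5"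
    using r2(2) r3 r4 r5 by auto
  have mem: "r2 \<in> T - {r1}" "r3 \<in> T - {r1}" "r4 \<in> T - {r1}" "r5 \<in> T - {r1}" using r2 r3 r4 r5 by auto
  show ?thesis
  proof (rule that[of r1 r2 r3 r4 r5])
    show "r1 \<in> T" "r2 \<in> T" "r3 \<in> T" "r4 \<in> T" "r5 \<in> T" using r1 mem by auto
    show "0 < D r1 r2 r3" "0 < D r1 r2 r4" "0 < D r1 r2 r5" "0 < D r1 r3 r4" "0 < D r1 r4 r5"
      using b by (simp_all add: before_def[OF r1])
    show "0 < D r2 r3 r4" by (rule triple_pos[OF r1 mem(1,2,3) b(1,4)])
    show "0 < D r2 r4 r5" by (rule triple_pos[OF r1 mem(1,3,4) b(2,6)])
    show "0 < D r3 r4 r5" by (rule triple_pos[OF r1 mem(2,3,4) b(4,6)])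
    fix t assume t: "t \<in> T" "t \<notin> {r1, r2, r3, r4, r5}"
    then have tb: "before r1 r2 t" "before r1 r3 t" "before r1 r4 t" "before r1 r5 t"
      using r2(2) r3(2) r4(2) r5(2) by auto
    have tm: "t \<in> T - {r1}" using t by simp
    show "0 < D r1 r2 t \<and> 0 < D r2 r3 t \<and> 0 < D r3 r4 t \<and> 0 < D r4 r5 t"
      using tb(1) triple_pos[OF r1 mem(1,2) tm b(1) tb(2)] triple_pos[OF r1 mem(2,3) tm b(4) tb(3)]
        triple_pos[OF r1 mem(3,4) tm b(6) tb(4)]
      by (simp add: before_def[OF r1])
  qed
qed

text \<open>Cramer's rule for r1 in terms of r2, r3, r4 has signs +, -, +; absorbing the moduli into
  c1, c2, c3 gives the first relation, and scaling r5 to coefficient -1 at c2 gives the second. The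
  rest are signs of determinants: a < 1 from (r1, r4, r5), b > 1 from (r1, r2, r5), the pentagonal
  conditions from the sides of the cone.\<close>

lemma pentagon_exists:
  assumes fin: "finite T" and card: "5 \<le> card T"
  shows "\<exists>(c :: nat \<Rightarrow> 'a) a b \<alpha> \<beta> \<gamma>. (\<forall>i<5. c i \<in> convex_cone hull T) \<and>
    c 0 = c 1 - c 2 + c 3 \<and> c 4 = a *\<^sub>R c 1 - c 2 + b *\<^sub>R c 3 \<and> 0 < a \<and> a < 1 \<and> 1 < b \<and>
    linear \<alpha> \<and> linear \<beta> \<and> linear \<gamma> \<and>
    \<alpha> (c 1) = 1 \<and> \<beta> (c 1) = 0 \<and> \<gamma> (c 1) = 0 \<and>
    \<alpha> (c 2) = 0 \<and> \<beta> (c 2) = 1 \<and> \<gamma> (c 2) = 0 \<and>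
    \<alpha> (c 3) = 0 \<and> \<beta> (c 3) = 0 \<and> \<gamma> (c 3) = 1 \<and>
    (\<forall>t\<in>T. pentagonal a b (\<alpha> t, \<beta> t, \<gamma> t))"
proof -
  obtain r1 r2 r3 r4 r5 where rT: "r1 \<in> T" "r2 \<in> T" "r3 \<in> T" "r4 \<in> T" "r5 \<in> T"
    and D: "0 < D r1 r2 r3" "0 < D r1 r2 r4" "0 < D r1 r2 r5" "0 < D r1 r3 r4" "0 < D r1 r4 r5"
      "0 < D r2 r3 r4" "0 < D r2 r4 r5" "0 < D r3 r4 r5"
    and Dt: "\<And>t. t \<in> T \<Longrightarrow> t \<notin> {r1, r2, r3, r4, r5} \<Longrightarrow> 0 < D r1 r2 t \<and> 0 < D r2 r3 t \<and> 0 < D r3 r4 t \<and> 0 < D r4 r5 t"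
    using five_consecutive[OF fin card] by metis
  define \<Delta> where "\<Delta> = D r2 r3 r4"
  define x where "x = D r1 r3 r4 / \<Delta>"
  define y where "y = D r1 r2 r4 / \<Delta>"
  define z where "z = D r1 r2 r3 / \<Delta>"
  have xyz: "0 < x" "0 < y" "0 < z" using D by (simp_all add: x_def y_def z_def \<Delta>_def)
  define c1 where "c1 = x *\<^sub>R r2"
  define c2 where "c2 = y *\<^sub>R r3"
  define c3 where "c3 = z *\<^sub>R r4"
  define E where "E = D c1 c2 c3"
  have E: "0 < E" using D xyz by (simp add: E_def c1_def c2_def c3_def D_scale)
  \<comment> \<open>Cramer's rule for the basis dual to c1, c2, c3, extended to the whole
    space.\<close>
  define \<alpha> where "\<alpha> p = D p c2 c3 / E" for p
  define \<beta> where "\<beta> p = D c1 p c3 / E" for p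
  define \<gamma> where "\<gamma> p = D c1 c2 p / E" for p
  have lins: "linear \<alpha>" "linear \<beta>" "linear \<gamma>"
    by (auto intro!: linearI simp: \<alpha>_def \<beta>_def \<gamma>_def D_add D_scale add_divide_distrib)
  have sp: "r1 \<in> span T" "r2 \<in> span T" "r3 \<in> span T" "r4 \<in> span T" "r5 \<in> span T" using rT by (auto intro: span_base)
  have spc: "c1 \<in> span T" "c2 \<in> span T" "c3 \<in> span T" unfolding c1_def c2_def c3_def using sp by (auto intro: span_scale)
  have dec: "p = \<alpha> p *\<^sub>R c1 + \<beta> p *\<^sub>R c2 + \<gamma> p *\<^sub>R c3" if "p \<in> span T" for p
  proof -
    have "E *\<^sub>R p = D p c2 c3 *\<^sub>R c1 + D c1 p c3 *\<^sub>R c2 + D c1 c2 p *\<^sub>R c3"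
      using cramer[OF that spc] D_swap(1)[of c1 p c3] D_cycle[of p c1 c2] by (simp add: E_def algebra_simps)
    then have "(1 / E) *\<^sub>R (E *\<^sub>R p) = (1 / E) *\<^sub>R (D p c2 c3 *\<^sub>R c1 + D c1 p c3 *\<^sub>R c2 + D c1 c2 p *\<^sub>R c3)" by simp
    then show ?thesis using E by (simp add: scaleR_add_right \<alpha>_def \<beta>_def \<gamma>_def)
  qed
  have co1: "\<alpha> c1 = 1" "\<beta> c1 = 0" "\<gamma> c1 = 0" and co2: "\<alpha> c2 = 0" "\<beta> c2 = 1" "\<gamma> c2 = 0"
    and co3: "\<alpha> c3 = 0" "\<beta> c3 = 0" "\<gamma> c3 = 1"
    using E by (simp_all add: \<alpha>_def \<beta>_def \<gamma>_def D_same E_def[symmetric])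
  have r1: "r1 = c1 - c2 + c3"
  proof -
    have "\<Delta> *\<^sub>R r1 = D r1 r3 r4 *\<^sub>R r2 - D r1 r2 r4 *\<^sub>R r3 + D r1 r2 r3 *\<^sub>R r4"
      using cramer[OF sp(1,2,3,4)] by (simp add: \<Delta>_def algebra_simps)
    then have "(1 / \<Delta>) *\<^sub>R (\<Delta> *\<^sub>R r1) = (1 / \<Delta>) *\<^sub>R (D r1 r3 r4 *\<^sub>R r2 - D r1 r2 r4 *\<^sub>R r3 + D r1 r2 r3 *\<^sub>R r4)" by simp
    then show ?thesis using D(6)
      by (simp add: scaleR_add_right scaleR_diff_right c1_def c2_def c3_def x_def y_def z_def \<Delta>_def)
  qed
  have pos_iff: "0 < e * r / k \<longleftrightarrow> 0 < r" if "0 < e" "0 < k" for e r k :: real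
    using that by (simp add: zero_less_divide_iff zero_less_mult_iff)
  have prods: "0 < x * y" "0 < y * z" "0 < x * z" using xyz by simp_all
  have Dx: "D r2 r3 p = E * \<gamma> p / (x * y)" "D r3 r4 p = E * \<alpha> p / (y * z)" "D r2 r4 p = - (E * \<beta> p / (x * z))" for p
  proof -
    show "D r2 r3 p = E * \<gamma> p / (x * y)" using E xyz by (simp add: \<gamma>_def c1_def c2_def D_scale)
    show "D r3 r4 p = E * \<alpha> p / (y * z)" using E xyz D_cycle[of p r3 r4] by (simp add: \<alpha>_def c2_def c3_def D_scale)
    show "D r2 r4 p = - (E * \<beta> p / (x * z))" using E xyz D_swap(2)[of r2 p r4] by (simp add: \<beta>_def c1_def c3_def D_scale)
  qed
  \<comment> \<open>The side through r1 and r2 is \<beta> + \<gamma> = 0, and the one through r4 and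
    r5 is \<alpha> + a \<beta> = 0. They give the bounds - y < w and - y * a < x in
    \<open>pentagonal\<close>.\<close>
  have D12: "D r1 r2 p = E * (\<beta> p + \<gamma> p) / x" if "p \<in> span T" for p
  proof -
    have "x * D r1 r2 p = D (c1 - c2 + c3) c1 p" by (simp add: r1 c1_def D_scale)
    also have "\<dots> = D c3 c1 p + D c1 c2 p"
      using D_swap(1)[of c2 c1 p] by (simp add: D_add D_diff D_same)
    also have "D c3 c1 p = D c1 p c3" using D_cycle[of c1 p c3] D_cycle[of c3 c1 p] by simp
    finally show ?thesis using E xyz by (simp add: \<beta>_def \<gamma>_def field_simps)
  qed
  \<comment> \<open>\<open>D r2 r4 r5\<close> is positive: r5 lies beyond the plane of r2 and r4,
    where the coordinate at c2 is negative.\<close>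
  define b' where "b' = - \<beta> r5"
  have b': "0 < b'"
    using D(7) pos_iff[OF E prods(3), of "- \<beta> r5"] by (simp add: Dx b'_def)
  define c4 where "c4 = (1 / b') *\<^sub>R r5"
  define a where "a = \<alpha> c4"
  define b where "b = \<gamma> c4"
  have r5: "r5 = b' *\<^sub>R c4" using b' by (simp add: c4_def)
  have "\<beta> c4 = (1 / b') * \<beta> r5" by (simp only: c4_def linear_scale[OF lins(2)] real_scaleR_def)
  then have bc4: "\<beta> c4 = - 1" using b' by (simp add: b'_def)
  have spc4: "c4 \<in> span T" unfolding c4_def using sp by (auto intro: span_scale)
  have c4: "c4 = a *\<^sub>R c1 - c2 + b *\<^sub>R c3" using dec[OF spc4] by (simp add: bc4 a_def b_def)
  have a0: "0 < a"
  proof -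
    have "0 < \<alpha> r5" using D(8) unfolding Dx pos_iff[OF E prods(2)] .
    then show ?thesis using b' by (simp add: a_def c4_def linear_scale[OF lins(1)])
  qed
  have D45: "D r4 r5 p = b' * E * (\<alpha> p + a * \<beta> p) / z" if "p \<in> span T" for p
  proof -
    have "z * D r4 r5 p = b' * D c3 (a *\<^sub>R c1 - c2 + b *\<^sub>R c3) p" unfolding r5 c4[symmetric] by (simp add: c3_def D_scale)
    also have "\<dots> = b' * (a * D c3 c1 p - D c3 c2 p)" by (simp add: D_add D_diff D_scale D_same)
    also have "D c3 c1 p = D c1 p c3" using D_cycle[of c1 p c3] D_cycle[of c3 c1 p] by simp
    also have "D c3 c2 p = - D p c2 c3"
      using D_swap(1)[of c2 c3 p] D_cycle[of p c2 c3] by simp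
    finally show ?thesis using E xyz by (simp add: \<alpha>_def \<beta>_def field_simps)
  qed
  have b1: "1 < b"
  proof -
    have "0 < \<beta> r5 + \<gamma> r5" using D(3) unfolding D12[OF sp(5)] pos_iff[OF E xyz(1)] .
    also have "\<beta> r5 + \<gamma> r5 = b' * (b - 1)"
      by (simp add: r5 linear_scale[OF lins(2)] linear_scale[OF lins(3)] bc4 b_def algebra_simps)
    finally show ?thesis using b' by (simp add: zero_less_mult_iff)
  qed
  have a1: "a < 1"
  proof -
    have "0 < D r4 r5 r1" using D(5) D_cycle[of r1 r4 r5] by simp
    then have "0 < \<alpha> r1 + a * \<beta> r1" unfolding D45[OF sp(1)] pos_iff[OF mult_pos_pos[OF b' E] xyz(3)] .
    also have "\<alpha> r1 + a * \<beta> r1 = 1 - a"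
      by (simp add: r1 linear_add[OF lins(1)] linear_diff[OF lins(1)] linear_add[OF lins(2)] linear_diff[OF lins(2)] co1 co2 co3)
    finally show ?thesis by simp
  qed
  have pent: "pentagonal a b (\<alpha> t, \<beta> t, \<gamma> t)" if t: "t \<in> T" for t
  proof -
    have pos: "pentagonal a b (\<alpha> t, \<beta> t, \<gamma> t)" if "t \<in> {r2, r3, r4}"
    proof -
      have "r2 = (1 / x) *\<^sub>R c1" "r3 = (1 / y) *\<^sub>R c2" "r4 = (1 / z) *\<^sub>R c3" using xyz by (simp_all add: c1_def c2_def c3_def)
      then have "\<alpha> r2 = 1 / x" "\<beta> r2 = 0" "\<gamma> r2 = 0" "\<alpha> r3 = 0" "\<beta> r3 = 1 / y" "\<gamma> r3 = 0" "\<alpha> r4 = 0" "\<beta> r4 = 0" "\<gamma> r4 = 1 / z"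
        by (simp_all only: linear_scale[OF lins(1)] linear_scale[OF lins(2)] linear_scale[OF lins(3)] co1 co2 co3) simp_all
      then show ?thesis using that xyz by (auto simp: pentagonal_def)
    qed
    consider "t = r1" | "t \<in> {r2, r3, r4}" | "t = r5" | "t \<notin> {r1, r2, r3, r4, r5}" by blast
    then show ?thesis
    proof cases
      case 1
      have "\<alpha> r1 = 1" "\<beta> r1 = - 1" "\<gamma> r1 = 1"
        by (simp_all add: r1 linear_add[OF lins(1)] linear_diff[OF lins(1)] linear_add[OF lins(2)] linear_diff[OF lins(2)]
            linear_add[OF lins(3)] linear_diff[OF lins(3)] co1 co2 co3)
      then show ?thesis using 1 by (simp add: pentagonal_def)
    next
      case 2
      then show ?thesis by (rule pos)
    next
      case 3
      have "\<alpha> r5 = b' * a" "\<beta> r5 = - b'" "\<gamma> r5 = b' * b"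
        by (simp_all add: r5 linear_scale[OF lins(1)] linear_scale[OF lins(2)] linear_scale[OF lins(3)] bc4 a_def b_def)
      then show ?thesis using 3 b' a0 b1 by (simp add: pentagonal_def)
    next
      case 4
      have spt: "t \<in> span T" using t by (rule span_base)
      have "0 < \<beta> t + \<gamma> t" "0 < \<gamma> t" "0 < \<alpha> t" "0 < \<alpha> t + a * \<beta> t"
        using Dt[OF t 4] unfolding D12[OF spt] D45[OF spt] Dx pos_iff[OF E xyz(1)] pos_iff[OF E prods(1)]
          pos_iff[OF E prods(2)] pos_iff[OF mult_pos_pos[OF b' E] xyz(3)] by simp_all
      then show ?thesis by (simp add: pentagonal_def mult.commute)
    qed
  qed
  define c where "c i = (if i = 0 then r1 else if i = 1 then c1 else if i = 2 then c2 else if i = 3 then c3 else c4)" for i :: nat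
  have c: "c 0 = r1" "c 1 = c1" "c 2 = c2" "c 3 = c3" "c 4 = c4" by (simp_all add: c_def)
  have "c i \<in> convex_cone hull T" for i
    unfolding c_def c1_def c2_def c3_def c4_def using rT xyz b'
    by (simp add: hull_inc convex_cone_hull_mul)
  then show ?thesis
    by (intro exI[of _ c] exI[of _ a] exI[of _ b] exI[of _ \<alpha>] exI[of _ \<beta>] exI[of _ \<gamma>])
       (auto simp only: c r1[symmetric] c4[symmetric] a0 a1 b1 lins co1 co2 co3 pent)
qed

end

subsection \<open>Faces and face quotients\<close>

lemma irredundant_generators:
  assumes "finite S"
  shows "\<exists>T\<subseteq>S. convex_cone hull T = convex_cone hull S \<and> (\<forall>t\<in>T. t \<notin> convex_cone hull (T - {t}))"
  using assms
proof (induction S rule: finite_psubset_induct)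
  case (psubset S)
  show ?case
  proof (cases "\<forall>t\<in>S. t \<notin> convex_cone hull (S - {t})")
    case False
    then obtain t where t: "t \<in> S" "t \<in> convex_cone hull (S - {t})" by blast
    have "S \<subseteq> convex_cone hull (S - {t})"
      using t hull_subset[of "S - {t}" convex_cone] by blast
    then have "convex_cone hull S \<subseteq> convex_cone hull (S - {t})"
      by (intro hull_minimal convex_cone_convex_cone_hull)
    moreover have "convex_cone hull (S - {t}) \<subseteq> convex_cone hull S" by (rule hull_mono) blast
    ultimately have eq: "convex_cone hull (S - {t}) = convex_cone hull S" by blast
    have "S - {t} \<subset> S" using t by blast
    from psubset.IH[OF this] obtain T where "T \<subseteq> S - {t}" "convex_cone hull T = convex_cone hull (S - {t})"
      "\<forall>t\<in>T. t \<notin> convex_cone hull (T - {t})" by blast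
    then show ?thesis using eq by (intro exI[of _ T]) auto
  qed blast
qed

text \<open>The implication from membership in F to membership in the hull of T \<inter> F holds on
  generators; it survives sums by the face property and scaling because F is a cone.\<close>

lemma cone_face_hull:
  fixes T :: "'a::real_vector set"
  assumes F: "cone_face F (convex_cone hull T)"
  shows "F = convex_cone hull (T \<inter> F)"
proof
  have FC: "convex_cone F" "F \<subseteq> convex_cone hull T"
    and face: "\<And>x y. x \<in> convex_cone hull T \<Longrightarrow> y \<in> convex_cone hull T \<Longrightarrow> x + y \<in> F \<Longrightarrow> x \<in> F \<and> y \<in> F"
    using F by (auto simp: cone_face_def)
  show "convex_cone hull (T \<inter> F) \<subseteq> F" using FC(1) by (intro hull_minimal) auto
  let ?W = "{x \<in> convex_cone hull T. x \<in> F \<longrightarrow> x \<in> convex_cone hull (T \<inter> F)}"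
  have "convex_cone ?W"
  proof (rule convex_cone_iff[THEN iffD2], intro conjI ballI allI impI)
    show "0 \<in> ?W" by (simp add: convex_cone_hull_contains_0)
  next
    fix x y assume "x \<in> ?W" "y \<in> ?W"
    then show "x + y \<in> ?W" using face[of x y] by (auto intro: convex_cone_hull_add)
  next
    fix x and r :: real assume x: "x \<in> ?W" and r: "0 \<le> r"
    show "r *\<^sub>R x \<in> ?W"
    proof (cases "r = 0")
      case True
      then show ?thesis by (simp add: convex_cone_hull_contains_0)
    next
      case False
      have "x \<in> F" if "r *\<^sub>R x \<in> F"
        using convex_cone_scaleR[OF FC(1) _ that, of "1 / r"] r False by simp
      then show ?thesis using x r by (auto intro: convex_cone_hull_mul)
    qed
  qed
  then have "convex_cone hull T \<subseteq> ?W" by (intro hull_minimal) (auto intro: hull_inc)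
  then show "F \<subseteq> convex_cone hull (T \<inter> F)" using FC(2) by blast
qed

text \<open>By \<open>cone_face_hull\<close> an extreme ray contains a nonzero generator. Being
  one-dimensional in a pointed cone, it consists of the nonnegative multiples of that generator, so
  the choice of one is injective.\<close>

lemma card_extreme_rays_le:
  fixes T :: "'a::real_vector set"
  assumes fin: "finite T"
    and pointed: "\<And>x. x \<in> convex_cone hull T \<Longrightarrow> - x \<in> convex_cone hull T \<Longrightarrow> x = 0"
  shows "card (extreme_rays (convex_cone hull T)) \<le> card T"
proof -
  let ?E = "extreme_rays (convex_cone hull T)"
  have ex: "\<exists>t. t \<in> T \<inter> R \<and> t \<noteq> 0" if "R \<in> ?E" for R
  proof (rule ccontr)
    assume *: "\<not> ?thesis"
    have R: "cone_face R (convex_cone hull T)" "dim (span R) = 1" using that by (auto simp: extreme_rays_def)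
    have "R \<subseteq> {0}"
    proof -
      have "T \<inter> R \<subseteq> {0}" using * by auto
      then have "convex_cone hull (T \<inter> R) \<subseteq> {0}" by (intro hull_minimal) (auto simp: convex_cone_iff)
      then show ?thesis using cone_face_hull[OF R(1)] by simp
    qed
    then have "span R \<subseteq> span {}" using span_mono[of R "{0}"] by (simp add: span_insert_0)
    then have "dim (span R) \<le> card ({} :: 'a set)" by (intro dim_le_card) auto
    then show False using R(2) by simp
  qed
  then have "\<exists>g. \<forall>R\<in>?E. g R \<in> T \<inter> R \<and> g R \<noteq> 0" by (intro bchoice) blast
  then obtain g where g: "\<And>R. R \<in> ?E \<Longrightarrow> g R \<in> T \<inter> R \<and> g R \<noteq> 0" by blast
  have ray: "R = {k *\<^sub>R g R | k. 0 \<le> k}" if "R \<in> ?E" for R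
  proof
    have R: "cone_face R (convex_cone hull T)" "dim (span R) = 1" using that by (auto simp: extreme_rays_def)
    have cc: "convex_cone R" "R \<subseteq> convex_cone hull T" using R by (auto simp: cone_face_def)
    have gR: "g R \<in> R" "g R \<noteq> 0" using g[OF that] by auto
    show "{k *\<^sub>R g R | k. 0 \<le> k} \<subseteq> R" using cc gR by (auto intro: convex_cone_scaleR)
    show "R \<subseteq> {k *\<^sub>R g R | k. 0 \<le> k}"
    proof
      fix x assume x: "x \<in> R"
      obtain k where k: "x = k *\<^sub>R g R"
      proof -
        obtain B where B: "B \<subseteq> R" "independent B" "R \<subseteq> span B" "card B = dim R" using basis_exists by blast
        have "card B = 1" using B(4) R(2) by (simp add: dim_span)
        then obtain b where b: "B = {b}" by (auto simp: card_1_singleton_iff)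
        have "x \<in> span {b}" "g R \<in> span {b}" using B(3) x gR by (auto simp: b)
        then obtain p q where pq: "x = p *\<^sub>R b" "g R = q *\<^sub>R b" unfolding span_singleton by blast
        then have "q \<noteq> 0" using gR by auto
        then have "x = (p / q) *\<^sub>R g R" using pq by simp
        then show ?thesis using that by blast
      qed
      have "0 \<le> k"
      proof (rule ccontr)
        assume "\<not> 0 \<le> k"
        then have "(- 1 / k) *\<^sub>R x \<in> R" using cc x by (intro convex_cone_scaleR) (auto simp: field_simps)
        moreover have "(- 1 / k) *\<^sub>R x = - g R" using k \<open>\<not> 0 \<le> k\<close> by simp
        ultimately have "- g R \<in> convex_cone hull T" "g R \<in> convex_cone hull T" using cc gR by auto
        then show False using pointed gR by blast
      qed
      then show "x \<in> {k *\<^sub>R g R | k. 0 \<le> k}" using k by blast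
    qed
  qed
  have "inj_on g ?E"
  proof (rule inj_onI)
    fix R R' assume "R \<in> ?E" "R' \<in> ?E" "g R = g R'"
    then show "R = R'" using ray[of R] ray[of R'] by simp
  qed
  moreover have "g ` ?E \<subseteq> T" using g by blast
  ultimately show ?thesis using fin by (metis card_inj_on_le)
qed

text \<open>An isomorphism of the span with \<open>real^3\<close> supplies the coordinates;
  \<open>G\<close> is the image of the irredundant generators under (\<alpha>, \<beta>,
  \<gamma>).\<close>

lemma pentagon_of_cone:
  fixes S :: "'a::euclidean_space set"
  assumes fin: "finite S" and dim: "dim (span (convex_cone hull S)) = 3"
    and card: "5 \<le> card (extreme_rays (convex_cone hull S))"
    and pointed: "\<forall>x\<in>convex_cone hull S. - x \<in> convex_cone hull S \<longrightarrow> x = 0"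
  shows "\<exists>(c :: nat \<Rightarrow> 'a) a b \<alpha> \<beta> \<gamma> G. (\<forall>i<5. c i \<in> convex_cone hull S) \<and>
    c 0 = c 1 - c 2 + c 3 \<and> c 4 = a *\<^sub>R c 1 - c 2 + b *\<^sub>R c 3 \<and> 0 < a \<and> a < 1 \<and> 1 < b \<and>
    linear \<alpha> \<and> linear \<beta> \<and> linear \<gamma> \<and>
    \<alpha> (c 1) = 1 \<and> \<beta> (c 1) = 0 \<and> \<gamma> (c 1) = 0 \<and>
    \<alpha> (c 2) = 0 \<and> \<beta> (c 2) = 1 \<and> \<gamma> (c 2) = 0 \<and>
    \<alpha> (c 3) = 0 \<and> \<beta> (c 3) = 0 \<and> \<gamma> (c 3) = 1 \<and>
    finite G \<and> (\<forall>z\<in>G. pentagonal a b z) \<and>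
    (\<forall>x\<in>convex_cone hull S. (\<alpha> x, \<beta> x, \<gamma> x) \<in> convex_cone hull G)"
proof -
  obtain T where T: "T \<subseteq> S" "convex_cone hull T = convex_cone hull S"
    "\<forall>t\<in>T. t \<notin> convex_cone hull (T - {t})"
    using irredundant_generators[OF fin] by blast
  have finT: "finite T" using T fin finite_subset by blast
  have "5 \<le> card T"
    using card_extreme_rays_le[of T] card pointed finT by (simp add: T(2))
  have "convex_cone hull T \<subseteq> span T"
    by (intro hull_minimal) (auto simp: span_base convex_cone_iff span_zero span_add span_scale)
  then have "span (convex_cone hull T) = span T"
    by (metis hull_subset span_mono span_span subset_antisym)
  then have dimT: "dim (span T) = 3" using dim T(2) by simp
  obtain f :: "'a \<Rightarrow> real^3" where f: "linear f" "f ` span T = UNIV" "inj_on f (span T)"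
    using subspace_isomorphism[OF subspace_span[of T] subspace_UNIV[where 'a = "real^3"]] dimT by auto
  define X where "X x = f x $ 1" for x
  define Y where "Y x = f x $ 2" for x
  define Z where "Z x = f x $ 3" for x
  have "irredundant_cone T X Y Z"
  proof (rule irredundant_cone.intro)
    show "linear X" "linear Y" "linear Z"
      using f(1) by (auto intro!: linearI simp: X_def Y_def Z_def linear_add linear_scale)
    show "x = 0" if "x \<in> span T" "X x = 0" "Y x = 0" "Z x = 0" for x
    proof -
      have "f x = 0" using that by (simp add: Finite_Cartesian_Product.vec_eq_iff forall_3 X_def Y_def Z_def)
      then have "f x = f 0" by (simp add: linear_0[OF f(1)])
      then show ?thesis using f(3) that(1) by (metis inj_onD span_zero)
    qed
    show "\<exists>x\<in>span T. X x = r1 \<and> Y x = r2 \<and> Z x = r3" for r1 r2 r3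
    proof -
      have "(vector [r1, r2, r3] :: real^3) \<in> f ` span T" using f(2) by simp
      then obtain x where "x \<in> span T" "f x = vector [r1, r2, r3]" by auto
      then show ?thesis by (intro bexI[of _ x]) (simp_all add: X_def Y_def Z_def vector_3)
    qed
    show "x = 0" if "x \<in> convex_cone hull T" "- x \<in> convex_cone hull T" for x
      using pointed that by (simp add: T(2))
    show "t \<notin> convex_cone hull (T - {t})" if "t \<in> T" for t using T(3) that by blast
  qed
  then interpret irredundant_cone T X Y Z .
  obtain c :: "nat \<Rightarrow> 'a" and a b \<alpha> \<beta> \<gamma> where c: "\<forall>i<5. c i \<in> convex_cone hull T"
    "c 0 = c 1 - c 2 + c 3" "c 4 = a *\<^sub>R c 1 - c 2 + b *\<^sub>R c 3" "0 < a" "a < 1" "1 < b"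
    and lins: "linear \<alpha>" "linear \<beta>" "linear \<gamma>"
    and co: "\<alpha> (c 1) = 1" "\<beta> (c 1) = 0" "\<gamma> (c 1) = 0" "\<alpha> (c 2) = 0" "\<beta> (c 2) = 1" "\<gamma> (c 2) = 0"
      "\<alpha> (c 3) = 0" "\<beta> (c 3) = 0" "\<gamma> (c 3) = 1"
    and pent: "\<forall>t\<in>T. pentagonal a b (\<alpha> t, \<beta> t, \<gamma> t)"
    using pentagon_exists[OF finT \<open>5 \<le> card T\<close>] by (elim exE conjE) (rule that)
  let ?h = "\<lambda>x. (\<alpha> x, \<beta> x, \<gamma> x)"
  have "linear ?h"
    by (intro linearI) (simp_all add: linear_add[OF lins(1)] linear_add[OF lins(2)] linear_add[OF lins(3)]
      linear_scale[OF lins(1)] linear_scale[OF lins(2)] linear_scale[OF lins(3)])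
  then have "convex_cone hull (?h ` T) = ?h ` (convex_cone hull T)" by (rule convex_cone_hull_linear_image)
  then have "\<forall>x\<in>convex_cone hull S. ?h x \<in> convex_cone hull (?h ` T)" using T(2) by auto
  moreover have "finite (?h ` T)" "\<forall>z\<in>?h ` T. pentagonal a b z" using finT pent by auto
  ultimately show ?thesis
    using c lins co unfolding T(2)
    by (intro exI[of _ c] exI[of _ a] exI[of _ b] exI[of _ \<alpha>] exI[of _ \<beta>] exI[of _ \<gamma>] exI[of _ "?h ` T"] conjI)
qed

text \<open>Faces of polyhedra are exposed, and the exposing hyperplane passes through 0 because a
  cone face contains 0.\<close>

lemma exposing_functional:
  fixes C :: "'a::euclidean_space set"
  assumes fin: "finite S" and C: "C = convex_cone hull S" and F: "cone_face F C"
  shows "\<exists>l :: 'a \<Rightarrow> real. linear l \<and> (\<forall>x\<in>C. 0 \<le> l x) \<and> (\<forall>x\<in>C. l x = 0 \<longleftrightarrow> x \<in> F)"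
proof -
  have cone: "convex_cone C" unfolding C by (rule convex_cone_convex_cone_hull)
  have Fc: "F \<subseteq> C" "convex_cone F" and face: "\<And>x y. x \<in> C \<Longrightarrow> y \<in> C \<Longrightarrow> x + y \<in> F \<Longrightarrow> x \<in> F \<and> y \<in> F"
    using F by (auto simp: cone_face_def)
  \<comment> \<open>The endpoints of a segment are scaled by the convex weights, and back after the
    face property has been applied.\<close>
  have "F face_of C"
    unfolding face_of_def
  proof (intro conjI ballI impI)
    show "F \<subseteq> C" by (rule Fc)
    show "convex F" using Fc(2) by (simp add: convex_cone_def)
    fix p q x assume "p \<in> C" "q \<in> C" "x \<in> F" "x \<in> open_segment p q"
    then obtain r where r: "0 < r" "r < 1" "x = (1 - r) *\<^sub>R p + r *\<^sub>R q" by (auto simp: in_segment)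
    have "(1 - r) *\<^sub>R p \<in> C" "r *\<^sub>R q \<in> C" using \<open>p \<in> C\<close> \<open>q \<in> C\<close> r cone by (auto intro: convex_cone_scaleR)
    then have "(1 - r) *\<^sub>R p \<in> F" "r *\<^sub>R q \<in> F" using face r(3) \<open>x \<in> F\<close> by blast+
    then have "(1 / (1 - r)) *\<^sub>R ((1 - r) *\<^sub>R p) \<in> F" "(1 / r) *\<^sub>R (r *\<^sub>R q) \<in> F"
      using r by (auto intro!: convex_cone_scaleR[OF Fc(2)] simp del: scaleR_scaleR)
    then show "p \<in> F" "q \<in> F" using r by simp_all
  qed
  moreover have "polyhedron C" unfolding C by (rule polyhedron_convex_cone_hull[OF fin])
  ultimately have "F exposed_face_of C" using exposed_face_of_polyhedron by blast
  then obtain w r where w: "C \<subseteq> {x. w \<bullet> x \<le> r}" "F = C \<inter> {x. w \<bullet> x = r}"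
    by (auto simp: exposed_face_of_def)
  have "0 \<in> F" using Fc(2) by (rule convex_cone_contains_0)
  then have "r = 0" using w(2) by auto
  then show ?thesis using w
    by (intro exI[of _ "\<lambda>x. - (w \<bullet> x)"]) (auto intro!: linearI simp: inner_add_right)
qed

text \<open>The exposing functional of F serves as \<open>l\<close>: positive on generators off F,
  zero on those in F, whose coordinates lie in the hull of \<open>G\<close>.\<close>

lemma face_case:
  fixes C :: "'a::euclidean_space set"
  assumes fin: "finite S" and C: "C = convex_cone hull S" and u: "u \<in> C"
    and pointed: "\<And>x. x \<in> C \<Longrightarrow> - x \<in> C \<Longrightarrow> x = 0"
    and F: "cone_face F C" "dim (span F) = 3" "5 \<le> card (extreme_rays F)"
  shows "\<not> subhomogeneous TYPE('b::comm_cstar_algebra) (min_cone C) u"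
proof -
  have hullF: "convex_cone hull (S \<inter> F) = F" using cone_face_hull F(1) C by metis
  have FC: "F \<subseteq> C" using F(1) by (simp add: cone_face_def)
  obtain l :: "'a \<Rightarrow> real" where l: "linear l" "\<And>x. x \<in> C \<Longrightarrow> 0 \<le> l x" "\<And>x. x \<in> C \<Longrightarrow> l x = 0 \<longleftrightarrow> x \<in> F"
    using exposing_functional[OF fin C F(1)] by blast
  have pF: "\<forall>x\<in>F. - x \<in> F \<longrightarrow> x = 0" using pointed FC by blast
  note P = pentagon_of_cone[of "S \<inter> F", unfolded hullF, OF finite_Int[OF disjI1[OF fin]] F(2,3) pF]
  obtain c :: "nat \<Rightarrow> 'a" and a b \<alpha> \<beta> \<gamma> G where c: "\<forall>i<5. c i \<in> F"
    "c 0 = c 1 - c 2 + c 3" "c 4 = a *\<^sub>R c 1 - c 2 + b *\<^sub>R c 3" "0 < a" "a < 1" "1 < b"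
    and lins: "linear \<alpha>" "linear \<beta>" "linear \<gamma>"
    and co: "\<alpha> (c 1) = 1" "\<beta> (c 1) = 0" "\<gamma> (c 1) = 0" "\<alpha> (c 2) = 0" "\<beta> (c 2) = 1" "\<gamma> (c 2) = 0"
      "\<alpha> (c 3) = 0" "\<beta> (c 3) = 0" "\<gamma> (c 3) = 1"
    and G: "finite G" "\<forall>z\<in>G. pentagonal a b z"
      "\<forall>x\<in>F. (\<alpha> x, \<beta> x, \<gamma> x) \<in> convex_cone hull G"
    using P by (elim exE conjE) (rule that)
  have cF: "c i \<in> F" if "i < 5" for i using c(1) that by simp
  show ?thesis
  proof (rule pentagonal_not_subhomogeneous[OF fin C u _ c(2-6) lins l(1) co(1-3) _ co(4-6) _ co(7-9) _ G(1)])
    show "c i \<in> C" if "i < 5" for i using cF[OF that] FC by blast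
    show "l (c 1) = 0" "l (c 2) = 0" "l (c 3) = 0"
      using l(3)[of "c 1"] l(3)[of "c 2"] l(3)[of "c 3"] cF[of 1] cF[of 2] cF[of 3] FC by auto
    show "pentagonal a b z" if "z \<in> G" for z using G(2) that by blast
    fix x assume "x \<in> S"
    then have "x \<in> C" unfolding C by (rule hull_inc)
    then show "0 < l x \<or> (l x = 0 \<and> (\<alpha> x, \<beta> x, \<gamma> x) \<in> convex_cone hull G)"
      using l(2,3)[of x] G(3) by force
  qed
qed

lemma cone_span_diff:
  assumes "convex_cone F" "x \<in> span F"
  shows "\<exists>p\<in>F. \<exists>q\<in>F. x = p - q"
  using assms(2)
proof (induction rule: span_induct_alt)
  case base
  have "0 \<in> F" using assms(1) by (rule convex_cone_contains_0)
  then show ?case by (intro bexI[of _ 0]) simp_all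
next
  case (step r y z)
  then obtain p q where pq: "p \<in> F" "q \<in> F" "z = p - q" by blast
  show ?case
  proof (cases "0 \<le> r")
    case True
    then have "r *\<^sub>R y + p \<in> F" using pq step assms(1) by (intro convex_cone_add convex_cone_scaleR)
    then show ?thesis using pq by (intro bexI[of _ "r *\<^sub>R y + p"] bexI[of _ q]) simp_all
  next
    case False
    then have "(- r) *\<^sub>R y + q \<in> F" using pq step assms(1) by (intro convex_cone_add convex_cone_scaleR) auto
    then show ?thesis using pq by (intro bexI[of _ p] bexI[of _ "(- r) *\<^sub>R y + q"]) simp_all
  qed
qed

text \<open>
  The relations between the five rays of the quotient hold in \<open>C\<close> only modulo \<open>span F\<close>. Moving the
  lift of the second ray by an element of \<open>F\<close> makes both of them exact.
\<close>

lemma quotient_case: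
  fixes C :: "'a::euclidean_space set" and q :: "'a \<Rightarrow> 'a"
  assumes fin: "finite S" and C: "C = convex_cone hull S" and u: "u \<in> C"
    and pointed: "\<And>x. x \<in> C \<Longrightarrow> - x \<in> C \<Longrightarrow> x = 0"
    and F: "cone_face F C" and q: "linear_quotient (span F) q"
    and dim: "dim (span (q ` C)) = 3" and card: "5 \<le> card (extreme_rays (q ` C))"
  shows "\<not> subhomogeneous TYPE('b::comm_cstar_algebra) (min_cone C) u"
proof -
  have lq: "linear q" and ker: "\<And>x. q x = 0 \<longleftrightarrow> x \<in> span F" using q by (auto simp: linear_quotient_def)
  have cone: "convex_cone C" unfolding C by (rule convex_cone_convex_cone_hull)
  have Fc: "F \<subseteq> C" "convex_cone F" and face: "\<And>x y. x \<in> C \<Longrightarrow> y \<in> C \<Longrightarrow> x + y \<in> F \<Longrightarrow> x \<in> F \<and> y \<in> F"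
    using F by (auto simp: cone_face_def)
  \<comment> \<open>C \<inter> span F = F: an element p - r of C with p, r in F lands in F after
    adding r.\<close>
  have spanF: "x \<in> F" if "x \<in> C" "x \<in> span F" for x
  proof -
    obtain p r where "p \<in> F" "r \<in> F" "x = p - r" using cone_span_diff[OF Fc(2) \<open>x \<in> span F\<close>] by blast
    then have "x + r \<in> F" "r \<in> C" using Fc by auto
    then show ?thesis using face that by blast
  qed
  have hullq: "convex_cone hull (q ` S) = q ` C" unfolding C by (rule convex_cone_hull_linear_image[OF lq])
  \<comment> \<open>The quotient cone is pointed: representatives of x and - x add up to an element
    of F, so each of them lies in F.\<close>
  have pq: "x = 0" if "x \<in> q ` C" "- x \<in> q ` C" for x
  proof -
    obtain y z where yz: "y \<in> C" "x = q y" "z \<in> C" "- x = q z" using \<open>x \<in> q ` C\<close> \<open>- x \<in> q ` C\<close> by (auto simp: image_iff)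
    have "q (y + z) = x + - x"
      by (simp only: linear_add[OF lq] yz(2)[symmetric] yz(4)[symmetric])
    then have "y + z \<in> span F" by (simp add: ker[symmetric])
    then have "y + z \<in> F" by (rule spanF[OF convex_cone_add[OF cone yz(1,3)]])
    then have "y \<in> F" using face[OF yz(1,3)] by simp
    then have "q y = 0" by (simp add: ker span_base)
    then show ?thesis by (simp only: yz(2))
  qed
  have pq': "\<forall>x\<in>q ` C. - x \<in> q ` C \<longrightarrow> x = 0" using pq by blast
  note P = pentagon_of_cone[of "q ` S", unfolded hullq, OF finite_imageI[OF fin] dim card pq']
  obtain c :: "nat \<Rightarrow> 'a" and a b \<alpha> \<beta> \<gamma> G where c: "\<forall>i<5. c i \<in> q ` C"
    "c 0 = c 1 - c 2 + c 3" "c 4 = a *\<^sub>R c 1 - c 2 + b *\<^sub>R c 3" "0 < a" "a < 1" "1 < b"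
    and lins: "linear \<alpha>" "linear \<beta>" "linear \<gamma>"
    and co: "\<alpha> (c 1) = 1" "\<beta> (c 1) = 0" "\<gamma> (c 1) = 0" "\<alpha> (c 2) = 0" "\<beta> (c 2) = 1" "\<gamma> (c 2) = 0"
      "\<alpha> (c 3) = 0" "\<beta> (c 3) = 0" "\<gamma> (c 3) = 1"
    and G: "finite G" "\<forall>z\<in>G. pentagonal a b z"
      "\<forall>x\<in>q ` C. (\<alpha> x, \<beta> x, \<gamma> x) \<in> convex_cone hull G"
    using P by (elim exE conjE) (rule that)
  have "\<exists>e. \<forall>i\<in>{..<5}. e i \<in> C \<and> q (e i) = c i"
  proof (intro bchoice ballI)
    fix i :: nat assume "i \<in> {..<5}"
    then have "c i \<in> q ` C" using c(1) by simp
    then show "\<exists>x. x \<in> C \<and> q x = c i" by (elim imageE) (intro exI conjI, assumption, simp)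
  qed
  then obtain e where e: "\<And>i. i < 5 \<Longrightarrow> e i \<in> C \<and> q (e i) = c i" by auto
  note lqs = linear_add[OF lq] linear_diff[OF lq] linear_scale[OF lq]
  have "q (e 0 - (e 1 - e 2 + e 3)) = 0" "q (e 4 - (a *\<^sub>R e 1 - e 2 + b *\<^sub>R e 3)) = 0"
    using c(2,3) e by (simp_all add: lqs del: One_nat_def)
  then have "e 0 - (e 1 - e 2 + e 3) \<in> span F" "e 4 - (a *\<^sub>R e 1 - e 2 + b *\<^sub>R e 3) \<in> span F"
    by (simp_all only: ker)
  note d = this[THEN cone_span_diff[OF Fc(2)]]
  obtain g1 g2 where "g1 \<in> F" "g2 \<in> F" and g: "e 0 - (e 1 - e 2 + e 3) = g1 - g2" using d(1) by (elim bexE)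
  moreover obtain h1 h2 where "h1 \<in> F" "h2 \<in> F" and h: "e 4 - (a *\<^sub>R e 1 - e 2 + b *\<^sub>R e 3) = h1 - h2"
    using d(2) by (elim bexE)
  ultimately have gF: "g1 \<in> F" "g2 \<in> F" "h1 \<in> F" "h2 \<in> F" by simp_all
  \<comment> \<open>The errors of the two relations are g1 - g2 and h1 - h2. Adding s to
    \<open>e 1\<close> absorbs g1 in the first and h1 in the second, so the corrections left for
    \<open>e 0\<close> and \<open>e 4\<close> are sums of elements of F and stay in C.\<close>
  define s where "s = g1 + (1 / a) *\<^sub>R h1"
  have sF: "s \<in> F" unfolding s_def using gF c(4) Fc(2) by (intro convex_cone_add convex_cone_scaleR) auto
  have qF: "q x = 0" if "x \<in> F" for x using that by (simp add: ker span_base)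
  define e' where "e' i = (if i = 0 then e 0 + (g2 + (1 / a) *\<^sub>R h1) else if i = 1 then e 1 + s
    else if i = 4 then e 4 + (h2 + a *\<^sub>R g1) else e i)" for i :: nat
  have e'C: "e' i \<in> C" if "i < 5" for i
  proof -
    have add: "x + y \<in> C" if "x \<in> C" "y \<in> C" for x y using cone that by (rule convex_cone_add)
    have gC: "g1 \<in> C" "g2 \<in> C" "h1 \<in> C" "h2 \<in> C" "s \<in> C" using gF sF Fc(1) by blast+
    have "(1 / a) *\<^sub>R h1 \<in> C" "a *\<^sub>R g1 \<in> C"
      using c(4) gC by (simp_all add: convex_cone_scaleR[OF cone])
    then have "g2 + (1 / a) *\<^sub>R h1 \<in> C" "h2 + a *\<^sub>R g1 \<in> C" using gC by (simp_all add: add)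
    then have "e 0 + (g2 + (1 / a) *\<^sub>R h1) \<in> C" "e 1 + s \<in> C" "e 4 + (h2 + a *\<^sub>R g1) \<in> C" "e i \<in> C"
      using e[of 0] e[of 1] e[of 4] e[OF that] gC by (simp_all add: add del: One_nat_def)
    then show ?thesis unfolding e'_def by (simp del: One_nat_def)
  qed
  have e'q: "q (e' 1) = c 1" "q (e' 2) = c 2" "q (e' 3) = c 3"
    using e by (simp_all add: e'_def lqs qF[OF sF] del: One_nat_def)
  have rel0: "e' 0 = e' 1 - e' 2 + e' 3"
  proof -
    have "e 0 = (e 1 - e 2 + e 3) + (g1 - g2)" using g by (simp add: algebra_simps)
    then show ?thesis by (simp add: e'_def s_def)
  qed
  have rel4: "e' 4 = a *\<^sub>R e' 1 - e' 2 + b *\<^sub>R e' 3"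
  proof -
    have "e 4 = (a *\<^sub>R e 1 - e 2 + b *\<^sub>R e 3) + (h1 - h2)" using h by (simp add: algebra_simps)
    then show ?thesis using c(4) by (simp add: e'_def s_def scaleR_add_right)
  qed
  have lin: "linear (\<lambda>x. \<alpha> (q x))" "linear (\<lambda>x. \<beta> (q x))" "linear (\<lambda>x. \<gamma> (q x))"
    using linear_compose[OF lq lins(1)] linear_compose[OF lq lins(2)] linear_compose[OF lq lins(3)] by (simp_all add: o_def)
  show ?thesis
  \<comment> \<open>With \<open>l\<close> = 0 no generator is exempt: coordinates are read off in
    the quotient, where the hull of \<open>G\<close> contains those of the whole cone.\<close>
  proof (rule pentagonal_not_subhomogeneous[OF fin C u e'C rel0 rel4 c(4-6) lin, where l = "\<lambda>_. 0" and G = G])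
    show "linear (\<lambda>_::'a. 0::real)" by (rule linearI) simp_all
    show "pentagonal a b z" if "z \<in> G" for z using G(2) that by blast
    show "0 < (0::real) \<or> (0::real) = 0 \<and> (\<alpha> (q x), \<beta> (q x), \<gamma> (q x)) \<in> convex_cone hull G" if "x \<in> S" for x
      using G(3) that by (simp add: C hull_inc)
  qed (use G(1) co in \<open>simp_all only: e'q\<close>)
qed

theorem corollary4p3:
  fixes C :: "'a::euclidean_space set" and u :: 'a
  assumes "proper_polyhedral_cone C"
    and "u \<in> interior C"
    and "(\<exists>F. cone_face F C \<and> dim (span F) = 3 \<and> 5 \<le> card (extreme_rays F)) \<or>
         (\<exists>F (q :: 'a \<Rightarrow> 'a). cone_face F C \<and> linear_quotient (span F) q \<and>
            dim (span (q ` C)) = 3 \<and> 5 \<le> card (extreme_rays (q ` C)))"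
  shows "\<not> subhomogeneous TYPE('b::comm_cstar_algebra) (min_cone C) u"
proof -
  obtain S where S: "finite S" "C = convex_cone hull S" and p: "C \<inter> uminus ` C = {0}"
    using assms(1) by (auto simp: proper_polyhedral_cone_def)
  have pointed: "x = 0" if "x \<in> C" "- x \<in> C" for x
  proof -
    have "x \<in> uminus ` C" using that(2) by (metis add.inverse_inverse imageI)
    then show ?thesis using p that(1) by blast
  qed
  have u: "u \<in> C" using assms(2) interior_subset by blast
  from assms(3) show ?thesis
    using face_case[OF S u pointed] quotient_case[OF S u pointed] by blast
qed

end
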